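(* Let $\varphi\in\mathrm{BMOA}^{(2)}$. Then for any $\ell^2$-column-vector-valued function $f\in H^1(\ell^2)$, $$\Big\|\Big(\int_{\mathbb{T}}\big[(f*\varphi)(f*\varphi)^*\big]\,dm\Big)^{1/2}\Big\|_{S_{4/3}}\le\|\varphi\|_{\mathrm{BMOA}^{(2)}}\cdot\|f\|_{H^1(\ell^2)} .$$
   Context: $\mathbb{T}$ is the unit circle with normalized Haar measure $m$. $H^1(\ell^2)$ is the space of $f\in L^1(\mathbb{T};\ell^2)$ with $\widehat f(n)=0$ for $n<0$. $\ell^2$-vectors are regarded as columns, so $vv^*$ is a rank-one operator on $\ell^2$; $f*\varphi=\sum_{n\ge0}\widehat\varphi(n)\widehat f(n)e^{in\theta}$, so that $\int_{\mathbb{T}}(f*\varphi)(f*\varphi)^*dm=\sum_{n\ge0}|\widehat\varphi(n)|^2\widehat f(n)\widehat f(n)^*$. $S_p$ is the Schatten–von Neumann class of operators on $\ell^2$. $\mathrm{BMOA}:=L^\infty(\mathbb{T})/\overline{H_0^\infty}$ with the quotient norm, where $\overline{H_0^\infty}=\{f\in L^\infty(\mathbb{T}):\widehat f(n)=0\ \forall n\ge0\}$; the class of $\psi\in L^\infty$ is identified with $\sum_{n\ge0}\widehat\psi(n)e^{in\theta}$. $\mathrm{BMOA}^{(2)}$ is the space of formal series $\varphi=\sum_{n\ge0}\widehat\varphi(n)e^{in\theta}$ with $\|\varphi\|_{\mathrm{BMOA}^{(2)}}:=\big\|\sum_{n\ge0}|\widehat\varphi(n)|^2e^{in\theta}\big\|_{\mathrm{BMOA}}^{1/2}<\infty$.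 *)

theory Defs
  imports "HOL-Probability.Probability"
begin

section \<open>The complex Hilbert space of square-summable sequences\<close>

typedef ell2 = "{x :: nat \<Rightarrow> complex. summable (\<lambda>k. (cmod (x k))\<^sup>2)}"
  morphisms ell2_nth Abs_ell2
  by (rule exI[of _ "\<lambda>_. 0"]) simp

lemma ell2_summable: "summable (\<lambda>k. (cmod (ell2_nth x k))\<^sup>2)"
  using ell2_nth by blast

lemma ell2_eqI: "(\<And>k. ell2_nth x k = ell2_nth y k) \<Longrightarrow> x = y"
  by (simp add: ell2_nth_inject[symmetric] ext)

lemma ell2_nth_Abs: "summable (\<lambda>k. (cmod (x k))\<^sup>2) \<Longrightarrow> ell2_nth (Abs_ell2 x) = x"
  by (simp add: Abs_ell2_inverse)

lemma cmod_add_square_le: "(cmod (a + b))\<^sup>2 \<le> 2 * (cmod a)\<^sup>2 + 2 * (cmod b)\<^sup>2"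
proof -
  have "(cmod (a + b))\<^sup>2 \<le> (cmod a + cmod b)\<^sup>2"
    by (intro power_mono norm_triangle_ineq) simp
  also have "\<dots> \<le> 2 * (cmod a)\<^sup>2 + 2 * (cmod b)\<^sup>2"
    using zero_le_power2[of "cmod a - cmod b"] by (simp add: power2_eq_square algebra_simps)
  finally show ?thesis .
qed

lemma square_summable_add:
  assumes "summable (\<lambda>k. (cmod (x k))\<^sup>2)" "summable (\<lambda>k. (cmod (y k))\<^sup>2)"
  shows "summable (\<lambda>k. (cmod (x k + y k))\<^sup>2)"
proof (rule summable_comparison_test')
  show "summable (\<lambda>k. 2 * (cmod (x k))\<^sup>2 + 2 * (cmod (y k))\<^sup>2)"
    using assms by (intro summable_add summable_mult)
qed (use cmod_add_square_le in simp)

lemma square_summable_scale: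
  "summable (\<lambda>k. (cmod (x k))\<^sup>2) \<Longrightarrow> summable (\<lambda>k. (cmod (c * x k))\<^sup>2)"
  by (simp add: norm_mult power_mult_distrib summable_mult)

lemma square_summable_mult:
  assumes "summable (\<lambda>k. (cmod (x k))\<^sup>2)" "summable (\<lambda>k. (cmod (y k))\<^sup>2)"
  shows "summable (\<lambda>k. cnj (x k) * y k)"
proof (rule summable_comparison_test')
  show "summable (\<lambda>k. (cmod (x k))\<^sup>2 + (cmod (y k))\<^sup>2)"
    using assms by (intro summable_add)
  fix k
  have "0 \<le> cmod (x k) * cmod (y k)"
    by simp
  then show "norm (cnj (x k) * y k) \<le> (cmod (x k))\<^sup>2 + (cmod (y k))\<^sup>2"
    using sum_squares_bound[of "cmod (x k)" "cmod (y k)"] unfolding norm_mult complex_mod_cnj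
    by linarith
qed

definition scaleC_ell2 :: "complex \<Rightarrow> ell2 \<Rightarrow> ell2"  (infixr "*\<^sub>C" 75)
  where "c *\<^sub>C x = Abs_ell2 (\<lambda>k. c * ell2_nth x k)"

text \<open>Conjugate linear in the first argument, so that \<open>cinner v x\<close> is the number
  \<open>v\<^sup>* x\<close> for columns \<open>v\<close> and \<open>x\<close>.\<close>

definition cinner_ell2 :: "ell2 \<Rightarrow> ell2 \<Rightarrow> complex"
  where "cinner_ell2 v x = (\<Sum>k. cnj (ell2_nth v k) * ell2_nth x k)"

instantiation ell2 :: real_vector
begin
definition "0 = Abs_ell2 (\<lambda>_. 0)"
definition "x + y = Abs_ell2 (\<lambda>k. ell2_nth x k + ell2_nth y k)"
definition "- x = Abs_ell2 (\<lambda>k. - ell2_nth x k)"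
definition "x - y = Abs_ell2 (\<lambda>k. ell2_nth x k - ell2_nth y k)"
definition "r *\<^sub>R x = Abs_ell2 (\<lambda>k. of_real r * ell2_nth x k)"

lemma ell2_nth_simps [simp]:
  "ell2_nth 0 k = 0"
  "ell2_nth (x + y) k = ell2_nth x k + ell2_nth y k"
  "ell2_nth (- x) k = - ell2_nth x k"
  "ell2_nth (x - y) k = ell2_nth x k - ell2_nth y k"
  "ell2_nth (r *\<^sub>R x) k = of_real r * ell2_nth x k"
  "ell2_nth (c *\<^sub>C x) k = c * ell2_nth x k"
proof -
  show "ell2_nth (x - y) k = ell2_nth x k - ell2_nth y k"
    using square_summable_add[OF ell2_summable[of x], of "\<lambda>k. - ell2_nth y k"] ell2_summable[of y]
    by (simp add: minus_ell2_def ell2_nth_Abs)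
  show "ell2_nth (r *\<^sub>R x) k = of_real r * ell2_nth x k"
    using square_summable_scale[OF ell2_summable[of x], of "of_real r"]
    by (simp add: scaleR_ell2_def ell2_nth_Abs)
qed (simp_all add: zero_ell2_def plus_ell2_def uminus_ell2_def scaleC_ell2_def
      ell2_nth_Abs ell2_summable square_summable_add square_summable_scale)

instance
  by standard (auto intro!: ell2_eqI simp: algebra_simps)
end

lemma summable_cinner_ell2: "summable (\<lambda>k. cnj (ell2_nth x k) * ell2_nth y k)"
  by (intro square_summable_mult ell2_summable)

lemma cinner_ell2_self: "cinner_ell2 x x = of_real (\<Sum>k. (cmod (ell2_nth x k))\<^sup>2)"
proof -
  have "cnj z * z = of_real ((cmod z)\<^sup>2)" for z
    using complex_norm_square[of z] by (simp add: mult.commute)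
  then show ?thesis
    by (simp only: cinner_ell2_def suminf_of_real[OF ell2_summable])
qed

instantiation ell2 :: real_inner
begin
definition "inner x y = Re (cinner_ell2 x y)"
definition norm_ell2_def': "norm x = sqrt (inner x (x :: ell2))"
definition "sgn x = inverse (norm x) *\<^sub>R (x :: ell2)"
definition "dist x y = norm (x - y :: ell2)"
definition "(uniformity :: (ell2 \<times> ell2) filter) = (INF e\<in>{0<..}. principal {(x, y). dist x y < e})"
definition "open U = (\<forall>x\<in>U. \<forall>\<^sub>F (x', y) in uniformity. x' = x \<longrightarrow> (y :: ell2) \<in> U)"

lemma inner_ell2_suminf: "inner x y = (\<Sum>k. Re (cnj (ell2_nth x k) * ell2_nth y k))"
  unfolding inner_ell2_def cinner_ell2_def
  by (rule Re_suminf[OF summable_cinner_ell2])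

lemma summable_inner_ell2: "summable (\<lambda>k. Re (cnj (ell2_nth x k) * ell2_nth y k))"
  using summable_Re[OF summable_cinner_ell2] .

instance
proof
  fix x y z :: ell2 and r :: real
  show "inner x y = inner y x"
    by (simp add: inner_ell2_suminf mult.commute)
  show "inner (x + y) z = inner x z + inner y z"
    unfolding inner_ell2_suminf suminf_add[OF summable_inner_ell2 summable_inner_ell2]
    by (simp add: algebra_simps)
  show "inner (r *\<^sub>R x) y = r * inner x y"
    unfolding inner_ell2_suminf suminf_mult[OF summable_inner_ell2, symmetric]
    by (simp add: algebra_simps)
  show "0 \<le> inner x x"
    by (simp add: inner_ell2_def cinner_ell2_self suminf_nonneg ell2_summable)
  show "inner x x = 0 \<longleftrightarrow> x = 0"
    using suminf_eq_zero_iff[OF ell2_summable[of x]]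
    by (auto simp: inner_ell2_def cinner_ell2_self intro: ell2_eqI)
qed (simp_all add: norm_ell2_def' sgn_ell2_def dist_ell2_def uniformity_ell2_def open_ell2_def)
end

lemma norm_ell2_def: "norm x = sqrt (\<Sum>k. (cmod (ell2_nth x k))\<^sup>2)"
  by (simp add: norm_ell2_def' inner_ell2_def cinner_ell2_self)

lemma norm_ell2_le:
  assumes "0 \<le> e" "\<And>N. (\<Sum>k<N. (cmod (ell2_nth x k))\<^sup>2) \<le> e\<^sup>2"
  shows "norm x \<le> e"
  unfolding norm_ell2_def using assms
  by (intro real_le_lsqrt suminf_le_const ell2_summable) auto

lemma sum_le_norm_ell2: "(\<Sum>k<N. (cmod (ell2_nth x k))\<^sup>2) \<le> (norm x)\<^sup>2"
  unfolding norm_ell2_def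
  by (simp add: suminf_nonneg ell2_summable sum_le_suminf)

lemma cmod_nth_le_norm_ell2: "cmod (ell2_nth x k) \<le> norm x"
proof -
  have "(cmod (ell2_nth x k))\<^sup>2 \<le> (\<Sum>j<Suc k. (cmod (ell2_nth x j))\<^sup>2)"
    by (simp add: sum_nonneg)
  also have "\<dots> \<le> (norm x)\<^sup>2"
    by (rule sum_le_norm_ell2)
  finally show ?thesis
    by (rule power2_le_imp_le) simp
qed

instance ell2 :: banach
proof
  fix X :: "nat \<Rightarrow> ell2"
  assume X: "Cauchy X"
  have "Cauchy (\<lambda>n. ell2_nth (X n) k)" for k
  proof (rule metric_CauchyI)
    fix e :: real assume "0 < e"
    with X obtain M where M: "\<And>m n. m \<ge> M \<Longrightarrow> n \<ge> M \<Longrightarrow> dist (X m) (X n) < e"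
      unfolding Cauchy_def by blast
    have "dist (ell2_nth (X m) k) (ell2_nth (X n) k) < e" if "m \<ge> M" "n \<ge> M" for m n
      using cmod_nth_le_norm_ell2[of "X m - X n" k] M[OF that]
      by (simp add: dist_norm)
    then show "\<exists>M. \<forall>m\<ge>M. \<forall>n\<ge>M. dist (ell2_nth (X m) k) (ell2_nth (X n) k) < e"
      by blast
  qed
  then have "\<exists>c. (\<lambda>n. ell2_nth (X n) k) \<longlonglongrightarrow> c" for k
    using Cauchy_convergent[unfolded convergent_def] by blast
  then obtain l where l: "\<And>k. (\<lambda>n. ell2_nth (X n) k) \<longlonglongrightarrow> l k"
    using choice[of "\<lambda>k c. (\<lambda>n. ell2_nth (X n) k) \<longlonglongrightarrow> c"] by blast
  have bound: "\<exists>M. \<forall>m\<ge>M. \<forall>N. (\<Sum>k<N. (cmod (ell2_nth (X m) k - l k))\<^sup>2) \<le> e\<^sup>2" if "0 < e" for e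
  proof -
    obtain M where M: "\<And>m n. m \<ge> M \<Longrightarrow> n \<ge> M \<Longrightarrow> dist (X m) (X n) < e"
      using X \<open>0 < e\<close> unfolding Cauchy_def by blast
    have "(\<Sum>k<N. (cmod (ell2_nth (X m) k - l k))\<^sup>2) \<le> e\<^sup>2" if "m \<ge> M" for m N
    proof (rule LIMSEQ_le_const2)
      show "(\<lambda>n. \<Sum>k<N. (cmod (ell2_nth (X m) k - ell2_nth (X n) k))\<^sup>2)
              \<longlonglongrightarrow> (\<Sum>k<N. (cmod (ell2_nth (X m) k - l k))\<^sup>2)"
        by (intro tendsto_intros l)
      have "(\<Sum>k<N. (cmod (ell2_nth (X m) k - ell2_nth (X n) k))\<^sup>2) \<le> e\<^sup>2" if "n \<ge> M" for n
      proof -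
        have "(\<Sum>k<N. (cmod (ell2_nth (X m - X n) k))\<^sup>2) \<le> (norm (X m - X n))\<^sup>2"
          by (rule sum_le_norm_ell2)
        also have "\<dots> \<le> e\<^sup>2"
          using M[OF \<open>m \<ge> M\<close> that] by (intro power_mono) (auto simp: dist_norm)
        finally show ?thesis by simp
      qed
      then show "\<exists>n0. \<forall>n\<ge>n0. (\<Sum>k<N. (cmod (ell2_nth (X m) k - ell2_nth (X n) k))\<^sup>2) \<le> e\<^sup>2"
        by blast
    qed
    then show ?thesis by blast
  qed
  obtain m where m: "\<And>N. (\<Sum>k<N. (cmod (ell2_nth (X m) k - l k))\<^sup>2) \<le> 1"
    using bound[of 1] by auto
  have "summable (\<lambda>k. (cmod (ell2_nth (X m) k - l k))\<^sup>2)"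
    by (rule bounded_imp_summable[of _ 1])
       (use m in \<open>simp_all add: lessThan_Suc_atMost[symmetric] del: sum.lessThan_Suc\<close>)
  then have "summable (\<lambda>k. (cmod (- 1 * (ell2_nth (X m) k - l k)))\<^sup>2)"
    by (rule square_summable_scale)
  from square_summable_add[OF ell2_summable[of "X m"] this]
  have L: "summable (\<lambda>k. (cmod (l k))\<^sup>2)"
    by simp
  have "X \<longlonglongrightarrow> Abs_ell2 l"
  proof (rule metric_LIMSEQ_I)
    fix e :: real assume "0 < e"
    then obtain M where M: "\<And>m N. m \<ge> M \<Longrightarrow> (\<Sum>k<N. (cmod (ell2_nth (X m) k - l k))\<^sup>2) \<le> (e/2)\<^sup>2"
      using bound[of "e/2"] by auto
    have "dist (X n) (Abs_ell2 l) < e" if "n \<ge> M" for n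
    proof -
      have "norm (X n - Abs_ell2 l) \<le> e/2"
        using M[OF that] \<open>0 < e\<close> by (intro norm_ell2_le) (simp_all add: ell2_nth_Abs[OF L])
      then show ?thesis
        using \<open>0 < e\<close> by (simp add: dist_norm)
    qed
    then show "\<exists>no. \<forall>n\<ge>no. dist (X n) (Abs_ell2 l) < e"
      by blast
  qed
  then show "convergent X"
    by (auto simp: convergent_def)
qed

lemma ell2_finite_nth: "finite {k. x k \<noteq> 0} \<Longrightarrow> ell2_nth (Abs_ell2 x) = x"
  by (rule ell2_nth_Abs, rule summable_finite[of "{k. x k \<noteq> 0}"]) auto

lemma ell2_countable_dense:
  "\<exists>D :: ell2 set. countable D \<and> (\<forall>x. \<forall>e>0. \<exists>d\<in>D. dist d x < e)"
proof -
  obtain Q :: "complex set" where Q: "countable Q" "\<And>U. open U \<Longrightarrow> U \<noteq> {} \<Longrightarrow> \<exists>d\<in>Q. d \<in> U"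
    using countable_dense_exists by blast
  define D where "D = (\<lambda>w. Abs_ell2 (\<lambda>k. if k < length w then w ! k else 0)) ` lists Q"
  have nth: "ell2_nth (Abs_ell2 (\<lambda>k. if k < length w then w ! k else 0))
      = (\<lambda>k. if k < length w then w ! k else 0)" for w :: "complex list"
    by (rule ell2_finite_nth, rule finite_subset[of _ "{..<length w}"]) (auto split: if_splits)
  have "\<exists>d\<in>D. dist d x < e" if "0 < e" for x e
  proof -
    let ?s = "\<lambda>k. (cmod (ell2_nth x k))\<^sup>2"
    have "(\<lambda>n. \<Sum>k<n. ?s k) \<longlonglongrightarrow> (\<Sum>k. ?s k)"
      using summable_LIMSEQ[OF ell2_summable] .
    moreover have e8: "0 < e\<^sup>2 / 8" using that by simp
    ultimately obtain n where n: "\<bar>(\<Sum>k<n. ?s k) - (\<Sum>k. ?s k)\<bar> < e\<^sup>2 / 8"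
      by (metis LIMSEQ_def dist_real_def order_refl)
    define \<delta> where "\<delta> = e / (4 * (real n + 1))"
    have \<delta>: "0 < \<delta>" using that by (simp add: \<delta>_def)
    have "\<exists>q\<in>Q. cmod (q - ell2_nth x k) < \<delta>" for k
      using Q(2)[of "ball (ell2_nth x k) \<delta>"] \<delta> by (auto simp: dist_norm norm_minus_commute)
    then obtain q where q: "\<And>k. q k \<in> Q" "\<And>k. cmod (q k - ell2_nth x k) < \<delta>"
      by metis
    define d where "d = Abs_ell2 (\<lambda>k. if k < length (map q [0..<n]) then map q [0..<n] ! k else 0)"
    have "d \<in> D"
      unfolding D_def d_def by (rule imageI) (use q(1) in auto)
    have dk: "ell2_nth d k = (if k < n then q k else 0)" for k
      unfolding d_def nth by simp
    have "norm (d - x) \<le> e / 2"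
    proof (rule norm_ell2_le)
      fix N
      have "(\<Sum>k<N. (cmod (ell2_nth (d - x) k))\<^sup>2) \<le> (\<Sum>k<N + n. (cmod (ell2_nth (d - x) k))\<^sup>2)"
        by (intro sum_mono2) auto
      also have "\<dots> = (\<Sum>k<n. (cmod (ell2_nth (d - x) k))\<^sup>2)
          + (\<Sum>k=n..<N + n. (cmod (ell2_nth (d - x) k))\<^sup>2)"
        using sum.atLeastLessThan_concat[of 0 n "N + n" "\<lambda>k. (cmod (ell2_nth (d - x) k))\<^sup>2"]
        by (simp add: atLeast0LessThan)
      also have "(\<Sum>k=n..<N + n. (cmod (ell2_nth (d - x) k))\<^sup>2) = (\<Sum>k=n..<N + n. ?s k)"
        by (intro sum.cong) (auto simp: dk)
      finally have split: "(\<Sum>k<N. (cmod (ell2_nth (d - x) k))\<^sup>2)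
          \<le> (\<Sum>k<n. (cmod (ell2_nth (d - x) k))\<^sup>2) + (\<Sum>k=n..<N + n. ?s k)" .
      have tail: "(\<Sum>k=n..<N + n. ?s k) \<le> e\<^sup>2 / 8"
      proof -
        have "(\<Sum>k<n. ?s k) + (\<Sum>k=n..<N + n. ?s k) = (\<Sum>k<N + n. ?s k)"
          using sum.atLeastLessThan_concat[of 0 n "N + n" ?s] by (simp add: atLeast0LessThan)
        moreover have "(\<Sum>k<N + n. ?s k) \<le> (\<Sum>k. ?s k)"
          by (intro sum_le_suminf ell2_summable) auto
        ultimately show ?thesis using n by linarith
      qed
      have "(\<Sum>k<n. (cmod (ell2_nth (d - x) k))\<^sup>2) \<le> (\<Sum>k<n. \<delta>\<^sup>2)"
      proof (intro sum_mono)
        fix k assume "k \<in> {..<n}"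
        then have "ell2_nth (d - x) k = q k - ell2_nth x k" by (simp add: dk)
        then show "(cmod (ell2_nth (d - x) k))\<^sup>2 \<le> \<delta>\<^sup>2"
          using q(2)[of k] by (metis norm_ge_zero less_imp_le power_mono)
      qed
      also have "(\<Sum>k<n. \<delta>\<^sup>2) \<le> e\<^sup>2 / 16"
      proof -
        have "real n \<le> (real n + 1)\<^sup>2"
          by (simp add: power2_eq_square algebra_simps)
        then have "real n * (e\<^sup>2 / (16 * (real n + 1)\<^sup>2)) \<le> (real n + 1)\<^sup>2 * (e\<^sup>2 / (16 * (real n + 1)\<^sup>2))"
          by (intro mult_right_mono) auto
        also have "\<dots> = e\<^sup>2 / 16"
          by (simp add: add_nonneg_eq_0_iff)
        also have "e\<^sup>2 / (16 * (real n + 1)\<^sup>2) = \<delta>\<^sup>2"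
          unfolding \<delta>_def power_divide power_mult_distrib by simp
        finally show ?thesis
          by simp
      qed
      finally have "(\<Sum>k<n. (cmod (ell2_nth (d - x) k))\<^sup>2) \<le> e\<^sup>2 / 16" .
      moreover have "(e / 2)\<^sup>2 = e\<^sup>2 / 4"
        by (simp add: power_divide)
      ultimately show "(\<Sum>k<N. (cmod (ell2_nth (d - x) k))\<^sup>2) \<le> (e / 2)\<^sup>2"
        using split tail zero_le_power2[of e] by linarith
    qed (use that in simp)
    then show ?thesis
      using \<open>d \<in> D\<close> that by (intro bexI[of _ d]) (simp_all add: dist_norm)
  qed
  moreover have "countable D"
    unfolding D_def using Q(1) by simp
  ultimately show ?thesis by blast
qed

instance ell2 :: second_countable_topology
proof
  obtain D :: "ell2 set" where D: "countable D" "\<And>x e. 0 < e \<Longrightarrow> \<exists>d\<in>D. dist d x < e"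
    using ell2_countable_dense by blast
  define B where "B = (\<lambda>(d, n). ball d (inverse (real (Suc n)))) ` (D \<times> UNIV)"
  have "topological_basis B"
  proof (rule topological_basisI)
    fix U :: "ell2 set" and x assume "open U" "x \<in> U"
    then obtain e where e: "0 < e" "ball x e \<subseteq> U"
      by (auto simp: open_contains_ball)
    obtain n where n: "inverse (real (Suc n)) < e / 2"
      using reals_Archimedean[of "e/2"] e(1) by auto
    obtain d where d: "d \<in> D" "dist d x < inverse (real (Suc n))"
      using D(2)[of "inverse (real (Suc n))" x] by auto
    have "ball d (inverse (real (Suc n))) \<subseteq> ball x e"
    proof
      fix y assume "y \<in> ball d (inverse (real (Suc n)))"
      then have "dist d y < inverse (real (Suc n))" by simp
      moreover have "dist x y \<le> dist d x + dist d y"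
        by (metis dist_commute dist_triangle)
      ultimately have "dist x y < e" using d(2) n by linarith
      then show "y \<in> ball x e" by simp
    qed
    moreover have "ball d (inverse (real (Suc n))) \<in> B"
      unfolding B_def using d(1) by auto
    ultimately show "\<exists>B'\<in>B. x \<in> B' \<and> B' \<subseteq> U"
      using d(2) e(2) by (intro bexI[of _ "ball d (inverse (real (Suc n)))"]) auto
  qed (auto simp: B_def)
  moreover have "countable B"
    unfolding B_def using D(1) by auto
  ultimately show "\<exists>B :: ell2 set set. countable B \<and> open = generate_topology B"
    using topological_basis_imp_subbasis by blast
qed


section \<open>Bounded operators and Schatten classes\<close>

definition bounded_clinear :: "(ell2 \<Rightarrow> ell2) \<Rightarrow> bool"
  where "bounded_clinear T \<longleftrightarrow> bounded_linear T \<and> (\<forall>c x. T (c *\<^sub>C x) = c *\<^sub>C T x)"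

definition pos_op :: "(ell2 \<Rightarrow> ell2) \<Rightarrow> bool"
  where "pos_op T \<longleftrightarrow> bounded_clinear T \<and> (\<forall>x. cinner_ell2 x (T x) \<in> \<real>\<^sub>\<ge>\<^sub>0)"

text \<open>The square root of a positive operator is its unique positive square root.\<close>

definition op_sqrt :: "(ell2 \<Rightarrow> ell2) \<Rightarrow> (ell2 \<Rightarrow> ell2)"
  where "op_sqrt T = (THE S. pos_op S \<and> S \<circ> S = T)"

definition rank_le :: "nat \<Rightarrow> (ell2 \<Rightarrow> ell2) \<Rightarrow> bool"
  where "rank_le n T \<longleftrightarrow> (\<exists>B. finite B \<and> card B \<le> n \<and> range T \<subseteq> module.span (*\<^sub>C) B)"

definition singular_value :: "(ell2 \<Rightarrow> ell2) \<Rightarrow> nat \<Rightarrow> real"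
  where "singular_value T n = Inf {onorm (\<lambda>x. T x - R x) | R. bounded_clinear R \<and> rank_le n R}"

definition schatten_class :: "real \<Rightarrow> (ell2 \<Rightarrow> ell2) set"
  where "schatten_class p = {T. bounded_clinear T \<and> summable (\<lambda>n. singular_value T n powr p)}"

definition schatten_norm :: "real \<Rightarrow> (ell2 \<Rightarrow> ell2) \<Rightarrow> real"
  where "schatten_norm p T = (\<Sum>n. singular_value T n powr p) powr (1 / p)"

definition rank_one :: "ell2 \<Rightarrow> (ell2 \<Rightarrow> ell2)"
  where "rank_one v = (\<lambda>x. cinner_ell2 v x *\<^sub>C v)"


section \<open>Function spaces on the unit circle\<close>

definition haar_circle :: "complex measure"
  where "haar_circle = distr (uniform_measure lborel {0..2 * pi}) (restrict_space borel (sphere 0 1)) cis"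

definition fourier :: "(complex \<Rightarrow> complex) \<Rightarrow> int \<Rightarrow> complex"
  where "fourier \<psi> n = (\<integral>z. z powi (- n) * \<psi> z \<partial>haar_circle)"

definition vfourier :: "(complex \<Rightarrow> ell2) \<Rightarrow> int \<Rightarrow> ell2"
  where "vfourier f n = (\<integral>z. z powi (- n) *\<^sub>C f z \<partial>haar_circle)"

definition H1_ell2 :: "(complex \<Rightarrow> ell2) set"
  where "H1_ell2 = {f. integrable haar_circle f \<and> (\<forall>n<0. vfourier f n = 0)}"

definition H1_norm :: "(complex \<Rightarrow> ell2) \<Rightarrow> real"
  where "H1_norm f = (\<integral>z. norm (f z) \<partial>haar_circle)"

definition H2_ell2 :: "(complex \<Rightarrow> ell2) set"
  where "H2_ell2 = {g \<in> borel_measurable haar_circle.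
           integrable haar_circle (\<lambda>z. (norm (g z))\<^sup>2) \<and> (\<forall>n<0. vfourier g n = 0)}"

definition Linf_norm :: "(complex \<Rightarrow> complex) \<Rightarrow> ennreal"
  where "Linf_norm \<psi> = esssup haar_circle (\<lambda>z. ennreal (cmod (\<psi> z)))"

definition Linf :: "(complex \<Rightarrow> complex) set"
  where "Linf = {\<psi> \<in> borel_measurable haar_circle. Linf_norm \<psi> < \<infinity>}"

definition conj_H0_inf :: "(complex \<Rightarrow> complex) set"
  where "conj_H0_inf = {h \<in> Linf. \<forall>n\<ge>0. fourier h n = 0}"

text \<open>A formal series \<open>\<Sum>\<^sub>n a n e\<^sup>i\<^sup>n\<^sup>\<theta>\<close> over \<open>n \<ge> 0\<close> is given by its coefficients.  It is
  identified with the class of any \<open>\<psi>\<close> in \<open>Linf\<close> that has these nonnegative Fourier coefficients;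
  all such \<open>\<psi>\<close> lie in one class modulo \<open>conj_H0_inf\<close>, so the outer infimum below is over equal
  values, or over the empty set (value infinity) if the series is not in BMOA.\<close>

definition BMOA_norm :: "(nat \<Rightarrow> complex) \<Rightarrow> ennreal"
  where "BMOA_norm a = (INF \<psi>\<in>{\<psi> \<in> Linf. \<forall>n. fourier \<psi> (int n) = a n}.
           INF h\<in>conj_H0_inf. Linf_norm (\<lambda>z. \<psi> z - h z))"

definition BMOA2 :: "(nat \<Rightarrow> complex) set"
  where "BMOA2 = {\<phi>. BMOA_norm (\<lambda>n. of_real ((cmod (\<phi> n))\<^sup>2)) < \<infinity>}"

definition BMOA2_norm :: "(nat \<Rightarrow> complex) \<Rightarrow> real"
  where "BMOA2_norm \<phi> = sqrt (enn2real (BMOA_norm (\<lambda>n. of_real ((cmod (\<phi> n))\<^sup>2))))"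

text \<open>\<open>g\<close> is a function with the Fourier series \<open>f * \<phi>\<close>; it is unique up to null sets.\<close>

definition represents_conv ::
    "(complex \<Rightarrow> ell2) \<Rightarrow> (complex \<Rightarrow> ell2) \<Rightarrow> (nat \<Rightarrow> complex) \<Rightarrow> bool"
  where "represents_conv g f \<phi> \<longleftrightarrow>
           g \<in> H2_ell2 \<and> (\<forall>n. vfourier g (int n) = \<phi> n *\<^sub>C vfourier f (int n))"

text \<open>The operator \<open>\<integral> g g\<^sup>* dm\<close>, as a strong integral of rank-one operators.\<close>

definition integral_rank_one :: "(complex \<Rightarrow> ell2) \<Rightarrow> (ell2 \<Rightarrow> ell2)"
  where "integral_rank_one g = (\<lambda>x. \<integral>z. rank_one (g z) x \<partial>haar_circle)"

end

theory Submission
  imports Defs "HOL-Complex_Analysis.Cauchy_Integral_Formula"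
begin

text \<open>
  Write \<open>a\<^sub>n\<close> for the Fourier coefficients of \<open>f\<close>.  The operator in question is \<open>A = W W\<^sup>*\<close>, where
  \<open>W\<close> has the columns \<open>\<phi>(n) a\<^sub>n\<close>, so \<open>\<surd>A\<close> and \<open>W\<close> have the same singular values and the claim is a
  bound for the Schatten \<open>4/3\<close> norm of \<open>W\<close>.  Suppose that \<open>f = h g\<close> with a scalar \<open>h\<close> and a
  vector-valued \<open>g\<close>, both analytic, such that \<open>|h|\<^sup>2 = \<parallel>g\<parallel>\<^sup>2 = \<parallel>f\<parallel>\<close> on the circle.  Comparing
  coefficients gives \<open>W = G H\<close>, where \<open>G\<close> has the coefficients \<open>g\<^sub>k\<close> of \<open>g\<close> as columns and
  \<open>H\<^sub>k\<^sub>n = \<phi>(n) h\<^sub>n\<^sub>-\<^sub>k\<close>.  Since \<open>3/4 = 1/2 + 1/4\<close>, Hoelder's inequality bounds \<open>W\<close> by the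
  Hilbert-Schmidt norm of \<open>G\<close>, whose square is \<open>\<parallel>f\<parallel>\<^sub>1\<close>, times the Schatten \<open>4\<close> norm of \<open>H\<close>
  (\<open>schatten_norm_product_le\<close>).

  The fourth power of the latter is the squared Hilbert-Schmidt norm of \<open>H H\<^sup>*\<close>.  If \<open>\<psi>\<close> is a bounded
  function with the coefficients \<open>|\<phi>(n)|\<^sup>2\<close> for \<open>n \<ge> 0\<close>, then the entries of \<open>H H\<^sup>*\<close> on the diagonal
  \<open>l - k = d\<close> are Fourier coefficients of \<open>\<psi> p\<^sub>d\<close>, where \<open>p\<^sub>d\<close> has the coefficients \<open>h\<^sub>i cnj h\<^sub>i\<^sub>-\<^sub>d\<close>
  at \<open>-i\<close>.
  Bessel's inequality bounds the diagonal by \<open>\<parallel>\<psi>\<parallel>\<^sub>\<infinity>\<^sup>2 \<Sum>\<^sub>i |h\<^sub>i|\<^sup>2 |h\<^sub>i\<^sub>-\<^sub>d|\<^sup>2\<close>, and summation over \<open>d\<close>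
  yields \<open>\<parallel>\<psi>\<parallel>\<^sub>\<infinity>\<^sup>2 \<parallel>h\<parallel>\<^sub>2\<^sup>4\<close> (\<open>toeplitz_product_bound\<close>).  The infimum
  of \<open>\<parallel>\<psi>\<parallel>\<^sub>\<infinity>\<^sup>2\<close> over all such \<open>\<psi>\<close> is \<open>\<parallel>\<phi>\<parallel>\<^sup>4\<close>.

  The exact factorisation needs outer functions.  It is replaced by an approximate one for
  polynomials: if a polynomial \<open>q\<close> has \<open>Re q\<close> uniformly close to \<open>ln (\<parallel>f\<parallel> + \<delta>)\<close> on the circle, then
  \<open>h = exp (q/2)\<close> and \<open>g = exp (-q/2) f\<close> have the desired moduli up to factors close to \<open>1\<close>
  (\<open>approximate_outer_factorisation\<close>).  The Fejer means reduce the general case to polynomials, since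
  they do not increase the norm in \<open>L\<^sup>1\<close> (\<open>fejer_mean_L1_le\<close>).

  For a polynomial, a unitary change of basis makes the columns of \<open>W\<close> orthogonal
  (\<open>exists_orthogonal_mixing\<close>).  Their norms are then the singular values, and \<open>\<surd>(W W\<^sup>*)\<close> has an
  explicit form.  The passage to the limit rests on the estimate
  \<open>\<parallel>S - T\<parallel>\<^sup>2 \<le> \<parallel>S\<^sup>2 - T\<^sup>2\<parallel>\<close> for positive operators (\<open>pos_op_diff_le_sqrt\<close>): it shows that the square
  roots converge in operator norm, that their limit is the one square root of the limit operator, and
  hence that the singular values converge.  A function with the prescribed coefficients comes from
  the Riesz-Fischer theorem (\<open>exists_H2_function\<close>).
\<close>

section \<open>Complex inner product geometry of the sequence space\<close>

abbreviation cinner_brackets :: "ell2 \<Rightarrow> ell2 \<Rightarrow> complex"  ("\<langle>_, _\<rangle>")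
  where "\<langle>x, y\<rangle> \<equiv> cinner_ell2 x y"

lemma cinner_commute: "cnj \<langle>x, y\<rangle> = \<langle>y, x\<rangle>"
proof -
  have "cnj \<langle>x, y\<rangle> = (\<Sum>k. cnj (cnj (ell2_nth x k) * ell2_nth y k))"
    unfolding cinner_ell2_def
    using bounded_linear.suminf[OF bounded_linear_cnj summable_cinner_ell2, of x y] by simp
  then show ?thesis
    by (simp add: cinner_ell2_def mult.commute)
qed

lemma cinner_add_right: "\<langle>x, y + z\<rangle> = \<langle>x, y\<rangle> + \<langle>x, z\<rangle>"
  unfolding cinner_ell2_def suminf_add[OF summable_cinner_ell2 summable_cinner_ell2]
  by (simp add: algebra_simps)

lemma cinner_scaleC_right: "\<langle>x, c *\<^sub>C y\<rangle> = c * \<langle>x, y\<rangle>"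
  unfolding cinner_ell2_def suminf_mult[OF summable_cinner_ell2, symmetric]
  by (simp add: algebra_simps)

lemma scaleR_ell2_scaleC: "r *\<^sub>R x = complex_of_real r *\<^sub>C x"
  by (rule ell2_eqI) simp

lemma cinner_add_left: "\<langle>x + y, z\<rangle> = \<langle>x, z\<rangle> + \<langle>y, z\<rangle>"
  using cinner_add_right[of z x y] by (metis cinner_commute complex_cnj_add)

lemma cinner_scaleC_left: "\<langle>c *\<^sub>C x, y\<rangle> = cnj c * \<langle>x, y\<rangle>"
  by (metis cinner_commute cinner_scaleC_right complex_cnj_mult)

lemma cinner_self: "\<langle>x, x\<rangle> = of_real ((norm x)\<^sup>2)"
  by (simp add: cinner_ell2_self norm_ell2_def suminf_nonneg ell2_summable)

lemma scaleC_one [simp]: "1 *\<^sub>C x = x" and scaleC_zero_left [simp]: "0 *\<^sub>C x = 0"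
  and scaleC_zero_right [simp]: "c *\<^sub>C 0 = 0"
  and scaleC_scaleC: "c *\<^sub>C d *\<^sub>C x = (c * d) *\<^sub>C x"
  and scaleC_add_left: "(c + d) *\<^sub>C x = c *\<^sub>C x + d *\<^sub>C x"
  and scaleC_add_right: "c *\<^sub>C (x + y) = c *\<^sub>C x + c *\<^sub>C y"
  by (rule ell2_eqI, simp add: algebra_simps)+

lemma norm_scaleC: "norm (c *\<^sub>C x) = cmod c * norm x"
proof -
  have "complex_of_real ((norm (c *\<^sub>C x))\<^sup>2) = of_real ((cmod c * norm x)\<^sup>2)"
    unfolding cinner_self[symmetric] cinner_scaleC_left cinner_scaleC_right
    by (simp add: cinner_self power_mult_distrib complex_norm_square[unfolded of_real_power] mult_ac)
  then have "(norm (c *\<^sub>C x))\<^sup>2 = (cmod c * norm x)\<^sup>2"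
    unfolding of_real_eq_iff .
  then show ?thesis
    by (simp add: power2_eq_iff_nonneg)
qed

lemma cmod_cinner_le: "cmod \<langle>x, y\<rangle> \<le> norm x * norm y"
proof (cases "\<langle>x, y\<rangle> = 0")
  case False
  define c where "c = cnj (sgn \<langle>x, y\<rangle>)"
  have c: "cmod c = 1"
    using False by (simp add: c_def norm_sgn)
  have "\<langle>x, c *\<^sub>C y\<rangle> = of_real (cmod \<langle>x, y\<rangle>)"
    unfolding cinner_scaleC_right c_def using False
    by (simp add: sgn_eq complex_norm_square[symmetric] power2_eq_square mult.commute)
  then have "cmod \<langle>x, y\<rangle> = inner x (c *\<^sub>C y)"
    by (simp add: inner_ell2_def)
  also have "\<dots> \<le> norm x * norm y"
    using norm_cauchy_schwarz[of x "c *\<^sub>C y"] by (simp add: norm_scaleC c)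
  finally show ?thesis .
qed simp

lemma bounded_bilinear_scaleC: "bounded_bilinear (*\<^sub>C)"
proof
  show "\<exists>K. \<forall>a b. norm (a *\<^sub>C b) \<le> norm a * norm b * K"
    by (intro exI[of _ 1]) (simp add: norm_scaleC)
qed (auto intro: ell2_eqI simp: algebra_simps scaleR_conv_of_real)

lemma bounded_bilinear_cinner: "bounded_bilinear cinner_ell2"
proof
  show "\<exists>K. \<forall>a b. norm \<langle>a, b\<rangle> \<le> norm a * norm b * K"
    by (intro exI[of _ 1]) (simp add: cmod_cinner_le)
qed (simp_all add: cinner_add_left cinner_add_right scaleR_ell2_scaleC cinner_scaleC_left
    cinner_scaleC_right scaleR_conv_of_real)

interpretation scaleC: bounded_bilinear "(*\<^sub>C)"
  by (rule bounded_bilinear_scaleC)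

interpretation cinner: bounded_bilinear cinner_ell2
  by (rule bounded_bilinear_cinner)

interpretation cspan: module "(*\<^sub>C)"
  by standard (auto intro: ell2_eqI simp: algebra_simps)

lemma borel_measurable_bilinear:
  assumes "bounded_bilinear h" "f \<in> borel_measurable M" "g \<in> borel_measurable M"
  shows "(\<lambda>z. h (f z :: 'a :: {second_countable_topology, real_normed_vector})
           (g z :: 'b :: {second_countable_topology, real_normed_vector})
           :: 'c :: real_normed_vector) \<in> borel_measurable M"
  by (rule borel_measurable_continuous_Pair[OF assms(2,3)])
     (intro bounded_bilinear.continuous_on[OF assms(1)] continuous_intros)

lemmas borel_measurable_scaleC [measurable (raw)] =
  borel_measurable_bilinear[OF bounded_bilinear_scaleC]
lemmas borel_measurable_cinner [measurable (raw)] =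
  borel_measurable_bilinear[OF bounded_bilinear_cinner]

lemma norm_add_orthogonal:
  assumes "\<langle>x, y\<rangle> = 0"
  shows "(norm (x + y))\<^sup>2 = (norm x)\<^sup>2 + (norm y)\<^sup>2"
proof -
  have "inner x y = 0"
    using assms by (simp add: inner_ell2_def)
  then show ?thesis
    by (simp add: power2_norm_eq_inner inner_add_left inner_add_right inner_commute)
qed

definition orthogonal_family :: "('i \<Rightarrow> ell2) \<Rightarrow> 'i set \<Rightarrow> bool"
  where "orthogonal_family z I \<longleftrightarrow> (\<forall>i\<in>I. \<forall>j\<in>I. i \<noteq> j \<longrightarrow> \<langle>z i, z j\<rangle> = 0)"

lemma orthogonal_familyD:
  "orthogonal_family z I \<Longrightarrow> i \<in> I \<Longrightarrow> j \<in> I \<Longrightarrow> i \<noteq> j \<Longrightarrow> \<langle>z i, z j\<rangle> = 0"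
  by (simp add: orthogonal_family_def)

lemma orthogonal_family_subset: "orthogonal_family z I \<Longrightarrow> J \<subseteq> I \<Longrightarrow> orthogonal_family z J"
  by (auto simp: orthogonal_family_def)

text \<open>Vectors of the family may vanish: the convention \<open>a / 0 = 0\<close> drops them from the sums.\<close>

definition orth_proj :: "('i \<Rightarrow> ell2) \<Rightarrow> 'i set \<Rightarrow> ell2 \<Rightarrow> ell2"
  where "orth_proj z I x = (\<Sum>i\<in>I. (\<langle>z i, x\<rangle> / of_real ((norm (z i))\<^sup>2)) *\<^sub>C z i)"

lemma cinner_orth_proj:
  assumes "finite I" "orthogonal_family z I" "j \<in> I"
  shows "\<langle>z j, orth_proj z I x\<rangle> = \<langle>z j, x\<rangle>"
proof -
  have "\<langle>z j, orth_proj z I x\<rangle> = (\<Sum>i\<in>I. \<langle>z i, x\<rangle> / of_real ((norm (z i))\<^sup>2) * \<langle>z j, z i\<rangle>)"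
    by (simp add: orth_proj_def cinner.sum_right cinner_scaleC_right)
  also have "\<dots> = (\<Sum>i\<in>I. if i = j then \<langle>z j, x\<rangle> else 0)"
    using orthogonal_familyD[OF assms(2,3)] by (intro sum.cong) (auto simp: cinner_self cinner.zero_left)
  also have "\<dots> = \<langle>z j, x\<rangle>"
    using assms(1,3) by simp
  finally show ?thesis .
qed

text \<open>The residual is orthogonal to the projection, so Pythagoras gives Bessel's inequality with an
  explicit defect.  The defect is used in \<open>sum_residuals\<close> to count dimensions.\<close>

lemma bessel_orthogonal:
  assumes "finite I" "orthogonal_family z I"
  shows "(norm x)\<^sup>2 = (norm (x - orth_proj z I x))\<^sup>2 + (\<Sum>i\<in>I. (cmod \<langle>z i, x\<rangle>)\<^sup>2 / (norm (z i))\<^sup>2)"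
proof -
  let ?p = "orth_proj z I x"
  have pc: "\<langle>?p, y\<rangle> = (\<Sum>i\<in>I. cnj \<langle>z i, x\<rangle> / of_real ((norm (z i))\<^sup>2) * \<langle>z i, y\<rangle>)" for y
    by (simp add: orth_proj_def cinner.sum_left cinner_scaleC_left)
  have "\<langle>?p, x - ?p\<rangle> = 0"
    unfolding pc by (simp add: cinner.diff_right cinner_orth_proj[OF assms])
  then have "(norm (?p + (x - ?p)))\<^sup>2 = (norm ?p)\<^sup>2 + (norm (x - ?p))\<^sup>2"
    by (rule norm_add_orthogonal)
  moreover have "\<langle>?p, ?p\<rangle> = of_real (\<Sum>i\<in>I. (cmod \<langle>z i, x\<rangle>)\<^sup>2 / (norm (z i))\<^sup>2)"
    unfolding pc of_real_sum
    by (intro sum.cong refl) (simp only: cinner_orth_proj[OF assms] of_real_divide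
        complex_norm_square mult_ac times_divide_eq_left times_divide_eq_right)
  then have "(norm ?p)\<^sup>2 = (\<Sum>i\<in>I. (cmod \<langle>z i, x\<rangle>)\<^sup>2 / (norm (z i))\<^sup>2)"
    unfolding cinner_self of_real_eq_iff .
  ultimately show ?thesis
    by simp
qed

lemma bessel_orthogonal_le:
  assumes "finite I" "orthogonal_family z I"
  shows "(\<Sum>i\<in>I. (cmod \<langle>z i, x\<rangle>)\<^sup>2 / (norm (z i))\<^sup>2) \<le> (norm x)\<^sup>2"
  using bessel_orthogonal[where z = z, OF assms, of x] by simp

definition coord :: "nat \<Rightarrow> ell2"
  where "coord n = Abs_ell2 (\<lambda>k. if k = n then 1 else 0)"

lemma ell2_nth_coord [simp]: "ell2_nth (coord n) k = (if k = n then 1 else 0)"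
proof -
  have "ell2_nth (coord n) = (\<lambda>k. if k = n then 1 else 0)"
    unfolding coord_def by (rule ell2_finite_nth) simp
  then show ?thesis by simp
qed

lemma cinner_coord_left: "\<langle>coord n, x\<rangle> = ell2_nth x n"
proof -
  have "\<langle>coord n, x\<rangle> = (\<Sum>k. if k = n then ell2_nth x n else 0)"
    unfolding cinner_ell2_def by (intro arg_cong[where f = suminf]) auto
  also have "\<dots> = ell2_nth x n"
    using sums_single[of n "\<lambda>_. ell2_nth x n"] by (simp add: sums_iff)
  finally show ?thesis .
qed

lemma cinner_coord_right: "\<langle>x, coord n\<rangle> = cnj (ell2_nth x n)"
  by (metis cinner_commute cinner_coord_left)

lemma norm_coord [simp]: "norm (coord n) = 1"
  using cinner_self[of "coord n"] unfolding cinner_coord_left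
  by (metis ell2_nth_coord norm_ge_zero of_real_eq_1_iff power2_eq_1_iff one_neq_neg_one
      not_one_le_zero neg_0_le_iff_le zero_le_one le_minus_one_simps(1) le_minus_one_simps(3))

section \<open>Square roots of positive operators\<close>

text \<open>The norm of a symmetric operator is the supremum of its quadratic form.  Polarisation recovers the
  bilinear form from the quadratic form, and the parallelogram law keeps the constant.\<close>

lemma norm_symmetric_le:
  fixes D :: "'a :: real_inner \<Rightarrow> 'a"
  assumes "bounded_linear D" and sym: "\<And>x y. inner (D x) y = inner x (D y)"
    and le: "\<And>x. norm x = 1 \<Longrightarrow> \<bar>inner (D x) x\<bar> \<le> m"
  shows "norm (D x) \<le> m * norm x"
proof (cases "D x = 0")
  case True
  have "0 \<le> m * norm x"
  proof (cases "x = 0")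
    case False
    then have "0 \<le> m"
      using le[of "x /\<^sub>R norm x"] by simp
    then show ?thesis by simp
  qed simp
  with True show ?thesis by simp
next
  case False
  interpret D: bounded_linear D by fact
  have quad: "\<bar>inner (D y) y\<bar> \<le> m * (norm y)\<^sup>2" for y
  proof (cases "y = 0")
    case False
    have "inner (D y) y = (norm y)\<^sup>2 * inner (D (y /\<^sub>R norm y)) (y /\<^sub>R norm y)"
      using False by (simp add: D.scaleR power2_eq_square field_simps)
    also have "\<bar>\<dots>\<bar> = (norm y)\<^sup>2 * \<bar>inner (D (y /\<^sub>R norm y)) (y /\<^sub>R norm y)\<bar>"
      by (simp add: abs_mult)
    also have "\<dots> \<le> (norm y)\<^sup>2 * m"
      using le[of "y /\<^sub>R norm y"] False by (intro mult_left_mono) auto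
    finally show ?thesis by (simp add: mult.commute)
  qed (simp add: D.zero)
  \<comment> \<open>polarisation with a vector \<open>y\<close> of the length of \<open>x\<close> in the direction of \<open>D x\<close>\<close>
  define y where "y = (norm x / norm (D x)) *\<^sub>R D x"
  have ny: "norm y = norm x"
    using False by (simp add: y_def)
  have "4 * inner (D x) y = inner (D (x + y)) (x + y) - inner (D (x - y)) (x - y)"
    by (simp add: D.add D.diff inner_add_left inner_add_right inner_diff_left inner_diff_right
        sym[of y x] inner_commute[of y "D x"])
  also have "\<dots> \<le> m * (norm (x + y))\<^sup>2 + m * (norm (x - y))\<^sup>2"
    using quad[of "x + y"] quad[of "x - y"] by linarith
  also have "\<dots> = m * (2 * (norm x)\<^sup>2 + 2 * (norm y)\<^sup>2)"
    by (simp add: power2_norm_eq_inner inner_add_left inner_add_right inner_diff_left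
        inner_diff_right inner_commute algebra_simps)
  finally have "4 * inner (D x) y \<le> m * (2 * (norm x)\<^sup>2 + 2 * (norm y)\<^sup>2)" .
  moreover have "inner (D x) y = norm x * norm (D x)"
    using False by (simp add: y_def power2_norm_eq_inner[symmetric] power2_eq_square)
  ultimately have "norm x * norm (D x) \<le> norm x * (m * norm x)"
    by (simp add: ny power2_eq_square algebra_simps)
  moreover have "norm x > 0"
    using False D.zero by auto
  ultimately show ?thesis
    by (metis mult_le_cancel_left_pos)
qed

text \<open>Let \<open>D = S - T\<close> have norm \<open>m\<close>.  The quadratic form of \<open>S\<^sup>2 - T\<^sup>2\<close> is \<open>\<langle>D x, (S + T) x\<rangle>\<close>.  For a
  unit vector \<open>x\<close> at which \<open>|\<langle>D x, x\<rangle>|\<close> is nearly \<open>m\<close>, the vector \<open>D x\<close> is nearly \<open>\<plusminus>m x\<close>, so the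
  form is nearly \<open>\<plusminus>m \<langle>x, (S + T) x\<rangle>\<close>.  Positivity of \<open>S\<close> and \<open>T\<close> gives
  \<open>\<langle>x, (S + T) x\<rangle> \<ge> |\<langle>x, D x\<rangle>|\<close>, which is nearly \<open>m\<close>.  Hence \<open>m\<^sup>2 \<le> e\<close>.\<close>

lemma positive_diff_le_sqrt:
  fixes S T :: "'a :: real_inner \<Rightarrow> 'a"
  assumes S: "bounded_linear S" "\<And>x y. inner (S x) y = inner x (S y)" "\<And>x. 0 \<le> inner x (S x)"
    and T: "bounded_linear T" "\<And>x y. inner (T x) y = inner x (T y)" "\<And>x. 0 \<le> inner x (T x)"
    and le: "\<And>x. norm (S (S x) - T (T x)) \<le> e * norm x"
    and e: "0 \<le> e"
  shows "norm (S x - T x) \<le> sqrt e * norm x"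
proof -
  interpret S: bounded_linear S by fact
  interpret T: bounded_linear T by fact
  define D where "D = (\<lambda>x. S x - T x)"
  define m where "m = onorm D"
  define L where "L = onorm S + onorm T"
  have D: "bounded_linear D"
    unfolding D_def using S(1) T(1) by (rule bounded_linear_sub)
  have L: "0 \<le> L"
    unfolding L_def using S(1) T(1) by (simp add: onorm_pos_le)
  have Dsym: "inner (D x) y = inner x (D y)" for x y
    by (simp add: D_def inner_diff_left inner_diff_right S(2) T(2))
  have m0: "0 \<le> m"
    unfolding m_def using D by (rule onorm_pos_le)
  have Dm: "norm (D x) \<le> m * norm x" for x
    unfolding m_def using D by (rule onorm)
  \<comment> \<open>quantitative form of the argument for a lower bound \<open>m'\<close> of \<open>|\<langle>D x, x\<rangle>|\<close>; then \<open>m'\<close> tends to \<open>m\<close>\<close>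
  have key: "m * m' - L * sqrt (2 * m * (m - m')) \<le> e" if m': "m' < m" "0 \<le> m'" for m'
  proof -
    have "\<exists>x. norm x = 1 \<and> m' < \<bar>inner (D x) x\<bar>"
    proof (rule ccontr)
      assume "\<not> ?thesis"
      then have "\<And>x. norm x = 1 \<Longrightarrow> \<bar>inner (D x) x\<bar> \<le> m'"
        by force
      then have "norm (D x) \<le> m' * norm x" for x
        by (intro norm_symmetric_le[OF D Dsym])
      then have "m \<le> m'"
        unfolding m_def using m'(2) by (intro onorm_bound)
      with m' show False by simp
    qed
    then obtain x where x: "norm x = 1" "m' < \<bar>inner (D x) x\<bar>"
      by blast
    define a where "a = \<bar>inner (D x) x\<bar>"
    define s :: real where "s = (if 0 \<le> inner (D x) x then 1 else -1)"
    have s: "s * inner (D x) x = a" "s * s = 1" "\<bar>s\<bar> = 1"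
      by (auto simp: s_def a_def)
    have am: "m' \<le> a"
      using x(2) by (simp add: a_def)
    have "(norm (D x - (s * m) *\<^sub>R x))\<^sup>2 = (norm (D x))\<^sup>2 - 2 * m * (s * inner (D x) x) + s * s * m * m"
      using x(1) by (simp add: power2_norm_eq_inner inner_diff_left inner_diff_right inner_commute
          algebra_simps norm_eq_1)
    also have "\<dots> \<le> m\<^sup>2 - 2 * m * a + m * m"
      using power_mono[OF Dm[of x], of 2] x(1) s by simp
    also have "\<dots> \<le> 2 * m * (m - m')"
      using mult_left_mono[OF am m0] by (simp add: power2_eq_square algebra_simps)
    finally have near: "norm (D x - (s * m) *\<^sub>R x) \<le> sqrt (2 * m * (m - m'))"
      by (rule real_le_rsqrt)
    have sum: "a \<le> inner x (S x + T x)"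
      using S(3)[of x] T(3)[of x]
      by (simp add: a_def D_def inner_diff_left inner_add_right S(2) T(2) abs_if)
    have NL: "norm (S x + T x) \<le> L"
      using norm_triangle_ineq[of "S x" "T x"] onorm[OF S(1), of x] onorm[OF T(1), of x] x(1)
      by (simp add: L_def)
    have "inner (D x) (S x + T x) = inner (S (S x) - T (T x)) x"
      by (simp add: D_def inner_diff_left inner_add_right S(2) T(2) inner_commute algebra_simps)
    also have "\<bar>\<dots>\<bar> \<le> e"
      using Cauchy_Schwarz_ineq2[of "S (S x) - T (T x)" x] le[of x] x(1) by simp
    finally have "\<bar>inner (D x) (S x + T x)\<bar> \<le> e" .
    then have up: "s * inner (D x) (S x + T x) \<le> e"
      by (auto simp: s_def)
    have "D x = (s * m) *\<^sub>R x + (D x - (s * m) *\<^sub>R x)"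
      by simp
    then have "s * inner (D x) (S x + T x) = s * inner ((s * m) *\<^sub>R x) (S x + T x)
        + s * inner (D x - (s * m) *\<^sub>R x) (S x + T x)"
      by (metis inner_add_left distrib_left)
    also have "s * inner ((s * m) *\<^sub>R x) (S x + T x) = m * inner x (S x + T x)"
      using s(2) by (simp add: mult.assoc[symmetric])
    finally have split: "s * inner (D x) (S x + T x) = m * inner x (S x + T x)
        + s * inner (D x - (s * m) *\<^sub>R x) (S x + T x)" .
    have "\<bar>s * inner (D x - (s * m) *\<^sub>R x) (S x + T x)\<bar> \<le> norm (D x - (s * m) *\<^sub>R x) * norm (S x + T x)"
      using Cauchy_Schwarz_ineq2 by (simp add: abs_mult s(3))
    also have "\<dots> \<le> sqrt (2 * m * (m - m')) * L"
      using near NL m0 m' by (intro mult_mono) auto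
    finally have "- (L * sqrt (2 * m * (m - m'))) \<le> s * inner (D x - (s * m) *\<^sub>R x) (S x + T x)"
      by (simp add: mult.commute)
    moreover have "m * m' \<le> m * inner x (S x + T x)"
      using am sum m0 by (intro mult_left_mono) auto
    ultimately show ?thesis
      using up split by linarith
  qed
  have "m * m \<le> e"
  proof (cases "m = 0")
    case True
    with e show ?thesis by simp
  next
    case False
    with m0 have "0 < m" by simp
    have lim: "((\<lambda>m'. m * m' - L * sqrt (2 * m * (m - m'))) \<longlongrightarrow> m * m - L * sqrt (2 * m * (m - m))) (at_left m)"
      by (intro tendsto_intros)
    have "eventually (\<lambda>m'. m * m' - L * sqrt (2 * m * (m - m')) \<le> e) (at_left m)"
      using \<open>0 < m\<close> by (intro eventually_at_leftI[of 0]) (auto intro: key)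
    from tendsto_upperbound[OF lim this] show ?thesis by simp
  qed
  then have "m \<le> sqrt e"
    by (intro real_le_rsqrt) (simp add: power2_eq_square)
  then show ?thesis
    using Dm[of x] mult_right_mono[of m "sqrt e" "norm x"] by (simp add: D_def)
qed

text \<open>Over the complex numbers a real quadratic form forces symmetry: expand it at \<open>x + \<i> y\<close>.\<close>

lemma pos_opD:
  assumes "pos_op S"
  shows "bounded_linear S" "\<And>x y. inner (S x) y = inner x (S y)" "\<And>x. 0 \<le> inner x (S x)"
    "\<And>c x. S (c *\<^sub>C x) = c *\<^sub>C S x"
proof -
  show bl: "bounded_linear S" and sc: "\<And>c x. S (c *\<^sub>C x) = c *\<^sub>C S x"
    using assms by (auto simp: pos_op_def bounded_clinear_def)
  interpret S: bounded_linear S by fact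
  have pos: "\<langle>x, S x\<rangle> \<in> \<real>\<^sub>\<ge>\<^sub>0" for x
    using assms by (simp add: pos_op_def)
  then show "0 \<le> inner x (S x)" for x
    by (simp add: inner_ell2_def complex_nonneg_Reals_iff)
  fix x y
  have Im0: "Im \<langle>u, S u\<rangle> = 0" for u
    using pos[of u] by (simp add: complex_nonneg_Reals_iff)
  have "Im \<langle>x, S x\<rangle> + Im \<langle>x, S (\<i> *\<^sub>C y)\<rangle> + Im \<langle>\<i> *\<^sub>C y, S x\<rangle> + Im \<langle>\<i> *\<^sub>C y, S (\<i> *\<^sub>C y)\<rangle> = 0"
    using Im0[of "x + \<i> *\<^sub>C y"] by (simp add: S.add cinner_add_left cinner_add_right algebra_simps)
  then have "Re \<langle>x, S y\<rangle> - Re \<langle>y, S x\<rangle> = 0"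
    by (simp add: sc cinner_scaleC_left cinner_scaleC_right Im0)
  moreover have "Re \<langle>S x, y\<rangle> = Re \<langle>y, S x\<rangle>"
    by (simp flip: cinner_commute[of y "S x"])
  ultimately show "inner (S x) y = inner x (S y)"
    by (simp add: inner_ell2_def)
qed

lemma pos_op_diff_le_sqrt:
  assumes "pos_op S" "pos_op T" "\<And>x. norm (S (S x) - T (T x)) \<le> e * norm x" "0 \<le> e"
  shows "norm (S x - T x) \<le> sqrt e * norm x"
  using positive_diff_le_sqrt[OF pos_opD(1-3)[OF assms(1)] pos_opD(1-3)[OF assms(2)] assms(3,4)] .

lemma op_sqrt_eq:
  assumes "pos_op S" "S \<circ> S = A"
  shows "op_sqrt A = S"
  unfolding op_sqrt_def
proof (rule the_equality)
  fix T assume T: "pos_op T \<and> T \<circ> T = A"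
  then have "T (T x) = S (S x)" for x
    using assms(2) by (metis comp_apply)
  then show "T = S"
    using pos_op_diff_le_sqrt[of T S 0] T assms(1) by (intro ext) simp
qed (use assms in simp)

text \<open>The estimate between the square roots makes the sequence \<open>S N\<close> Cauchy in operator norm.  Its limit is
  a positive square root of \<open>A\<close>, hence equal to \<open>op_sqrt A\<close> by uniqueness.\<close>

lemma op_sqrt_limit:
  assumes S: "\<And>N. pos_op (S N)" and e: "e \<longlonglongrightarrow> 0"
    and le: "\<And>N x. norm (S N (S N x) - A x) \<le> e N * norm x"
  shows "pos_op (op_sqrt A)" "norm (S N x - op_sqrt A x) \<le> sqrt (e N) * norm x"
proof -
  interpret S: bounded_linear "S N" for N
    using pos_opD(1)[OF S] .
  have ee: "e N \<ge> 0" for N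
  proof -
    have "0 \<le> e N * norm (coord 0)"
      using le[of N "coord 0"] norm_ge_zero order_trans by blast
    then show ?thesis by simp
  qed
  have cau: "norm (S N x - S M x) \<le> sqrt (e N + e M) * norm x" for N M x
  proof (rule pos_op_diff_le_sqrt[OF S S])
    fix x
    show "norm (S N (S N x) - S M (S M x)) \<le> (e N + e M) * norm x"
      using norm_triangle_ineq4[of "S N (S N x) - A x" "S M (S M x) - A x"] le[of N x] le[of M x]
      by (simp add: algebra_simps)
  qed (use ee in simp)
  have "convergent (\<lambda>N. S N x)" for x
    unfolding Cauchy_convergent_iff[symmetric]
  proof (rule CauchyI)
    fix d :: real assume d: "0 < d"
    define d' where "d' = (d / (norm x + 1))\<^sup>2 / 2"
    have nx: "norm x + 1 > 0" using norm_ge_zero[of x] by linarith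
    have d': "d' > 0" using d nx by (simp add: d'_def)
    from LIMSEQ_D[OF e d'] obtain M where M: "\<And>n. n \<ge> M \<Longrightarrow> e n < d'"
      using ee by auto
    show "\<exists>M. \<forall>m\<ge>M. \<forall>n\<ge>M. norm (S m x - S n x) < d"
    proof (intro exI allI impI)
      fix m n assume "m \<ge> M" "n \<ge> M"
      then have "e m + e n < (d / (norm x + 1))\<^sup>2"
        using M[of m] M[of n] by (simp add: d'_def)
      then have "sqrt (e m + e n) < d / (norm x + 1)"
        using d nx by (intro real_less_lsqrt) auto
      then have "sqrt (e m + e n) * (norm x + 1) < d"
        using nx by (simp add: field_simps)
      moreover have "norm (S m x - S n x) \<le> sqrt (e m + e n) * (norm x + 1)"
        using cau[of m x n] ee by (smt (verit) mult_left_mono real_sqrt_ge_zero)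
      ultimately show "norm (S m x - S n x) < d" by linarith
    qed
  qed
  then have lim: "(\<lambda>N. S N x) \<longlonglongrightarrow> lim (\<lambda>N. S N x)" for x
    by (simp add: convergent_LIMSEQ_iff)
  define T where "T = (\<lambda>x. lim (\<lambda>N. S N x))"
  have lim: "(\<lambda>N. S N x) \<longlonglongrightarrow> T x" for x
    using lim by (simp add: T_def)
  have near: "norm (S N x - T x) \<le> sqrt (e N) * norm x" for N x
  proof (rule LIMSEQ_le)
    show "(\<lambda>M. norm (S N x - S M x)) \<longlonglongrightarrow> norm (S N x - T x)"
      by (intro tendsto_intros lim)
    have "(\<lambda>M. sqrt (e N + e M) * norm x) \<longlonglongrightarrow> sqrt (e N + 0) * norm x"
      by (intro tendsto_intros e)
    then show "(\<lambda>M. sqrt (e N + e M) * norm x) \<longlonglongrightarrow> sqrt (e N) * norm x" by simp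
  qed (use cau in blast)
  have bl: "bounded_linear T"
  proof
    fix x y show "T (x + y) = T x + T y"
      using LIMSEQ_unique[OF lim[of "x + y"], of "T x + T y"] tendsto_add[OF lim[of x] lim[of y]]
      by (simp add: S.add)
  next
    fix r x show "T (r *\<^sub>R x) = r *\<^sub>R T x"
      using LIMSEQ_unique[OF lim[of "r *\<^sub>R x"], of "r *\<^sub>R T x"] tendsto_scaleR[OF tendsto_const lim[of x]]
      by (simp add: S.scaleR)
  next
    show "\<exists>K. \<forall>x. norm (T x) \<le> norm x * K"
    proof (intro exI allI)
      fix x
      have "norm (T x) \<le> norm (S 0 x) + norm (S 0 x - T x)"
        by norm
      then show "norm (T x) \<le> norm x * (onorm (S 0) + sqrt (e 0))"
        using near[of 0 x] onorm[OF S.bounded_linear_axioms, of 0 x] by (simp add: algebra_simps)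
    qed
  qed
  interpret T: bounded_linear T by fact
  have sc: "T (c *\<^sub>C x) = c *\<^sub>C T x" for c x
    using LIMSEQ_unique[OF lim[of "c *\<^sub>C x"], of "c *\<^sub>C T x"] scaleC.tendsto[OF tendsto_const lim[of x]]
    by (simp add: pos_opD(4)[OF S])
  have "\<langle>x, T x\<rangle> \<in> \<real>\<^sub>\<ge>\<^sub>0" for x
  proof (rule closed_sequentially[OF closed_nonneg_Reals_complex])
    show "(\<lambda>N. \<langle>x, S N x\<rangle>) \<longlonglongrightarrow> \<langle>x, T x\<rangle>"
      by (intro cinner.tendsto tendsto_intros lim)
  qed (use S in \<open>simp add: pos_op_def\<close>)
  then have pos: "pos_op T"
    using bl sc by (simp add: pos_op_def bounded_clinear_def)
  have "T (T x) = A x" for x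
  proof (rule LIMSEQ_unique)
    have z: "(\<lambda>N. sqrt (e N) * norm (S N x)) \<longlonglongrightarrow> sqrt 0 * norm (T x)"
      by (intro tendsto_intros e lim)
    have "(\<lambda>N. S N (S N x) - T (S N x)) \<longlonglongrightarrow> 0"
      by (rule Lim_null_comparison[OF _ z[unfolded real_sqrt_zero mult_zero_left]])
         (use near in \<open>intro always_eventually allI\<close>)
    from tendsto_add[OF this T.tendsto[OF lim[of x]]]
    show "(\<lambda>N. S N (S N x)) \<longlonglongrightarrow> T (T x)" by simp
    have z: "(\<lambda>N. e N * norm x) \<longlonglongrightarrow> 0 * norm x"
      by (intro tendsto_intros e)
    have "(\<lambda>N. S N (S N x) - A x) \<longlonglongrightarrow> 0"
      by (rule Lim_null_comparison[OF _ z[unfolded mult_zero_left]])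
         (use le in \<open>intro always_eventually allI\<close>)
    then show "(\<lambda>N. S N (S N x)) \<longlonglongrightarrow> A x"
      by (rule LIM_zero_cancel)
  qed
  then have "op_sqrt A = T"
    by (intro op_sqrt_eq pos) auto
  then show "pos_op (op_sqrt A)" "norm (S N x - op_sqrt A x) \<le> sqrt (e N) * norm x"
    using pos near by simp_all
qed

section \<open>Singular values of diagonal operators\<close>

lemma bounded_clinear_zero: "bounded_clinear (\<lambda>_. 0)"
  by (simp add: bounded_clinear_def)

lemma bounded_clinear_add:
  "bounded_clinear S \<Longrightarrow> bounded_clinear T \<Longrightarrow> bounded_clinear (\<lambda>x. S x + T x)"
  by (simp add: bounded_clinear_def bounded_linear_add scaleC_add_right)

lemma bounded_clinear_sum:
  "(\<And>i. i \<in> I \<Longrightarrow> bounded_clinear (T i)) \<Longrightarrow> bounded_clinear (\<lambda>x. \<Sum>i\<in>I. T i x)"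
  by (induction I rule: infinite_finite_induct) (simp_all add: bounded_clinear_zero bounded_clinear_add)

lemma bounded_clinear_cinner: "bounded_clinear (\<lambda>x. (\<langle>v, x\<rangle> * c) *\<^sub>C u)"
proof -
  have "bounded_linear (\<lambda>x. (\<langle>v, x\<rangle> * c) *\<^sub>C u)"
    by (intro bounded_linear_compose[OF scaleC.bounded_linear_left]
        bounded_linear_compose[OF bounded_linear_mult_left] cinner.bounded_linear_right)
  then show ?thesis
    by (simp add: bounded_clinear_def cinner_scaleC_right scaleC_scaleC mult_ac)
qed

lemma singular_value_nonneg:
  assumes "bounded_linear T"
  shows "0 \<le> singular_value T n"
  unfolding singular_value_def
proof (rule cInf_greatest)
  have "rank_le n (\<lambda>_. 0)"
    unfolding rank_le_def by (intro exI[of _ "{}"]) auto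
  then show "{onorm (\<lambda>x. T x - R x) |R. bounded_clinear R \<and> rank_le n R} \<noteq> {}"
    using bounded_clinear_zero by blast
qed (use assms in \<open>auto intro!: onorm_pos_le bounded_linear_sub simp: bounded_clinear_def\<close>)

lemma singular_value_le:
  assumes "bounded_linear T" "bounded_clinear R" "rank_le n R" "0 \<le> b"
    and "\<And>x. norm (T x - R x) \<le> b * norm x"
  shows "singular_value T n \<le> b"
proof -
  have "singular_value T n \<le> onorm (\<lambda>x. T x - R x)"
    unfolding singular_value_def
  proof (rule cInf_lower)
    show "bdd_below {onorm (\<lambda>x. T x - R x) |R. bounded_clinear R \<and> rank_le n R}"
      using assms(1) by (intro bdd_belowI[of _ 0])
        (auto intro!: onorm_pos_le bounded_linear_sub simp: bounded_clinear_def)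
  qed (use assms(2,3) in blast)
  also have "\<dots> \<le> b"
    using assms(4,5) by (intro onorm_bound)
  finally show ?thesis .
qed

text \<open>For an orthogonal family this is the square root of \<open>\<Sum>\<^sub>i z\<^sub>i z\<^sub>i\<^sup>*\<close>: it acts on \<open>z\<^sub>i\<close> as multiplication by
  \<open>\<parallel>z\<^sub>i\<parallel>\<close>.\<close>

definition diag_op :: "nat set \<Rightarrow> (nat \<Rightarrow> ell2) \<Rightarrow> ell2 \<Rightarrow> ell2"
  where "diag_op I z x = (\<Sum>i\<in>I. (\<langle>z i, x\<rangle> * of_real (1 / norm (z i))) *\<^sub>C z i)"

lemma bounded_clinear_diag_op: "bounded_clinear (diag_op I z)"
  unfolding diag_op_def[abs_def] by (intro bounded_clinear_sum bounded_clinear_cinner)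

lemma pos_op_diag_op: "pos_op (diag_op I z)"
proof -
  have "\<langle>x, diag_op I z x\<rangle> = of_real (\<Sum>i\<in>I. (cmod \<langle>z i, x\<rangle>)\<^sup>2 / norm (z i))" for x
    unfolding diag_op_def cinner.sum_right cinner_scaleC_right of_real_sum
    by (intro sum.cong refl)
       (simp add: cinner_commute[of "z _" x, symmetric] complex_norm_square[unfolded of_real_power] field_simps)
  then show ?thesis
    unfolding pos_op_def
    by (simp only: nonneg_Reals_of_real_iff bounded_clinear_diag_op) (simp add: sum_nonneg)
qed

lemma rank_le_diag_op:
  assumes "finite I" "card I \<le> n"
  shows "rank_le n (diag_op I z)"
  unfolding rank_le_def
proof (intro exI conjI)
  show "card (z ` I) \<le> n"
    using card_image_le[of I z] assms by linarith
  show "range (diag_op I z) \<subseteq> cspan.span (z ` I)"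
    by (rule image_subsetI, unfold diag_op_def, intro cspan.span_sum cspan.span_scale cspan.span_base imageI)
qed (use assms in simp)

lemma diag_op_square:
  assumes "finite I" "orthogonal_family z I"
  shows "diag_op I z (diag_op I z x) = (\<Sum>i\<in>I. \<langle>z i, x\<rangle> *\<^sub>C z i)"
proof -
  have "\<langle>z i, diag_op I z x\<rangle> = \<langle>z i, x\<rangle> * of_real (norm (z i))" if i: "i \<in> I" for i
  proof -
    have "\<langle>z i, diag_op I z x\<rangle> = (\<Sum>j\<in>I. if j = i then \<langle>z i, x\<rangle> * of_real (norm (z i)) else 0)"
      unfolding diag_op_def cinner.sum_right cinner_scaleC_right
      using orthogonal_familyD[OF assms(2) i] by (intro sum.cong) (auto simp: cinner_self power2_eq_square)
    then show ?thesis using i assms(1) by simp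
  qed
  then show ?thesis
    unfolding diag_op_def[of I z "diag_op I z x"]
    by (intro sum.cong refl) (auto simp: cinner.zero_left)
qed

text \<open>The operator is symmetric, so the squared norm of its value at \<open>x\<close> is the quadratic form of its
  square, and that is controlled by Bessel's inequality.\<close>

lemma norm_diag_op_le:
  assumes I: "finite I" "orthogonal_family z I"
    and b: "\<And>i. i \<in> I \<Longrightarrow> norm (z i) \<le> b" "0 \<le> b"
  shows "norm (diag_op I z x) \<le> b * norm x"
proof -
  have "complex_of_real ((norm (diag_op I z x))\<^sup>2) = \<langle>x, diag_op I z (diag_op I z x)\<rangle>"
  proof -
    have eq: "\<langle>diag_op I z x, y\<rangle> = \<langle>x, diag_op I z y\<rangle>" for y
      unfolding diag_op_def cinner.sum_right cinner.sum_left cinner_scaleC_right cinner_scaleC_left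
      by (intro sum.cong refl) (simp add: cinner_commute mult_ac)
    show ?thesis
      unfolding cinner_self[symmetric] eq ..
  qed
  also have "\<dots> = of_real (\<Sum>i\<in>I. (cmod \<langle>z i, x\<rangle>)\<^sup>2)"
    unfolding diag_op_square[of I z x, OF I] cinner.sum_right cinner_scaleC_right of_real_sum
    by (intro sum.cong refl)
       (simp add: cinner_commute[of "z _" x, symmetric] complex_norm_square[unfolded of_real_power])
  finally have "(norm (diag_op I z x))\<^sup>2 = (\<Sum>i\<in>I. (cmod \<langle>z i, x\<rangle>)\<^sup>2)"
    unfolding of_real_eq_iff .
  also have "\<dots> \<le> (\<Sum>i\<in>I. b\<^sup>2 * ((cmod \<langle>z i, x\<rangle>)\<^sup>2 / (norm (z i))\<^sup>2))"
  proof (rule sum_mono)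
    fix i assume i: "i \<in> I"
    have "(norm (z i))\<^sup>2 \<le> b\<^sup>2"
      using b(1)[OF i] by (intro power_mono) auto
    then have "(norm (z i))\<^sup>2 * ((cmod \<langle>z i, x\<rangle>)\<^sup>2 / (norm (z i))\<^sup>2) \<le> b\<^sup>2 * ((cmod \<langle>z i, x\<rangle>)\<^sup>2 / (norm (z i))\<^sup>2)"
      by (intro mult_right_mono) auto
    then show "(cmod \<langle>z i, x\<rangle>)\<^sup>2 \<le> b\<^sup>2 * ((cmod \<langle>z i, x\<rangle>)\<^sup>2 / (norm (z i))\<^sup>2)"
      by (cases "z i = 0") (auto simp: cinner.zero_left)
  qed
  also have "\<dots> = b\<^sup>2 * (\<Sum>i\<in>I. (cmod \<langle>z i, x\<rangle>)\<^sup>2 / (norm (z i))\<^sup>2)"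
    by (simp add: sum_distrib_left)
  also have "\<dots> \<le> b\<^sup>2 * (norm x)\<^sup>2"
    by (intro mult_left_mono bessel_orthogonal_le I) auto
  finally show ?thesis
    using b(2) by (metis power_mult_distrib mult_nonneg_nonneg norm_ge_zero power2_le_imp_le)
qed

text \<open>Cutting the diagonal operator after \<open>n\<close> terms gives an operator of rank at most \<open>n\<close>, and the largest
  of the remaining norms bounds the error.\<close>

lemma singular_value_near_diag_op:
  assumes T: "bounded_linear T" and near: "\<And>x. norm (T x - diag_op {..<N} z x) \<le> e * norm x"
    and e: "0 \<le> e"
    and orth: "orthogonal_family z {..<N}"
    and dec: "\<And>i j. i \<le> j \<Longrightarrow> j < N \<Longrightarrow> norm (z j) \<le> norm (z i)"
  shows "singular_value T n \<le> e + (if n < N then norm (z n) else 0)"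
proof -
  define b where "b = (if n < N then norm (z n) else 0)"
  define R where "R = diag_op {..<min n N} z"
  have split: "diag_op {..<N} z x = R x + diag_op {min n N..<N} z x" for x
  proof -
    have "{..<N} = {..<min n N} \<union> {min n N..<N}" by auto
    then show ?thesis
      unfolding R_def diag_op_def by (simp add: sum.union_disjoint ivl_disj_int)
  qed
  have "singular_value T n \<le> e + b"
  proof (rule singular_value_le)
    show "bounded_clinear R" "rank_le n R"
      unfolding R_def by (simp_all add: bounded_clinear_diag_op rank_le_diag_op)
    fix x
    have "norm (diag_op {min n N..<N} z x) \<le> b * norm x"
      by (intro norm_diag_op_le orthogonal_family_subset[OF orth]) (auto simp: b_def intro!: dec)
    moreover have "norm (T x - R x) \<le> norm (T x - diag_op {..<N} z x) + norm (diag_op {min n N..<N} z x)"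
      using norm_triangle_ineq[of "T x - diag_op {..<N} z x" "diag_op {min n N..<N} z x"]
      by (simp add: split)
    ultimately show "norm (T x - R x) \<le> (e + b) * norm x"
      using near[of x] by (simp add: algebra_simps)
  qed (use T e in \<open>auto simp: b_def\<close>)
  then show ?thesis by (simp add: b_def)
qed

section \<open>Orthogonalising the columns of an operator of finite rank\<close>

text \<open>The copy of \<open>\<complex>\<^sup>N\<close> inside the sequence space.\<close>

definition finite_vecs :: "nat \<Rightarrow> ell2 set"
  where "finite_vecs N = {x. \<forall>k\<ge>N. ell2_nth x k = 0}"

lemma finite_vecs_closed:
  "x \<in> finite_vecs N \<Longrightarrow> y \<in> finite_vecs N \<Longrightarrow> x + y \<in> finite_vecs N"
  "x \<in> finite_vecs N \<Longrightarrow> y \<in> finite_vecs N \<Longrightarrow> x - y \<in> finite_vecs N"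
  "x \<in> finite_vecs N \<Longrightarrow> c *\<^sub>C x \<in> finite_vecs N"
  "0 \<in> finite_vecs N"
  "n < N \<Longrightarrow> coord n \<in> finite_vecs N"
  by (auto simp: finite_vecs_def)

lemma finite_vecs_sum: "(\<And>i. i \<in> I \<Longrightarrow> x i \<in> finite_vecs N) \<Longrightarrow> sum x I \<in> finite_vecs N"
  by (induction I rule: infinite_finite_induct) (auto intro: finite_vecs_closed)

text \<open>The operator with the columns \<open>v 0, \<dots>, v (N - 1)\<close>.\<close>

definition synth :: "nat \<Rightarrow> (nat \<Rightarrow> ell2) \<Rightarrow> ell2 \<Rightarrow> ell2"
  where "synth N v x = (\<Sum>n<N. ell2_nth x n *\<^sub>C v n)"

lemma bounded_linear_ell2_nth: "bounded_linear (\<lambda>x. ell2_nth x n)"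
  using cinner.bounded_linear_right[of "coord n"] by (simp add: cinner_coord_left)

lemma bounded_linear_synth: "bounded_linear (synth N v)"
  unfolding synth_def[abs_def]
  by (intro bounded_linear_sum bounded_linear_compose[OF scaleC.bounded_linear_left]
      bounded_linear_ell2_nth)

lemmas synth_add = linear_add[OF bounded_linear.linear[OF bounded_linear_synth]]
lemmas synth_zero = linear_0[OF bounded_linear.linear[OF bounded_linear_synth]]
lemmas synth_sum = linear_sum[OF bounded_linear.linear[OF bounded_linear_synth]]

lemma synth_scaleC: "synth N v (c *\<^sub>C x) = c *\<^sub>C synth N v x"
  by (simp add: synth_def scaleC.sum_right scaleC_scaleC)

lemma synth_coord: "n < N \<Longrightarrow> synth N v (coord n) = v n"
proof -
  assume "n < N"
  have "synth N v (coord n) = (\<Sum>m<N. if m = n then v n else 0)"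
    unfolding synth_def by (intro sum.cong) auto
  with \<open>n < N\<close> show ?thesis by simp
qed

lemma norm_finite_vec:
  assumes "x \<in> finite_vecs N"
  shows "(norm x)\<^sup>2 = (\<Sum>n<N. (cmod (ell2_nth x n))\<^sup>2)"
proof -
  have "(\<Sum>k. (cmod (ell2_nth x k))\<^sup>2) = (\<Sum>n<N. (cmod (ell2_nth x n))\<^sup>2)"
    using assms by (intro suminf_finite) (auto simp: finite_vecs_def)
  then show ?thesis
    by (simp add: norm_ell2_def suminf_nonneg ell2_summable sum_nonneg)
qed

lemma ell2_nth_sum: "ell2_nth (sum f I) k = (\<Sum>i\<in>I. ell2_nth (f i) k)"
  by (induction I rule: infinite_finite_induct) auto

lemma ell2_nth_coord_combination:
  "ell2_nth (\<Sum>n<N. c n *\<^sub>C coord n) k = (if k < N then c k else 0)"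
proof -
  have "ell2_nth (\<Sum>n<N. c n *\<^sub>C coord n) k = (\<Sum>n<N. if n = k then c k else 0)"
    unfolding ell2_nth_sum by (intro sum.cong) auto
  then show ?thesis by simp
qed

lemma norm_coord_combination:
  "(norm (\<Sum>n<N. c n *\<^sub>C coord n))\<^sup>2 = (\<Sum>n<N. (cmod (c n))\<^sup>2)"
  by (subst norm_finite_vec[of _ N]) (simp_all add: finite_vecs_def ell2_nth_coord_combination)

text \<open>The dimension count for \<open>r\<close> orthonormal vectors in \<open>\<complex>\<^sup>N\<close>: the squared distances of the coordinate
  vectors to their span add up to \<open>N - r\<close>.  A positive sum yields a further orthogonal vector; for
  \<open>r = N\<close> the sum vanishes and the vectors form a basis.\<close>

lemma sum_residuals:
  assumes w: "\<And>i. i < r \<Longrightarrow> w i \<in> finite_vecs N" "\<And>i. i < r \<Longrightarrow> norm (w i) = 1"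
    and orth: "orthogonal_family w {..<r}"
  shows "(\<Sum>n<N. (norm (coord n - orth_proj w {..<r} (coord n)))\<^sup>2) = real N - real r"
proof -
  have "(norm (coord n - orth_proj w {..<r} (coord n)))\<^sup>2 = 1 - (\<Sum>i<r. (cmod (ell2_nth (w i) n))\<^sup>2)" for n
    using bessel_orthogonal[OF finite_lessThan orth, of "coord n"] w(2)
    by (simp add: cinner_coord_right)
  then have "(\<Sum>n<N. (norm (coord n - orth_proj w {..<r} (coord n)))\<^sup>2)
      = real N - (\<Sum>i<r. \<Sum>n<N. (cmod (ell2_nth (w i) n))\<^sup>2)"
    by (simp add: sum_subtractf sum.swap[of _ "{..<r}"])
  also have "(\<Sum>i<r. \<Sum>n<N. (cmod (ell2_nth (w i) n))\<^sup>2) = (\<Sum>i<r. 1)"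
    using w by (intro sum.cong refl) (auto simp: norm_finite_vec[symmetric])
  finally show ?thesis by simp
qed

lemma orth_proj_finite_vecs:
  "(\<And>i. i \<in> I \<Longrightarrow> w i \<in> finite_vecs N) \<Longrightarrow> orth_proj w I x \<in> finite_vecs N"
  unfolding orth_proj_def by (intro finite_vecs_sum finite_vecs_closed)

lemma exists_orthogonal_unit_vec:
  assumes w: "\<And>i. i < r \<Longrightarrow> w i \<in> finite_vecs N" "\<And>i. i < r \<Longrightarrow> norm (w i) = 1"
    and orth: "orthogonal_family w {..<r}" and "r < N"
  shows "\<exists>x\<in>finite_vecs N. norm x = 1 \<and> (\<forall>i<r. \<langle>w i, x\<rangle> = 0)"
proof -
  have "(\<Sum>n<N. (norm (coord n - orth_proj w {..<r} (coord n)))\<^sup>2) \<noteq> 0"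
    using sum_residuals[OF w orth] \<open>r < N\<close> by simp
  then obtain n where n: "n < N" "coord n - orth_proj w {..<r} (coord n) \<noteq> 0"
    by (metis (no_types, lifting) lessThan_iff norm_zero sum.neutral zero_power2)
  define y where "y = coord n - orth_proj w {..<r} (coord n)"
  have y: "y \<in> finite_vecs N" "y \<noteq> 0"
    using n w(1) by (auto simp: y_def intro!: finite_vecs_closed orth_proj_finite_vecs)
  have perp: "\<langle>w i, y\<rangle> = 0" if "i < r" for i
    using cinner_orth_proj[OF finite_lessThan orth, of i] that by (simp add: y_def cinner.diff_right)
  show ?thesis
    using y perp
    by (intro bexI[of _ "of_real (1 / norm y) *\<^sub>C y"])
       (auto simp: norm_scaleC norm_divide cinner_scaleC_right intro: finite_vecs_closed)
qed

text \<open>The unit polydisc of \<open>\<complex>\<^sup>N\<close> is compact by induction on \<open>N\<close>, as the image of the product of the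
  previous polydisc and a disc.  The remaining conditions are closed.\<close>

lemma compact_finite_unit_vecs:
  "compact {x \<in> finite_vecs N. norm x = 1 \<and> (\<forall>i<r. \<langle>w i, x\<rangle> = 0)}"
proof -
  define S where "S = (\<lambda>N. {x \<in> finite_vecs N. \<forall>n. cmod (ell2_nth x n) \<le> 1})"
  have "compact (S N)" for N
  proof (induction N)
    case 0
    have "S 0 = {0}"
      by (auto simp: S_def finite_vecs_def intro: ell2_eqI)
    then show ?case by simp
  next
    case (Suc N)
    have "S (Suc N) = (\<lambda>p. fst p + snd p *\<^sub>C coord N) ` (S N \<times> cball 0 1)"
    proof (intro equalityI subsetI)
      fix x assume x: "x \<in> S (Suc N)"
      define y where "y = x - ell2_nth x N *\<^sub>C coord N"
      have "ell2_nth y k = (if k = N then 0 else ell2_nth x k)" for k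
        by (simp add: y_def)
      then have "y \<in> S N" "ell2_nth x N \<in> cball 0 1"
        using x by (auto simp: S_def finite_vecs_def)
      then show "x \<in> (\<lambda>p. fst p + snd p *\<^sub>C coord N) ` (S N \<times> cball 0 1)"
        by (intro image_eqI[of _ _ "(y, ell2_nth x N)"]) (auto simp: y_def)
    next
      fix x assume "x \<in> (\<lambda>p. fst p + snd p *\<^sub>C coord N) ` (S N \<times> cball 0 1)"
      then obtain y c where "y \<in> S N" "cmod c \<le> 1" "x = y + c *\<^sub>C coord N"
        by auto
      then show "x \<in> S (Suc N)"
        by (auto simp: S_def finite_vecs_def)
    qed
    also have "compact \<dots>"
      by (intro compact_continuous_image compact_Times Suc compact_cball continuous_intros
          scaleC.continuous_on)
    finally show ?case .
  qed
  moreover have "closed ({x. norm x = 1} \<inter> (\<Inter>i<r. {x. \<langle>w i, x\<rangle> = 0}))"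
    by (intro closed_Int closed_INT ballI closed_Collect_eq continuous_intros cinner.continuous_on)
  ultimately have "compact (S N \<inter> ({x. norm x = 1} \<inter> (\<Inter>i<r. {x. \<langle>w i, x\<rangle> = 0})))"
    by (rule compact_Int_closed)
  moreover have "S N \<inter> ({x. norm x = 1} \<inter> (\<Inter>i<r. {x. \<langle>w i, x\<rangle> = 0}))
      = {x \<in> finite_vecs N. norm x = 1 \<and> (\<forall>i<r. \<langle>w i, x\<rangle> = 0)}"
    by (auto simp: S_def) (metis cmod_nth_le_norm_ell2)
  ultimately show ?thesis by simp
qed

text \<open>A greedy construction: each new vector maximises the norm of \<open>synth N v\<close> over the unit vectors
  orthogonal to the previous ones.\<close>

lemma exists_maximising_frame:
  assumes "r \<le> N"
  shows "\<exists>w. (\<forall>i<r. w i \<in> finite_vecs N \<and> norm (w i) = 1) \<and> orthogonal_family w {..<r} \<and>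
    (\<forall>i<r. \<forall>y\<in>finite_vecs N. (\<forall>j<i. \<langle>w j, y\<rangle> = 0) \<longrightarrow>
       norm (synth N v y) \<le> norm (synth N v (w i)) * norm y)"
  using assms
proof (induction r)
  case 0
  then show ?case by (simp add: orthogonal_family_def)
next
  case (Suc r)
  obtain w where w': "\<forall>i<r. w i \<in> finite_vecs N \<and> norm (w i) = 1"
    and orth: "orthogonal_family w {..<r}"
    and max: "\<forall>i<r. \<forall>y\<in>finite_vecs N. (\<forall>j<i. \<langle>w j, y\<rangle> = 0) \<longrightarrow>
       norm (synth N v y) \<le> norm (synth N v (w i)) * norm y"
    using Suc.IH[OF Suc_leD[OF Suc.prems]] by blast
  have w: "\<And>i. i < r \<Longrightarrow> w i \<in> finite_vecs N" "\<And>i. i < r \<Longrightarrow> norm (w i) = 1"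
    using w' by simp_all
  let ?K = "{x \<in> finite_vecs N. norm x = 1 \<and> (\<forall>i<r. \<langle>w i, x\<rangle> = 0)}"
  have "?K \<noteq> {}"
    using exists_orthogonal_unit_vec[OF w orth] Suc.prems by auto
  moreover have "continuous_on ?K (\<lambda>x. norm (synth N v x))"
    by (intro continuous_intros bounded_linear.continuous_on[OF bounded_linear_synth])
  ultimately have "\<exists>x\<in>?K. \<forall>y\<in>?K. norm (synth N v y) \<le> norm (synth N v x)"
    by (rule continuous_attains_sup[OF compact_finite_unit_vecs])
  then obtain x where x: "x \<in> ?K" "\<And>y. y \<in> ?K \<Longrightarrow> norm (synth N v y) \<le> norm (synth N v x)"
    by (elim bexE) (rule that, assumption, erule (1) bspec)
  define w' where "w' = w(r := x)"
  have perp: "\<langle>w i, x\<rangle> = 0" "\<langle>x, w i\<rangle> = 0" if "i < r" for i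
  proof -
    show *: "\<langle>w i, x\<rangle> = 0" using x(1) that by simp
    show "\<langle>x, w i\<rangle> = 0" using * cinner_commute[of "w i" x] by simp
  qed
  have "norm (synth N v y) \<le> norm (synth N v x) * norm y"
    if y: "y \<in> finite_vecs N" "\<And>j. j < r \<Longrightarrow> \<langle>w j, y\<rangle> = 0" for y
  proof (cases "y = 0")
    case False
    have "of_real (1 / norm y) *\<^sub>C y \<in> ?K"
      using y False by (auto simp: norm_scaleC norm_divide cinner_scaleC_right intro: finite_vecs_closed)
    from x(2)[OF this] False show ?thesis
      by (simp add: synth_scaleC norm_scaleC field_simps norm_divide)
  qed (simp add: synth_zero)
  note maximal = this
  show ?case
  proof (intro exI[of _ w'] conjI allI impI ballI)
    fix i assume i: "i < Suc r"
    then show "w' i \<in> finite_vecs N" "norm (w' i) = 1"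
      using w x(1) by (auto simp: w'_def less_Suc_eq)
    fix y assume y: "y \<in> finite_vecs N" "\<forall>j<i. \<langle>w' j, y\<rangle> = 0"
    then have "\<forall>j<i. \<langle>w j, y\<rangle> = 0"
      using i by (auto simp: w'_def)
    then show "norm (synth N v y) \<le> norm (synth N v (w' i)) * norm y"
      using maximal[OF y(1)] max[rule_format, of i y] y(1) i
      by (cases "i = r") (auto simp: w'_def)
  next
    show "orthogonal_family w' {..<Suc r}"
      unfolding orthogonal_family_def
    proof (intro ballI impI)
      fix i j assume "i \<in> {..<Suc r}" "j \<in> {..<Suc r}" "i \<noteq> j"
      then show "\<langle>w' i, w' j\<rangle> = 0"
        using perp orthogonal_familyD[OF orth, of i j] by (auto simp: w'_def)
    qed
  qed
qed

text \<open>The first-order condition at a maximum: a nonzero \<open>\<langle>a, b\<rangle>\<close> would let the left-hand side grow linearly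
  in a suitable direction \<open>t\<close>, while the right-hand side grows quadratically.\<close>

lemma orthogonal_of_maximal:
  assumes "\<And>t :: complex. (norm (a + t *\<^sub>C b))\<^sup>2 \<le> (norm a)\<^sup>2 * (1 + (cmod t)\<^sup>2)"
  shows "\<langle>a, b\<rangle> = 0"
proof (rule ccontr)
  assume nz: "\<langle>a, b\<rangle> \<noteq> 0"
  define c where "c = (cmod \<langle>a, b\<rangle>)\<^sup>2"
  have c: "c > 0" using nz by (simp add: c_def)
  have expand: "(norm (a + y))\<^sup>2 = (norm a)\<^sup>2 + 2 * inner a y + (norm y)\<^sup>2" for y
    by (simp add: power2_norm_eq_inner inner_add_left inner_add_right inner_commute)
  have *: "2 * s * c \<le> s\<^sup>2 * ((norm a)\<^sup>2 * c)" if "s > 0" for s :: real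
  proof -
    define t where "t = of_real s * cnj \<langle>a, b\<rangle>"
    have "inner a (t *\<^sub>C b) = s * c"
      unfolding inner_ell2_def cinner_scaleC_right t_def c_def
      by (simp add: complex_norm_square[unfolded of_real_power, symmetric] mult_ac flip: of_real_mult of_real_power)
    then have "(norm (a + t *\<^sub>C b))\<^sup>2 = (norm a)\<^sup>2 + 2 * s * c + (cmod t)\<^sup>2 * (norm b)\<^sup>2"
      using expand[of "t *\<^sub>C b"] by (simp add: norm_scaleC power_mult_distrib)
    moreover have "(cmod t)\<^sup>2 = s\<^sup>2 * c"
      using that by (simp add: t_def c_def norm_mult power_mult_distrib)
    moreover have "0 \<le> (cmod t)\<^sup>2 * (norm b)\<^sup>2" by simp
    ultimately show ?thesis
      using assms[of t] by (simp add: algebra_simps)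
  qed
  \<comment> \<open>small enough that the quadratic term loses against the linear one\<close>
  define s where "s = 1 / ((norm a)\<^sup>2 + 1)"
  have pos: "(norm a)\<^sup>2 + 1 > 0"
    by (intro add_nonneg_pos) auto
  then have s: "s > 0" by (simp add: s_def)
  have "2 * (s * c) \<le> (s * (norm a)\<^sup>2) * (s * c)"
    using *[OF s] by (simp add: power2_eq_square mult_ac)
  then have "2 \<le> s * (norm a)\<^sup>2"
    using s c by (simp add: mult_le_cancel_right)
  moreover have "s * (norm a)\<^sup>2 \<le> 1"
    using pos by (simp add: s_def)
  ultimately show False by simp
qed

text \<open>The singular value decomposition without its normalisation.  For \<open>i < j\<close> the vectors \<open>w i + t w j\<close>
  are admissible in step \<open>i\<close> of the greedy construction, so maximality makes the images of \<open>w i\<close> and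
  \<open>w j\<close> orthogonal.\<close>

lemma exists_orthogonal_mixing:
  obtains w where "\<And>i. i < N \<Longrightarrow> w i \<in> finite_vecs N" "\<And>i. i < N \<Longrightarrow> norm (w i) = 1"
    "orthogonal_family w {..<N}" "orthogonal_family (\<lambda>i. synth N v (w i)) {..<N}"
    "\<And>i j. i \<le> j \<Longrightarrow> j < N \<Longrightarrow> norm (synth N v (w j)) \<le> norm (synth N v (w i))"
proof -
  obtain w where w': "\<forall>i<N. w i \<in> finite_vecs N \<and> norm (w i) = 1"
    and orth: "orthogonal_family w {..<N}"
    and max: "\<forall>i<N. \<forall>y\<in>finite_vecs N. (\<forall>j<i. \<langle>w j, y\<rangle> = 0) \<longrightarrow>
       norm (synth N v y) \<le> norm (synth N v (w i)) * norm y"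
    using exists_maximising_frame[of N N v] by blast
  have w: "\<And>i. i < N \<Longrightarrow> w i \<in> finite_vecs N" "\<And>i. i < N \<Longrightarrow> norm (w i) = 1"
    using w' by simp_all
  have perp: "\<langle>synth N v (w i), synth N v (w j)\<rangle> = 0" if ij: "i < j" "j < N" for i j
  proof (rule orthogonal_of_maximal)
    fix t
    have "\<langle>w i, t *\<^sub>C w j\<rangle> = 0"
      using orthogonal_familyD[OF orth, of i j] ij by (simp add: cinner_scaleC_right)
    then have nrm: "(norm (w i + t *\<^sub>C w j))\<^sup>2 = 1 + (cmod t)\<^sup>2"
      using norm_add_orthogonal[of "w i" "t *\<^sub>C w j"] w ij by (simp add: norm_scaleC)
    have "\<langle>w k, w i + t *\<^sub>C w j\<rangle> = 0" if "k < i" for k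
      using orthogonal_familyD[OF orth, of k i] orthogonal_familyD[OF orth, of k j] ij that
      by (simp add: cinner_add_right cinner_scaleC_right)
    then have "norm (synth N v (w i + t *\<^sub>C w j)) \<le> norm (synth N v (w i)) * norm (w i + t *\<^sub>C w j)"
      using ij by (intro max[rule_format] finite_vecs_closed w) auto
    from power_mono[OF this, of 2]
    show "(norm (synth N v (w i) + t *\<^sub>C synth N v (w j)))\<^sup>2 \<le> (norm (synth N v (w i)))\<^sup>2 * (1 + (cmod t)\<^sup>2)"
      by (simp add: synth_add synth_scaleC power_mult_distrib nrm)
  qed
  show thesis
  proof (rule that[of w])
    show "orthogonal_family (\<lambda>i. synth N v (w i)) {..<N}"
      unfolding orthogonal_family_def
      by (metis perp cinner_commute complex_cnj_zero lessThan_iff linorder_neqE_nat)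
    fix i j assume "i \<le> j" "j < N"
    then show "norm (synth N v (w j)) \<le> norm (synth N v (w i))"
      using max[rule_format, of i "w j"] w orthogonal_familyD[OF orth, of _ j] by simp
  qed (use w orth in auto)
qed

lemma coord_expansion:
  assumes w: "\<And>i. i < N \<Longrightarrow> w i \<in> finite_vecs N" "\<And>i. i < N \<Longrightarrow> norm (w i) = 1"
    and orth: "orthogonal_family w {..<N}" and "n < N"
  shows "coord n = (\<Sum>i<N. cnj (ell2_nth (w i) n) *\<^sub>C w i)"
proof -
  have "(\<Sum>n<N. (norm (coord n - orth_proj w {..<N} (coord n)))\<^sup>2) = 0"
    using sum_residuals[OF w orth] by simp
  then have "coord n = orth_proj w {..<N} (coord n)"
    using \<open>n < N\<close> by (simp add: sum_nonneg_eq_0_iff)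
  also have "\<dots> = (\<Sum>i<N. cnj (ell2_nth (w i) n) *\<^sub>C w i)"
    unfolding orth_proj_def by (intro sum.cong) (auto simp: w(2) cinner_coord_right)
  finally show ?thesis .
qed

text \<open>A unitary change of basis preserves \<open>\<Sum> v\<^sub>n v\<^sub>n\<^sup>*\<close> and its trace.\<close>

lemma
  fixes v w :: "nat \<Rightarrow> ell2"
  assumes w: "\<And>i. i < N \<Longrightarrow> w i \<in> finite_vecs N" "\<And>i. i < N \<Longrightarrow> norm (w i) = 1"
    and orth: "orthogonal_family w {..<N}"
  defines "z \<equiv> \<lambda>i. synth N v (w i)"
  shows sum_rank_one_mixing: "(\<Sum>n<N. \<langle>v n, x\<rangle> *\<^sub>C v n) = (\<Sum>i<N. \<langle>z i, x\<rangle> *\<^sub>C z i)"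
    and sum_norm_mixing: "(\<Sum>n<N. (norm (v n))\<^sup>2) = (\<Sum>i<N. (norm (z i))\<^sup>2)"
proof -
  have v: "v n = (\<Sum>i<N. cnj (ell2_nth (w i) n) *\<^sub>C z i)" if "n < N" for n
  proof -
    have "v n = synth N v (coord n)"
      using that by (simp add: synth_coord)
    also have "\<dots> = (\<Sum>i<N. cnj (ell2_nth (w i) n) *\<^sub>C z i)"
      by (subst coord_expansion[OF w orth that]) (simp_all add: synth_sum synth_scaleC z_def)
    finally show ?thesis .
  qed
  have vc: "\<langle>v n, y\<rangle> = (\<Sum>i<N. ell2_nth (w i) n * \<langle>z i, y\<rangle>)" if "n < N" for n y
    by (subst v[OF that]) (simp add: cinner.sum_left cinner_scaleC_left)
  have "(\<Sum>n<N. \<langle>v n, x\<rangle> *\<^sub>C v n) = (\<Sum>n<N. \<Sum>i<N. (ell2_nth (w i) n * \<langle>z i, x\<rangle>) *\<^sub>C v n)"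
    by (intro sum.cong refl) (simp add: vc scaleC.sum_left)
  also have "\<dots> = (\<Sum>i<N. \<langle>z i, x\<rangle> *\<^sub>C z i)"
    by (subst sum.swap) (simp add: z_def synth_def scaleC.sum_right scaleC_scaleC mult_ac)
  finally show "(\<Sum>n<N. \<langle>v n, x\<rangle> *\<^sub>C v n) = (\<Sum>i<N. \<langle>z i, x\<rangle> *\<^sub>C z i)" .
  have "complex_of_real (\<Sum>n<N. (norm (v n))\<^sup>2) = (\<Sum>n<N. \<Sum>i<N. ell2_nth (w i) n * \<langle>z i, v n\<rangle>)"
    unfolding of_real_sum cinner_self[symmetric] by (intro sum.cong refl) (simp add: vc)
  also have "\<dots> = (\<Sum>i<N. \<langle>z i, z i\<rangle>)"
    by (subst sum.swap) (simp add: z_def synth_def cinner.sum_right cinner_scaleC_right)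
  also have "\<dots> = complex_of_real (\<Sum>i<N. (norm (z i))\<^sup>2)"
    unfolding of_real_sum cinner_self[symmetric] ..
  finally show "(\<Sum>n<N. (norm (v n))\<^sup>2) = (\<Sum>i<N. (norm (z i))\<^sup>2)"
    unfolding of_real_eq_iff .
qed

section \<open>Hoelder's inequality for the Schatten 4/3 norm of a product\<close>

text \<open>Hoelder's inequality with exponents \<open>3\<close> and \<open>3/2\<close> for \<open>s\<^sup>4\<^sup>/\<^sup>3 \<le> a\<^sup>4\<^sup>/\<^sup>3 b\<^sup>4\<^sup>/\<^sup>3\<close>, by Young's inequality after
  normalisation of both sums.\<close>

lemma holder_sum:
  fixes s a b :: "'i \<Rightarrow> real"
  assumes nn: "\<And>i. i \<in> I \<Longrightarrow> 0 \<le> s i" "\<And>i. i \<in> I \<Longrightarrow> 0 \<le> a i" "\<And>i. i \<in> I \<Longrightarrow> 0 \<le> b i"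
    and le: "\<And>i. i \<in> I \<Longrightarrow> s i \<le> a i * b i" and "finite I"
  shows "(\<Sum>i\<in>I. s i powr (4/3)) \<le> (\<Sum>i\<in>I. a i ^ 4) powr (1/3) * (\<Sum>i\<in>I. (b i)\<^sup>2) powr (2/3)"
proof -
  define P where "P = (\<Sum>i\<in>I. a i ^ 4)"
  define Q where "Q = (\<Sum>i\<in>I. (b i)\<^sup>2)"
  have PQ: "0 \<le> P" "0 \<le> Q"
    by (auto simp: P_def Q_def intro!: sum_nonneg)
  show ?thesis
  proof (cases "P = 0 \<or> Q = 0")
    case True
    have "s i = 0" if i: "i \<in> I" for i
    proof -
      have "a i = 0 \<or> b i = 0"
        using True i \<open>finite I\<close> by (auto simp: P_def Q_def sum_nonneg_eq_0_iff)
      then show ?thesis using le[OF i] nn(1)[OF i] by auto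
    qed
    then show ?thesis by simp
  next
    case False
    with PQ have PQ: "0 < P" "0 < Q" by auto
    have "s i powr (4/3) \<le> P powr (1/3) * Q powr (2/3) * (a i ^ 4 / (3 * P) + 2 * (b i)\<^sup>2 / (3 * Q))"
      if i: "i \<in> I" for i
    proof -
      note nni = nn(2)[OF i] nn(3)[OF i]
      have "s i powr (4/3) \<le> (a i * b i) powr (4/3)"
        using le[OF i] nn(1)[OF i] by (intro powr_mono2) auto
      also have "\<dots> = (a i ^ 4) powr (1/3) * ((b i)\<^sup>2) powr (2/3)"
        using nni by (cases "a i = 0 \<or> b i = 0") (auto simp: powr_mult powr_powr simp flip: powr_numeral)
      also have "\<dots> = P powr (1/3) * Q powr (2/3) * ((a i ^ 4 / P) powr (1/3) * ((b i)\<^sup>2 / Q) powr (2/3))"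
        using PQ nni by (simp add: powr_divide)
      also have "\<dots> \<le> P powr (1/3) * Q powr (2/3) *
          (((a i ^ 4 / P) powr (1/3)) powr 3 / 3 + (((b i)\<^sup>2 / Q) powr (2/3)) powr (3/2) / (3/2))"
        using PQ nni by (intro mult_left_mono Youngs_inequality) auto
      also have "((a i ^ 4 / P) powr (1/3)) powr 3 = a i ^ 4 / P"
        using PQ nni by (cases "a i = 0") (auto simp: powr_powr)
      also have "(((b i)\<^sup>2 / Q) powr (2/3)) powr (3/2) = (b i)\<^sup>2 / Q"
        using PQ nni by (cases "b i = 0") (auto simp: powr_powr)
      finally show ?thesis
        using PQ by (simp add: field_simps)
    qed
    then have "(\<Sum>i\<in>I. s i powr (4/3)) \<le>
        (\<Sum>i\<in>I. P powr (1/3) * Q powr (2/3) * (a i ^ 4 / (3 * P) + 2 * (b i)\<^sup>2 / (3 * Q)))"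
      by (intro sum_mono)
    also have "\<dots> = P powr (1/3) * Q powr (2/3) * (P / (3 * P) + 2 * Q / (3 * Q))"
      unfolding P_def Q_def
      by (simp add: sum_distrib_left[symmetric] sum.distrib sum_divide_distrib[symmetric])
    also have "P / (3 * P) + 2 * Q / (3 * Q) = 1"
      using PQ by (simp add: field_simps)
    finally show ?thesis by (simp add: P_def Q_def)
  qed
qed

lemma cauchy_schwarz_sum:
  "(cmod (\<Sum>n<N. cnj (ell2_nth x n) * c n))\<^sup>2 \<le> (norm x)\<^sup>2 * (\<Sum>n<N. (cmod (c n))\<^sup>2)"
proof -
  define q where "q = (\<Sum>n<N. c n *\<^sub>C coord n)"
  have "(norm q)\<^sup>2 = (\<Sum>n<N. (cmod (c n))\<^sup>2)"
    unfolding q_def by (rule norm_coord_combination)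
  moreover have "(\<Sum>n<N. cnj (ell2_nth x n) * c n) = \<langle>x, q\<rangle>"
    by (simp add: q_def cinner.sum_right cinner_scaleC_right cinner_coord_right mult.commute)
  ultimately show ?thesis
    using power_mono[OF cmod_cinner_le[of x q], of 2] by (simp add: power_mult_distrib)
qed

text \<open>Let \<open>H\<close> have the columns \<open>h n\<close>.  The left-hand side adds up the squared diagonal entries of \<open>H\<^sup>* H\<close>
  in the basis \<open>w\<close>, the right-hand side is the squared Hilbert-Schmidt norm of \<open>H\<^sup>* H\<close>.\<close>

lemma sum_norm_synth_power4_le:
  assumes w: "\<And>i. i < N \<Longrightarrow> w i \<in> finite_vecs N" "\<And>i. i < N \<Longrightarrow> norm (w i) = 1"
    and orth: "orthogonal_family w {..<N}"
  shows "(\<Sum>i<N. norm (synth N h (w i)) ^ 4) \<le> (\<Sum>n<N. \<Sum>m<N. (cmod \<langle>h n, h m\<rangle>)\<^sup>2)"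
proof -
  have "norm (synth N h (w i)) ^ 4 \<le> (\<Sum>n<N. (cmod \<langle>h n, synth N h (w i)\<rangle>)\<^sup>2)" if "i < N" for i
  proof -
    let ?y = "synth N h (w i)"
    have "norm ?y ^ 4 = (cmod \<langle>?y, ?y\<rangle>)\<^sup>2"
      by (simp add: cinner_self norm_power flip: power_mult)
    also have "\<langle>?y, ?y\<rangle> = (\<Sum>n<N. cnj (ell2_nth (w i) n) * \<langle>h n, ?y\<rangle>)"
      by (subst (1) synth_def) (simp add: cinner.sum_left cinner_scaleC_left)
    also have "(cmod \<dots>)\<^sup>2 \<le> (norm (w i))\<^sup>2 * (\<Sum>n<N. (cmod \<langle>h n, ?y\<rangle>)\<^sup>2)"
      by (rule cauchy_schwarz_sum)
    finally show ?thesis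
      using w(2)[OF that] by simp
  qed
  then have "(\<Sum>i<N. norm (synth N h (w i)) ^ 4) \<le> (\<Sum>i<N. \<Sum>n<N. (cmod \<langle>h n, synth N h (w i)\<rangle>)\<^sup>2)"
    by (intro sum_mono) simp
  also have "\<dots> = (\<Sum>n<N. \<Sum>i<N. (cmod \<langle>h n, synth N h (w i)\<rangle>)\<^sup>2)"
    by (rule sum.swap)
  also have "\<dots> \<le> (\<Sum>n<N. \<Sum>m<N. (cmod \<langle>h n, h m\<rangle>)\<^sup>2)"
  proof (rule sum_mono)
    fix n
    define a where "a = (\<Sum>m<N. \<langle>h m, h n\<rangle> *\<^sub>C coord m)"
    have "\<langle>h n, synth N h (w i)\<rangle> = cnj \<langle>w i, a\<rangle>" for i
      by (simp add: a_def synth_def cinner.sum_right cinner_scaleC_right cinner_coord_right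
          cinner_commute mult.commute)
    then have "(\<Sum>i<N. (cmod \<langle>h n, synth N h (w i)\<rangle>)\<^sup>2) = (\<Sum>i<N. (cmod \<langle>w i, a\<rangle>)\<^sup>2 / (norm (w i))\<^sup>2)"
      by (intro sum.cong refl) (simp add: w(2))
    also have "\<dots> \<le> (norm a)\<^sup>2"
      by (intro bessel_orthogonal_le orth) simp
    also have "\<dots> = (\<Sum>m<N. (cmod \<langle>h m, h n\<rangle>)\<^sup>2)"
      unfolding a_def by (rule norm_coord_combination)
    also have "\<dots> = (\<Sum>m<N. (cmod \<langle>h n, h m\<rangle>)\<^sup>2)"
      by (metis cinner_commute complex_mod_cnj)
    finally show "(\<Sum>i<N. (cmod \<langle>h n, synth N h (w i)\<rangle>)\<^sup>2) \<le> (\<Sum>m<N. (cmod \<langle>h n, h m\<rangle>)\<^sup>2)" .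
  qed
  finally show ?thesis .
qed

text \<open>The factorisation \<open>v = g h\<close> of column operators splits \<open>\<parallel>z\<parallel>\<^sup>2 = \<langle>z, z\<rangle>\<close> for \<open>z = v w\<^sub>i\<close> into \<open>h w\<^sub>i\<close>
  paired with \<open>g\<^sup>* z\<close>.  By Cauchy-Schwarz each singular value is at most \<open>\<parallel>h w\<^sub>i\<parallel>\<close> times the norm of
  \<open>g\<^sup>*\<close> at the normalised \<open>z\<close>.  The fourth powers of the former add up to at most the squared
  Hilbert-Schmidt norm of \<open>h\<^sup>* h\<close>, the squares of the latter to at most that of \<open>g\<close>.\<close>

lemma schatten_norm_product_le:
  assumes w: "\<And>i. i < N \<Longrightarrow> w i \<in> finite_vecs N" "\<And>i. i < N \<Longrightarrow> norm (w i) = 1"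
    and orth: "orthogonal_family w {..<N}" "orthogonal_family (\<lambda>i. synth N v (w i)) {..<N}"
    and v: "\<And>n. n < N \<Longrightarrow> v n = synth M g (h n)"
  shows "(\<Sum>i<N. norm (synth N v (w i)) powr (4/3))
     \<le> (\<Sum>n<N. \<Sum>m<N. (cmod \<langle>h n, h m\<rangle>)\<^sup>2) powr (1/3) * (\<Sum>k<M. (norm (g k))\<^sup>2) powr (2/3)"
proof -
  define z where "z = (\<lambda>i. synth N v (w i))"
  define y where "y = (\<lambda>i. synth N h (w i))"
  define b where "b = (\<lambda>i. sqrt (\<Sum>k<M. (cmod \<langle>z i, g k\<rangle>)\<^sup>2 / (norm (z i))\<^sup>2))"
  have zy: "z i = synth M g (y i)" for i
  proof -
    have "z i = (\<Sum>n<N. ell2_nth (w i) n *\<^sub>C synth M g (h n))"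
      unfolding z_def synth_def[of N v] by (intro sum.cong refl) (simp add: v)
    then show ?thesis
      by (simp add: y_def synth_def[of N h] synth_sum synth_scaleC)
  qed
  have "norm (z i) \<le> norm (y i) * b i" for i
  proof (cases "z i = 0")
    case False
    have "norm (z i) ^ 4 = (cmod \<langle>z i, z i\<rangle>)\<^sup>2"
      by (simp add: cinner_self norm_power flip: power_mult)
    also have "\<langle>z i, z i\<rangle> = cnj (\<Sum>k<M. cnj (ell2_nth (y i) k) * \<langle>g k, z i\<rangle>)"
      by (subst (2) zy) (simp add: synth_def cinner.sum_right cinner_scaleC_right cinner_commute)
    also have "(cmod \<dots>)\<^sup>2 \<le> (norm (y i))\<^sup>2 * (\<Sum>k<M. (cmod \<langle>g k, z i\<rangle>)\<^sup>2)"
      unfolding complex_mod_cnj by (rule cauchy_schwarz_sum)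
    also have "(\<Sum>k<M. (cmod \<langle>g k, z i\<rangle>)\<^sup>2) = (\<Sum>k<M. (cmod \<langle>z i, g k\<rangle>)\<^sup>2)"
      by (metis cinner_commute complex_mod_cnj)
    also have "\<dots> = (norm (z i))\<^sup>2 * (b i)\<^sup>2"
      unfolding b_def using False
      by (simp add: sum_nonneg sum_divide_distrib[symmetric])
    finally have "(norm (z i))\<^sup>2 * (norm (z i))\<^sup>2 \<le> (norm (z i))\<^sup>2 * (norm (y i) * b i)\<^sup>2"
      by (simp add: power_mult_distrib mult_ac flip: power_add)
    then have "(norm (z i))\<^sup>2 \<le> (norm (y i) * b i)\<^sup>2"
      by (rule mult_left_le_imp_le) (simp add: False)
    then show ?thesis
      by (rule power2_le_imp_le) (simp add: b_def sum_nonneg)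
  qed (simp add: b_def sum_nonneg)
  then have "(\<Sum>i<N. norm (z i) powr (4/3)) \<le> (\<Sum>i<N. norm (y i) ^ 4) powr (1/3) * (\<Sum>i<N. (b i)\<^sup>2) powr (2/3)"
    by (intro holder_sum) (auto simp: b_def sum_nonneg)
  also have "\<dots> \<le> (\<Sum>n<N. \<Sum>m<N. (cmod \<langle>h n, h m\<rangle>)\<^sup>2) powr (1/3) * (\<Sum>k<M. (norm (g k))\<^sup>2) powr (2/3)"
  proof (intro mult_mono powr_mono2)
    show "(\<Sum>i<N. norm (y i) ^ 4) \<le> (\<Sum>n<N. \<Sum>m<N. (cmod \<langle>h n, h m\<rangle>)\<^sup>2)"
      unfolding y_def by (rule sum_norm_synth_power4_le[OF w orth(1)])
    have "(\<Sum>i<N. (b i)\<^sup>2) = (\<Sum>k<M. \<Sum>i<N. (cmod \<langle>z i, g k\<rangle>)\<^sup>2 / (norm (z i))\<^sup>2)"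
      unfolding b_def by (simp add: sum_nonneg sum.swap[of _ "{..<N}"])
    also have "\<dots> \<le> (\<Sum>k<M. (norm (g k))\<^sup>2)"
      by (intro sum_mono bessel_orthogonal_le) (use orth(2) in \<open>auto simp: z_def\<close>)
    finally show "(\<Sum>i<N. (b i)\<^sup>2) \<le> (\<Sum>k<M. (norm (g k))\<^sup>2)" .
  qed (auto intro!: sum_nonneg)
  finally show ?thesis by (simp add: z_def)
qed

section \<open>Fourier coefficients of vector-valued functions\<close>

lemma measurable_cis_circle:
  "cis \<in> uniform_measure lborel {0..2 * pi} \<rightarrow>\<^sub>M restrict_space borel (sphere 0 1)"
proof -
  have "cis \<in> borel \<rightarrow>\<^sub>M borel"
    by (intro borel_measurable_continuous_onI continuous_intros)
  then have "cis \<in> borel \<rightarrow>\<^sub>M restrict_space borel (sphere 0 1)"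
    by (intro measurable_restrict_space2) auto
  then show ?thesis
    by (simp add: measurable_cong_sets[OF sets_uniform_measure refl])
qed

lemma space_haar_circle [simp]: "space haar_circle = sphere 0 1"
  by (simp add: haar_circle_def space_restrict_space)

lemma sets_haar_circle: "sets haar_circle = sets (restrict_space borel (sphere 0 1))"
  by (simp add: haar_circle_def)

interpretation haar: prob_space haar_circle
  unfolding haar_circle_def
  by (intro prob_space.prob_space_distr[OF _ measurable_cis_circle] prob_space_uniform_measure) auto

lemma borel_measurable_haar_circle:
  fixes f :: "complex \<Rightarrow> 'a :: topological_space"
  assumes "continuous_on (sphere 0 1) f"
  shows "f \<in> borel_measurable haar_circle"
  using borel_measurable_continuous_on_restrict[OF assms]
  by (simp add: measurable_cong_sets[OF sets_haar_circle refl])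

lemma continuous_on_circle_power_int: "continuous_on (sphere 0 1) (\<lambda>z :: complex. z powi n)"
  by (intro continuous_intros) auto

lemma borel_measurable_power_int_circle [measurable]:
  "(\<lambda>z. z powi n) \<in> borel_measurable haar_circle"
  by (intro borel_measurable_haar_circle continuous_on_circle_power_int)

lemma bounded_on_circle:
  fixes f :: "complex \<Rightarrow> 'a :: real_normed_vector"
  assumes "continuous_on (sphere 0 1) f"
  shows "\<exists>B. \<forall>z\<in>sphere 0 1. norm (f z) \<le> B"
proof -
  have "bounded (f ` sphere 0 1)"
    using assms by (intro compact_imp_bounded compact_continuous_image) auto
  then show ?thesis
    unfolding bounded_iff by blast
qed

lemma integrable_haar_continuous:
  fixes f :: "complex \<Rightarrow> 'a :: {banach, second_countable_topology}"
  assumes "continuous_on (sphere 0 1) f"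
  shows "integrable haar_circle f"
proof -
  obtain B where "\<And>z. z \<in> sphere 0 1 \<Longrightarrow> norm (f z) \<le> B"
    using bounded_on_circle[OF assms] by blast
  then show ?thesis
    using borel_measurable_haar_circle[OF assms]
    by (intro haar.integrable_const_bound[of _ B]) auto
qed

lemma power_int_circle:
  assumes "z \<in> sphere 0 (1::real)"
  shows "cmod (z powi n) = 1" "z powi (m + n) = z powi m * z powi n" "z powi (- n) = cnj (z powi n)"
proof -
  have z: "cmod z = 1" "z \<noteq> 0"
    using assms by auto
  show n: "cmod (z powi n) = 1" for n
    by (simp add: norm_power_int z)
  show "z powi (m + n) = z powi m * z powi n"
    using z by (simp add: power_int_add)
  have "z powi n * cnj (z powi n) = 1"
    using complex_norm_square[of "z powi n"] n[of n] by simp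
  moreover have "z powi (- n) * z powi n = 1"
    using z by (simp add: power_int_minus)
  ultimately show "z powi (- n) = cnj (z powi n)"
    by (metis mult.assoc mult.commute mult_1)
qed

lemma integral_power_int_circle: "(\<integral>z. z powi n \<partial>haar_circle) = (if n = 0 then 1 else 0)"
proof (cases "n = 0")
  case True
  then show ?thesis using haar.prob_space by simp
next
  case False
  have "(\<integral>z. z powi n \<partial>haar_circle) = (\<integral>t. cis t powi n \<partial>uniform_measure lborel {0..2 * pi})"
    unfolding haar_circle_def
    by (rule integral_distr[OF measurable_cis_circle])
       (intro borel_measurable_continuous_on_restrict continuous_on_circle_power_int)
  also have "uniform_measure lborel {0..2 * pi} = density lborel (\<lambda>t. ennreal (indicator {0..2 * pi} t / (2 * pi)))"
    unfolding uniform_measure_def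
    by (intro arg_cong[where f = "density lborel"] ext) (auto simp: divide_ennreal[symmetric] split: split_indicator)
  also have "(\<integral>t. cis t powi n \<partial>\<dots>) = (\<integral>t. (indicator {0..2 * pi} t / (2 * pi)) *\<^sub>R (cis t powi n) \<partial>lborel)"
    by (rule integral_density) (auto simp: cis_power_int intro!: borel_measurable_continuous_onI continuous_intros)
  also have "\<dots> = (\<integral>t. of_real (1 / (2 * pi)) * (indicator {0..2 * pi} t *\<^sub>R cis (of_int n * t)) \<partial>lborel)"
    by (intro Bochner_Integration.integral_cong refl) (simp add: cis_power_int mult.commute scaleR_conv_of_real)
  also have "\<dots> = of_real (1 / (2 * pi)) * (\<integral>t. indicator {0..2 * pi} t *\<^sub>R cis (of_int n * t) \<partial>lborel)"
    by (rule integral_mult_right_zero)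
  also have "(\<integral>t. indicator {0..2 * pi} t *\<^sub>R cis (of_int n * t) \<partial>lborel)
      = cis (of_int n * (2 * pi)) / (\<i> * of_int n) - cis (of_int n * 0) / (\<i> * of_int n)"
  proof (rule integral_FTC_atLeastAtMost)
    fix t :: real
    have "((\<lambda>t. cis (of_int n * t) / (\<i> * of_int n)) has_vector_derivative
        (of_int n *\<^sub>R (\<i> * cis (of_int n * t))) / (\<i> * of_int n)) (at t within {0..2 * pi})"
      by (intro has_vector_derivative_divide)
         (auto intro!: derivative_eq_intros simp: has_vector_derivative_def)
    also have "(of_int n *\<^sub>R (\<i> * cis (of_int n * t))) / (\<i> * of_int n) = cis (of_int n * t)"
      using False by (simp add: scaleR_conv_of_real)
    finally show "((\<lambda>t. cis (of_int n * t) / (\<i> * of_int n)) has_vector_derivative cis (of_int n * t))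
        (at t within {0..2 * pi})" .
  qed (auto intro!: continuous_intros)
  also have "cis (of_int n * (2 * pi)) = 1"
    by (metis Ints_of_int cis_multiple_2pi mult.commute)
  finally show ?thesis using False by simp
qed

lemma integrable_power_int_scaleC:
  assumes "integrable haar_circle f"
  shows "integrable haar_circle (\<lambda>z. z powi n *\<^sub>C f z)"
  by (rule Bochner_Integration.integrable_bound[OF assms])
     (use assms in \<open>auto simp: norm_scaleC norm_power_int\<close>)

lemma norm_vfourier_le:
  assumes "integrable haar_circle f"
  shows "norm (vfourier f n) \<le> (\<integral>z. norm (f z) \<partial>haar_circle)"
proof -
  have "norm (vfourier f n) \<le> (\<integral>z. norm (z powi (- n) *\<^sub>C f z) \<partial>haar_circle)"
    unfolding vfourier_def by (rule integral_norm_bound)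
  also have "\<dots> = (\<integral>z. norm (f z) \<partial>haar_circle)"
    by (intro Bochner_Integration.integral_cong) (auto simp: norm_scaleC norm_power_int)
  finally show ?thesis .
qed

lemma vfourier_diff:
  "integrable haar_circle f \<Longrightarrow> integrable haar_circle g \<Longrightarrow>
    vfourier (\<lambda>z. f z - g z) n = vfourier f n - vfourier g n"
  unfolding vfourier_def
  by (simp add: scaleC.diff_right integrable_power_int_scaleC)

lemma vfourier_sum:
  "(\<And>i. i \<in> I \<Longrightarrow> integrable haar_circle (f i)) \<Longrightarrow>
    vfourier (\<lambda>z. \<Sum>i\<in>I. f i z) n = (\<Sum>i\<in>I. vfourier (f i) n)"
  unfolding vfourier_def
  by (simp add: scaleC.sum_right Bochner_Integration.integral_sum integrable_power_int_scaleC)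

lemma vfourier_scaleC: "vfourier (\<lambda>z. c *\<^sub>C f z) n = c *\<^sub>C vfourier f n"
proof (cases "c = 0")
  case False
  have "vfourier (\<lambda>z. c *\<^sub>C f z) n = (\<integral>z. c *\<^sub>C z powi (- n) *\<^sub>C f z \<partial>haar_circle)"
    by (simp add: vfourier_def scaleC_scaleC mult.commute)
  also have "\<dots> = c *\<^sub>C vfourier f n"
  proof -
    have "integrable haar_circle (\<lambda>z. z powi (- n) *\<^sub>C f z)"
      if "integrable haar_circle (\<lambda>z. c *\<^sub>C z powi (- n) *\<^sub>C f z)"
      using integrable_bounded_linear[OF scaleC.bounded_linear_right[of "1 / c"] that] False
      by (simp add: scaleC_scaleC)
    then show ?thesis
      unfolding vfourier_def
      using integral_bounded_linear[OF scaleC.bounded_linear_right[of c]]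
      by (metis not_integrable_integral_eq scaleC_zero_right)
  qed
  finally show ?thesis .
qed (simp add: vfourier_def)

lemma vfourier_shift: "vfourier (\<lambda>z. z powi m *\<^sub>C f z) n = vfourier f (n - m)"
  unfolding vfourier_def
  by (intro Bochner_Integration.integral_cong refl)
     (simp add: scaleC_scaleC power_int_circle(2)[symmetric])

lemma vfourier_const: "vfourier (\<lambda>_. a) n = (if n = 0 then a else 0)"
proof -
  have "vfourier (\<lambda>_. a) n = (\<integral>z. z powi (- n) \<partial>haar_circle) *\<^sub>C a"
    unfolding vfourier_def
    by (rule integral_bounded_linear[OF scaleC.bounded_linear_left])
       (intro integrable_haar_continuous continuous_on_circle_power_int)
  then show ?thesis
    unfolding integral_power_int_circle by simp
qed

definition trig_poly :: "int set \<Rightarrow> (int \<Rightarrow> ell2) \<Rightarrow> complex \<Rightarrow> ell2"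
  where "trig_poly I a z = (\<Sum>k\<in>I. z powi k *\<^sub>C a k)"

lemma continuous_on_trig_poly: "continuous_on (sphere 0 1) (trig_poly I a)"
  unfolding trig_poly_def[abs_def]
  by (intro continuous_intros scaleC.continuous_on continuous_on_circle_power_int)

lemma vfourier_trig_poly:
  assumes "finite I"
  shows "vfourier (trig_poly I a) n = (if n \<in> I then a n else 0)"
proof -
  have "vfourier (trig_poly I a) n = (\<Sum>k\<in>I. vfourier (\<lambda>z. z powi k *\<^sub>C a k) n)"
    unfolding trig_poly_def[abs_def]
    by (intro vfourier_sum integrable_haar_continuous scaleC.continuous_on
        continuous_on_circle_power_int continuous_intros)
  also have "\<dots> = (\<Sum>k\<in>I. if k = n then a n else 0)"
    by (intro sum.cong refl) (simp add: vfourier_shift vfourier_const)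
  finally show ?thesis using assms by simp
qed

lemma cinner_vfourier:
  assumes "integrable haar_circle g"
  shows "\<langle>a, vfourier g k\<rangle> = (\<integral>z. \<langle>z powi k *\<^sub>C a, g z\<rangle> \<partial>haar_circle)"
proof -
  have "(\<integral>z. \<langle>z powi k *\<^sub>C a, g z\<rangle> \<partial>haar_circle) = (\<integral>z. \<langle>a, z powi (- k) *\<^sub>C g z\<rangle> \<partial>haar_circle)"
    by (intro Bochner_Integration.integral_cong refl)
       (simp add: power_int_circle(3) cinner_scaleC_left cinner_scaleC_right)
  also have "\<dots> = \<langle>a, vfourier g k\<rangle>"
    unfolding vfourier_def
    by (rule integral_bounded_linear[OF cinner.bounded_linear_right])
       (rule integrable_power_int_scaleC[OF assms])
  finally show ?thesis ..
qed

lemma integrable_cinner_bounded: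
  assumes "integrable haar_circle g" "continuous_on (sphere 0 1) s"
  shows "integrable haar_circle (\<lambda>z. \<langle>s z, g z\<rangle>)"
proof -
  obtain B where B: "\<And>z. z \<in> sphere 0 1 \<Longrightarrow> norm (s z) \<le> B"
    using bounded_on_circle[OF assms(2)] by blast
  have [measurable]: "s \<in> borel_measurable haar_circle" "g \<in> borel_measurable haar_circle"
    using assms borel_measurable_haar_circle by auto
  show ?thesis
  proof (rule Bochner_Integration.integrable_bound)
    show "integrable haar_circle (\<lambda>z. B *\<^sub>R norm (g z))"
      using assms by simp
    show "AE z in haar_circle. norm \<langle>s z, g z\<rangle> \<le> norm (B *\<^sub>R norm (g z))"
    proof (rule AE_I2)
      fix z assume "z \<in> space haar_circle"
      then have "norm (s z) \<le> \<bar>B\<bar>"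
        using B by force
      then have "norm (s z) * norm (g z) \<le> \<bar>B\<bar> * norm (g z)"
        by (intro mult_right_mono) auto
      then show "norm \<langle>s z, g z\<rangle> \<le> norm (B *\<^sub>R norm (g z))"
        using cmod_cinner_le[of "s z" "g z"] by (simp add: abs_mult)
    qed
  qed measurable
qed

lemma integral_cinner_trig_poly:
  assumes "integrable haar_circle g"
  shows "(\<integral>z. \<langle>trig_poly I a z, g z\<rangle> \<partial>haar_circle) = (\<Sum>k\<in>I. \<langle>a k, vfourier g k\<rangle>)"
proof -
  have "(\<integral>z. \<langle>trig_poly I a z, g z\<rangle> \<partial>haar_circle) = (\<integral>z. (\<Sum>k\<in>I. \<langle>z powi k *\<^sub>C a k, g z\<rangle>) \<partial>haar_circle)"
    by (simp add: trig_poly_def cinner.sum_left)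
  also have "\<dots> = (\<Sum>k\<in>I. (\<integral>z. \<langle>z powi k *\<^sub>C a k, g z\<rangle> \<partial>haar_circle))"
    by (intro Bochner_Integration.integral_sum integrable_cinner_bounded assms scaleC.continuous_on
        continuous_on_circle_power_int continuous_intros)
  finally show ?thesis
    by (simp add: cinner_vfourier[OF assms])
qed

lemma parseval_trig_poly:
  assumes "finite I"
  shows "(\<integral>z. (norm (trig_poly I a z))\<^sup>2 \<partial>haar_circle) = (\<Sum>k\<in>I. (norm (a k))\<^sup>2)"
proof -
  have int: "integrable haar_circle (trig_poly I a)"
    by (intro integrable_haar_continuous continuous_on_trig_poly)
  have "complex_of_real (\<integral>z. (norm (trig_poly I a z))\<^sup>2 \<partial>haar_circle)
      = (\<integral>z. \<langle>trig_poly I a z, trig_poly I a z\<rangle> \<partial>haar_circle)"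
    unfolding cinner_self integral_complex_of_real ..
  also have "\<dots> = (\<Sum>k\<in>I. \<langle>a k, a k\<rangle>)"
    unfolding integral_cinner_trig_poly[OF int] by (simp add: vfourier_trig_poly[OF assms])
  also have "\<dots> = complex_of_real (\<Sum>k\<in>I. (norm (a k))\<^sup>2)"
    by (simp add: cinner_self)
  finally show ?thesis
    unfolding of_real_eq_iff .
qed

lemma integrable_of_square_integrable:
  fixes g :: "complex \<Rightarrow> 'a :: {banach, second_countable_topology}"
  assumes "g \<in> borel_measurable haar_circle" "integrable haar_circle (\<lambda>z. (norm (g z))\<^sup>2)"
  shows "integrable haar_circle g"
proof (rule Bochner_Integration.integrable_bound)
  show "integrable haar_circle (\<lambda>z. 1 + (norm (g z))\<^sup>2)"
    using assms(2) by simp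
  have "norm (g z) \<le> 1 + (norm (g z))\<^sup>2" for z
    using zero_le_power2[of "norm (g z) - 1"] zero_le_power2[of "norm (g z)"] norm_ge_zero[of "g z"]
    unfolding power2_diff power_one by linarith
  then show "AE z in haar_circle. norm (g z) \<le> norm (1 + (norm (g z))\<^sup>2)"
    by (intro AE_I2) (smt (verit) real_norm_def)
qed fact

text \<open>The squared distance of \<open>g\<close> to the trigonometric polynomial with the coefficients of \<open>g\<close> is
  nonnegative.\<close>

lemma bessel_vfourier:
  assumes "g \<in> borel_measurable haar_circle" "integrable haar_circle (\<lambda>z. (norm (g z))\<^sup>2)" "finite I"
  shows "(\<Sum>k\<in>I. (norm (vfourier g k))\<^sup>2) \<le> (\<integral>z. (norm (g z))\<^sup>2 \<partial>haar_circle)"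
proof -
  define s where "s = trig_poly I (vfourier g)"
  have g: "integrable haar_circle g"
    by (rule integrable_of_square_integrable[OF assms(1,2)])
  have s: "continuous_on (sphere 0 1) s"
    unfolding s_def by (rule continuous_on_trig_poly)
  have ints: "integrable haar_circle (\<lambda>z. (norm (s z))\<^sup>2)"
    by (intro integrable_haar_continuous continuous_intros s)
  have intc: "integrable haar_circle (\<lambda>z. inner (s z) (g z))"
    unfolding inner_ell2_def by (intro integrable_Re integrable_cinner_bounded g s)
  have cross: "(\<integral>z. inner (s z) (g z) \<partial>haar_circle) = (\<Sum>k\<in>I. (norm (vfourier g k))\<^sup>2)"
    unfolding inner_ell2_def integral_Re[OF integrable_cinner_bounded[OF g s]]
    unfolding s_def integral_cinner_trig_poly[OF g] by (simp add: cinner_self)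
  have sq: "(\<integral>z. (norm (s z))\<^sup>2 \<partial>haar_circle) = (\<Sum>k\<in>I. (norm (vfourier g k))\<^sup>2)"
    unfolding s_def by (rule parseval_trig_poly[OF assms(3)])
  have "0 \<le> (\<integral>z. (norm (g z - s z))\<^sup>2 \<partial>haar_circle)"
    by simp
  also have "\<dots> = (\<integral>z. (norm (g z))\<^sup>2 - 2 * inner (s z) (g z) + (norm (s z))\<^sup>2 \<partial>haar_circle)"
    by (intro Bochner_Integration.integral_cong refl)
       (simp add: power2_norm_eq_inner inner_diff_left inner_diff_right inner_commute)
  also have "\<dots> = (\<integral>z. (norm (g z))\<^sup>2 \<partial>haar_circle) - 2 * (\<integral>z. inner (s z) (g z) \<partial>haar_circle)
      + (\<integral>z. (norm (s z))\<^sup>2 \<partial>haar_circle)"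
    using assms(2) ints intc by simp
  finally show ?thesis
    by (simp add: cross sq)
qed

section \<open>The Riesz-Fischer theorem\<close>

lemma sum_le_suminf_tail:
  fixes a :: "nat \<Rightarrow> real"
  assumes "summable a" "\<And>n. 0 \<le> a n"
  shows "sum a {N..<M} \<le> (\<Sum>n. a (n + N))"
proof (cases "N \<le> M")
  case True
  have "sum a {N..<M} = (\<Sum>n<M - N. a (n + N))"
    using True by (intro sum.reindex_bij_witness[of _ "\<lambda>n. n + N" "\<lambda>n. n - N"]) auto
  also have "\<dots> \<le> (\<Sum>n. a (n + N))"
    using assms by (intro sum_le_suminf) (auto simp: summable_iff_shift)
  finally show ?thesis .
qed (use assms in \<open>simp add: suminf_nonneg summable_iff_shift\<close>)

abbreviation fourier_sum :: "(nat \<Rightarrow> ell2) \<Rightarrow> nat \<Rightarrow> complex \<Rightarrow> ell2"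
  where "fourier_sum a N \<equiv> trig_poly {0..<int N} (\<lambda>k. a (nat k))"

lemma sum_int_nat: "(\<Sum>k\<in>{int m..<int n}. f (nat k)) = (\<Sum>k\<in>{m..<n}. f k)"
  by (rule sum.reindex_bij_witness[of _ int nat]) auto

lemma L2_dist_fourier_sum:
  assumes "N \<le> M"
  shows "(\<integral>z. (norm (fourier_sum a M z - fourier_sum a N z))\<^sup>2 \<partial>haar_circle) = (\<Sum>n=N..<M. (norm (a n))\<^sup>2)"
proof -
  have "{0..<int M} = {0..<int N} \<union> {int N..<int M}"
    using assms by auto
  then have "fourier_sum a M z - fourier_sum a N z = trig_poly {int N..<int M} (\<lambda>k. a (nat k)) z" for z
    by (simp add: trig_poly_def sum.union_disjoint ivl_disj_int)
  then show ?thesis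
    by (simp add: parseval_trig_poly sum_int_nat[of "\<lambda>k. (norm (a k))\<^sup>2"])
qed

text \<open>The measure is a probability measure, so this is nonnegativity of the variance of \<open>\<parallel>g\<parallel>\<close>.\<close>

lemma integral_norm_le_sqrt:
  fixes g :: "complex \<Rightarrow> 'a :: {banach, second_countable_topology}"
  assumes "g \<in> borel_measurable haar_circle" "integrable haar_circle (\<lambda>z. (norm (g z))\<^sup>2)"
  shows "(\<integral>z. norm (g z) \<partial>haar_circle) \<le> sqrt (\<integral>z. (norm (g z))\<^sup>2 \<partial>haar_circle)"
proof -
  let ?m = "\<integral>z. norm (g z) \<partial>haar_circle"
  have int: "integrable haar_circle (\<lambda>z. norm (g z))"
    using integrable_of_square_integrable[OF assms] by simp
  have "0 \<le> (\<integral>z. (norm (g z) - ?m)\<^sup>2 \<partial>haar_circle)"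
    by simp
  also have "\<dots> = (\<integral>z. (norm (g z))\<^sup>2 + ?m\<^sup>2 - 2 * norm (g z) * ?m \<partial>haar_circle)"
    by (simp add: power2_diff)
  also have "\<dots> = (\<integral>z. (norm (g z))\<^sup>2 \<partial>haar_circle) + ?m\<^sup>2 - 2 * ?m * ?m"
    using int assms(2) haar.prob_space by simp
  finally show ?thesis
    by (intro real_le_rsqrt) (simp add: power2_eq_square)
qed

text \<open>A subsequence of the partial sums with increments of norm at most \<open>2\<^sup>-\<^sup>j\<close> converges almost everywhere,
  and Fatou's lemma turns the distances between partial sums into distances to the limit.\<close>

lemma riesz_fischer:
  fixes a :: "nat \<Rightarrow> ell2"
  assumes a: "summable (\<lambda>n. (norm (a n))\<^sup>2)"
  obtains g where "g \<in> borel_measurable haar_circle"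
    "\<And>N. integrable haar_circle (\<lambda>z. (norm (g z - fourier_sum a N z))\<^sup>2)"
    "\<And>N. (\<integral>z. (norm (g z - fourier_sum a N z))\<^sup>2 \<partial>haar_circle) \<le> (\<Sum>n. (norm (a (n + N)))\<^sup>2)"
proof -
  define tail where "tail = (\<lambda>N. \<Sum>n. (norm (a (n + N)))\<^sup>2)"
  define s where "s = fourier_sum a"
  have tail0: "0 \<le> tail N" for N
    unfolding tail_def using a by (intro suminf_nonneg) (simp_all add: summable_iff_shift[of "\<lambda>n. (norm (a n))\<^sup>2"])
  have s_cont: "continuous_on (sphere 0 1) (s N)" for N
    unfolding s_def by (rule continuous_on_trig_poly)
  have s_meas [measurable]: "s N \<in> borel_measurable haar_circle" for N
    by (rule borel_measurable_haar_circle[OF s_cont])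
  have s_int: "integrable haar_circle (\<lambda>z. (norm (s M z - s N z))\<^sup>2)" for M N
    by (intro integrable_haar_continuous continuous_intros s_cont)
  have s_dist: "(\<integral>z. (norm (s M z - s N z))\<^sup>2 \<partial>haar_circle) \<le> tail N" if "N \<le> M" for M N
    unfolding s_def L2_dist_fourier_sum[OF that] tail_def
    by (rule sum_le_suminf_tail[OF a]) simp
  have "tail \<longlonglongrightarrow> 0"
    unfolding tail_def by (rule suminf_exist_split2[OF a])
  then have "\<exists>N. \<forall>n\<ge>N. tail n < (1/4) ^ j" for j
    using LIMSEQ_D[of tail 0 "(1/4) ^ j"] tail0 by auto
  then obtain r0 where r0: "\<And>j n. r0 j \<le> n \<Longrightarrow> tail n < (1/4) ^ j"
    by metis
  \<comment> \<open>increasing, above \<open>r0\<close>, and, thanks to the summand \<open>j\<close>, unbounded\<close>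
  define r where "r = (\<lambda>j. j + (\<Sum>i\<le>j. r0 i))"
  have r0r: "r0 j \<le> r j" for j
  proof -
    have "r0 j \<le> (\<Sum>i\<le>j. r0 i)"
      by (rule member_le_sum) auto
    then show ?thesis by (simp add: r_def)
  qed
  have r_mono: "r j \<le> r (Suc j)" for j
    by (simp add: r_def)
  have r_ge: "j \<le> r j" for j
    by (simp add: r_def)
  define d where "d = (\<lambda>j z. s (r (Suc j)) z - s (r j) z)"
  have d_meas [measurable]: "d j \<in> borel_measurable haar_circle" for j
    unfolding d_def by measurable
  have d_le: "(\<integral>\<^sup>+z. ennreal (norm (d j z)) \<partial>haar_circle) \<le> ennreal ((1/2) ^ j)" for j
  proof -
    have "(\<integral>z. norm (d j z) \<partial>haar_circle) \<le> sqrt (\<integral>z. (norm (d j z))\<^sup>2 \<partial>haar_circle)"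
      by (rule integral_norm_le_sqrt[OF d_meas]) (simp add: d_def s_int)
    also have "\<dots> \<le> sqrt ((1/4) ^ j)"
      unfolding d_def using s_dist[OF r_mono, of j] r0[OF r0r, of j] by simp
    also have "\<dots> = (1/2) ^ j"
      by (simp add: real_sqrt_power real_sqrt_divide)
    finally show ?thesis
      by (subst nn_integral_eq_integral)
         (auto simp: d_def intro!: integrable_haar_continuous continuous_intros s_cont)
  qed
  have "(\<integral>\<^sup>+z. (\<Sum>j. ennreal (norm (d j z))) \<partial>haar_circle) = (\<Sum>j. \<integral>\<^sup>+z. ennreal (norm (d j z)) \<partial>haar_circle)"
    by (rule nn_integral_suminf) measurable
  also have "\<dots> \<le> (\<Sum>j. ennreal ((1/2) ^ j))"
    by (intro suminf_le d_le) auto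
  also have "\<dots> < \<infinity>"
    by (subst suminf_ennreal2) (auto simp: summable_geometric)
  finally have "AE z in haar_circle. (\<Sum>j. ennreal (norm (d j z))) \<noteq> \<infinity>"
    by (intro nn_integral_PInf_AE) auto
  then have conv: "AE z in haar_circle. convergent (\<lambda>j. s (r j) z)"
  proof eventually_elim
    case (elim z)
    have "summable (\<lambda>j. norm (d j z))"
      by (rule summable_suminf_not_top) (use elim in auto)
    then have "summable (\<lambda>j. d j z)"
      by (rule summable_norm_cancel)
    then have "convergent (\<lambda>n. \<Sum>j<n. d j z)"
      by (simp add: summable_iff_convergent)
    moreover have "(\<Sum>j<n. d j z) = s (r n) z - s (r 0) z" for n
      unfolding d_def by (rule sum_lessThan_telescope)
    ultimately have "convergent (\<lambda>n. s (r n) z - s (r 0) z)"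
      by simp
    then show ?case
      using convergent_add[OF _ convergent_const[of "s (r 0) z"], of "\<lambda>n. s (r n) z - s (r 0) z"] by simp
  qed
  define g where "g = (\<lambda>z. lim (\<lambda>j. s (r j) z))"
  have g_meas [measurable]: "g \<in> borel_measurable haar_circle"
    unfolding g_def by measurable
  have nn: "(\<integral>\<^sup>+z. ennreal ((norm (g z - s N z))\<^sup>2) \<partial>haar_circle) \<le> ennreal (tail N)" for N
  proof -
    have "(\<integral>\<^sup>+z. ennreal ((norm (g z - s N z))\<^sup>2) \<partial>haar_circle)
        = (\<integral>\<^sup>+z. liminf (\<lambda>j. ennreal ((norm (s (r j) z - s N z))\<^sup>2)) \<partial>haar_circle)"
    proof (rule nn_integral_cong_AE, use conv in eventually_elim)
      case (elim z)
      then have "(\<lambda>j. s (r j) z) \<longlonglongrightarrow> g z"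
        by (simp add: g_def convergent_LIMSEQ_iff)
      then have "(\<lambda>j. ennreal ((norm (s (r j) z - s N z))\<^sup>2)) \<longlonglongrightarrow> ennreal ((norm (g z - s N z))\<^sup>2)"
        by (intro tendsto_intros)
      then show ?case
        by (intro lim_imp_Liminf[symmetric]) auto
    qed
    also have "\<dots> \<le> liminf (\<lambda>j. \<integral>\<^sup>+z. ennreal ((norm (s (r j) z - s N z))\<^sup>2) \<partial>haar_circle)"
      by (rule nn_integral_liminf) measurable
    also have "\<dots> \<le> ennreal (tail N)"
    proof (rule Liminf_le)
      have "(\<integral>\<^sup>+z. ennreal ((norm (s (r j) z - s N z))\<^sup>2) \<partial>haar_circle) \<le> ennreal (tail N)" if "N \<le> j" for j
        using s_dist[of N "r j"] r_ge[of j] that s_int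
        by (subst nn_integral_eq_integral) (auto intro!: ennreal_leI)
      then show "\<forall>\<^sub>F j in sequentially. (\<integral>\<^sup>+z. ennreal ((norm (s (r j) z - s N z))\<^sup>2) \<partial>haar_circle) \<le> ennreal (tail N)"
        by (auto simp: eventually_sequentially)
    qed simp
    finally show ?thesis .
  qed
  have int: "integrable haar_circle (\<lambda>z. (norm (g z - s N z))\<^sup>2)" for N
    using nn[of N] by (intro integrableI_bounded) (auto simp: le_less_trans)
  have le: "(\<integral>z. (norm (g z - s N z))\<^sup>2 \<partial>haar_circle) \<le> tail N" for N
    using nn[of N] tail0 by (subst (asm) nn_integral_eq_integral[OF int]) auto
  show thesis
    using that[OF g_meas] int le unfolding s_def tail_def by blast
qed

lemma integrable_norm_mult:
  fixes f g :: "complex \<Rightarrow> ell2"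
  assumes "f \<in> borel_measurable M" "g \<in> borel_measurable M"
    "integrable M (\<lambda>z. (norm (f z))\<^sup>2)" "integrable M (\<lambda>z. (norm (g z))\<^sup>2)"
  shows "integrable M (\<lambda>z. norm (f z) * norm (g z))"
proof (rule Bochner_Integration.integrable_bound)
  show "integrable M (\<lambda>z. (norm (f z))\<^sup>2 + (norm (g z))\<^sup>2)"
    using assms by simp
  show "AE z in M. norm (norm (f z) * norm (g z)) \<le> norm ((norm (f z))\<^sup>2 + (norm (g z))\<^sup>2)"
  proof (rule AE_I2)
    fix z
    have "0 \<le> norm (f z) * norm (g z)" by simp
    then have "norm (f z) * norm (g z) \<le> (norm (f z))\<^sup>2 + (norm (g z))\<^sup>2"
      using sum_squares_bound[of "norm (f z)" "norm (g z)"] by linarith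
    then show "norm (norm (f z) * norm (g z)) \<le> norm ((norm (f z))\<^sup>2 + (norm (g z))\<^sup>2)"
      by simp
  qed
qed (use assms in measurable)

lemma integrable_cinner_scaleC:
  fixes f g :: "complex \<Rightarrow> ell2"
  assumes "f \<in> borel_measurable M" "g \<in> borel_measurable M"
    "integrable M (\<lambda>z. (norm (f z))\<^sup>2)" "integrable M (\<lambda>z. (norm (g z))\<^sup>2)"
  shows "integrable M (\<lambda>z. \<langle>f z, x\<rangle> *\<^sub>C g z)"
proof (rule Bochner_Integration.integrable_bound)
  show "integrable M (\<lambda>z. norm x * (norm (f z) * norm (g z)))"
    using integrable_norm_mult[OF assms] by simp
  have "cmod \<langle>f z, x\<rangle> * norm (g z) \<le> (norm (f z) * norm x) * norm (g z)" for z
    by (intro mult_right_mono cmod_cinner_le) auto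
  then show "AE z in M. norm (\<langle>f z, x\<rangle> *\<^sub>C g z) \<le> norm (norm x * (norm (f z) * norm (g z)))"
    by (intro AE_I2) (simp add: norm_scaleC mult_ac)
qed (use assms in measurable)

lemma integral_trig_poly_cross:
  assumes "integrable haar_circle e" "finite I"
  shows "(\<integral>z. \<langle>trig_poly I a z, x\<rangle> *\<^sub>C e z \<partial>haar_circle) = (\<Sum>k\<in>I. \<langle>a k, x\<rangle> *\<^sub>C vfourier e k)"
proof -
  have "(\<integral>z. \<langle>trig_poly I a z, x\<rangle> *\<^sub>C e z \<partial>haar_circle)
      = (\<integral>z. (\<Sum>k\<in>I. \<langle>a k, x\<rangle> *\<^sub>C z powi (- k) *\<^sub>C e z) \<partial>haar_circle)"
    by (intro Bochner_Integration.integral_cong refl)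
       (simp add: trig_poly_def cinner.sum_left cinner_scaleC_left scaleC.sum_left scaleC_scaleC
          power_int_circle(3) mult.commute)
  also have "\<dots> = (\<Sum>k\<in>I. (\<integral>z. \<langle>a k, x\<rangle> *\<^sub>C z powi (- k) *\<^sub>C e z \<partial>haar_circle))"
    by (intro Bochner_Integration.integral_sum integrable_bounded_linear[OF scaleC.bounded_linear_right]
        integrable_power_int_scaleC assms)
  also have "\<dots> = (\<Sum>k\<in>I. \<langle>a k, x\<rangle> *\<^sub>C vfourier e k)"
    unfolding vfourier_def
    by (intro sum.cong refl integral_bounded_linear[OF scaleC.bounded_linear_right]
        integrable_power_int_scaleC assms)
  finally show ?thesis .
qed

lemma integral_cross_trig_poly:
  assumes "integrable haar_circle e" "finite I"
  shows "(\<integral>z. \<langle>e z, x\<rangle> *\<^sub>C trig_poly I a z \<partial>haar_circle) = (\<Sum>k\<in>I. \<langle>vfourier e k, x\<rangle> *\<^sub>C a k)"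
proof -
  have shift: "\<langle>e z, x\<rangle> * z powi k = \<langle>z powi (- k) *\<^sub>C e z, x\<rangle>" if "z \<in> sphere 0 1" for z k
    using that by (simp add: power_int_circle(3) cinner_scaleC_left mult.commute)
  have int: "integrable haar_circle (\<lambda>z. \<langle>z powi (- k) *\<^sub>C e z, x\<rangle>)" for k
    by (intro integrable_bounded_linear[OF cinner.bounded_linear_left] integrable_power_int_scaleC assms)
  have "(\<integral>z. \<langle>e z, x\<rangle> *\<^sub>C trig_poly I a z \<partial>haar_circle)
      = (\<integral>z. (\<Sum>k\<in>I. \<langle>z powi (- k) *\<^sub>C e z, x\<rangle> *\<^sub>C a k) \<partial>haar_circle)"
    by (intro Bochner_Integration.integral_cong refl)
       (simp add: trig_poly_def scaleC.sum_right scaleC_scaleC shift)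
  also have "\<dots> = (\<Sum>k\<in>I. (\<integral>z. \<langle>z powi (- k) *\<^sub>C e z, x\<rangle> *\<^sub>C a k \<partial>haar_circle))"
    by (intro Bochner_Integration.integral_sum integrable_bounded_linear[OF scaleC.bounded_linear_left] int)
  also have "\<dots> = (\<Sum>k\<in>I. (\<integral>z. \<langle>z powi (- k) *\<^sub>C e z, x\<rangle> \<partial>haar_circle) *\<^sub>C a k)"
    by (intro sum.cong refl integral_bounded_linear[OF scaleC.bounded_linear_left] int)
  also have "\<dots> = (\<Sum>k\<in>I. \<langle>vfourier e k, x\<rangle> *\<^sub>C a k)"
    unfolding vfourier_def
    by (intro sum.cong refl arg_cong2[where f = "(*\<^sub>C)"]
        integral_bounded_linear[OF cinner.bounded_linear_left] integrable_power_int_scaleC assms)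
  finally show ?thesis .
qed

text \<open>Let \<open>e\<close> be the difference of \<open>g\<close> and its partial sum of order \<open>N\<close>.  The coefficients of \<open>e\<close> below \<open>N\<close>
  vanish, so the mixed terms of \<open>\<integral> g g\<^sup>* dm\<close> vanish and \<open>\<integral> e e\<^sup>* dm\<close> remains.  Its norm is at most
  the squared norm of \<open>e\<close>.\<close>

lemma exists_H2_function:
  fixes a :: "nat \<Rightarrow> ell2"
  assumes a: "summable (\<lambda>n. (norm (a n))\<^sup>2)"
  obtains g where "g \<in> H2_ell2" "\<And>n. vfourier g (int n) = a n"
    "\<And>N x. norm (integral_rank_one g x - (\<Sum>n<N. \<langle>a n, x\<rangle> *\<^sub>C a n))
       \<le> (\<Sum>n. (norm (a (n + N)))\<^sup>2) * norm x"
proof -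
  define tail where "tail = (\<lambda>N. \<Sum>n. (norm (a (n + N)))\<^sup>2)"
  have tail: "tail \<longlonglongrightarrow> 0"
    unfolding tail_def by (rule suminf_exist_split2[OF a])
  obtain g where g [measurable]: "g \<in> borel_measurable haar_circle"
    and int: "\<And>N. integrable haar_circle (\<lambda>z. (norm (g z - fourier_sum a N z))\<^sup>2)"
    and le: "\<And>N. (\<integral>z. (norm (g z - fourier_sum a N z))\<^sup>2 \<partial>haar_circle) \<le> tail N"
    using riesz_fischer[OF a] unfolding tail_def by blast
  have s_cont: "continuous_on (sphere 0 1) (fourier_sum a N)" for N
    by (rule continuous_on_trig_poly)
  have s_meas [measurable]: "fourier_sum a N \<in> borel_measurable haar_circle" for N
    by (rule borel_measurable_haar_circle[OF s_cont])
  have s_int: "integrable haar_circle (fourier_sum a N)" for N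
    by (rule integrable_haar_continuous[OF s_cont])
  have s_int2: "integrable haar_circle (\<lambda>z. (norm (fourier_sum a N z))\<^sup>2)" for N
    by (intro integrable_haar_continuous continuous_intros s_cont)
  have g2: "integrable haar_circle (\<lambda>z. (norm (g z))\<^sup>2)"
    using int[of 0] by (simp add: trig_poly_def)
  have gi: "integrable haar_circle g"
    by (rule integrable_of_square_integrable[OF g g2])
  have s_coeff: "vfourier (fourier_sum a N) k = (if 0 \<le> k \<and> k < int N then a (nat k) else 0)" for k N
    by (simp add: vfourier_trig_poly)
  \<comment> \<open>convergence in \<open>L\<^sup>2\<close> implies convergence of each coefficient\<close>
  have coeff: "vfourier g k = b" if b: "\<And>N. int N > k \<Longrightarrow> vfourier (fourier_sum a N) k = b" for k b
  proof -
    have "norm (vfourier g k - b) \<le> sqrt (tail N)" if "int N > k" for N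
    proof -
      have "norm (vfourier g k - b) = norm (vfourier (\<lambda>z. g z - fourier_sum a N z) k)"
        using b[OF that] by (simp add: vfourier_diff gi s_int)
      also have "\<dots> \<le> (\<integral>z. norm (g z - fourier_sum a N z) \<partial>haar_circle)"
        by (intro norm_vfourier_le Bochner_Integration.integrable_diff gi s_int)
      also have "\<dots> \<le> sqrt (\<integral>z. (norm (g z - fourier_sum a N z))\<^sup>2 \<partial>haar_circle)"
        by (rule integral_norm_le_sqrt[OF _ int]) measurable
      also have "\<dots> \<le> sqrt (tail N)"
        using le by simp
      finally show ?thesis .
    qed
    moreover have "(\<lambda>N. sqrt (tail N)) \<longlonglongrightarrow> sqrt 0"
      by (intro tendsto_intros tail)
    ultimately have "norm (vfourier g k - b) \<le> 0"
      by (intro LIMSEQ_le_const[where X = "\<lambda>N. sqrt (tail N)"])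
         (auto intro!: exI[of _ "nat (k + 1)"])
    then show ?thesis by simp
  qed
  have pos: "vfourier g (int n) = a n" for n
    by (rule coeff) (simp add: s_coeff)
  have neg: "vfourier g n = 0" if "n < 0" for n
    by (rule coeff) (use that in \<open>simp add: s_coeff\<close>)
  have main: "norm (integral_rank_one g x - (\<Sum>n<N. \<langle>a n, x\<rangle> *\<^sub>C a n)) \<le> tail N * norm x" for N x
  proof -
    define s where "s = fourier_sum a N"
    define e where "e = (\<lambda>z. g z - s z)"
    have [measurable]: "s \<in> borel_measurable haar_circle" "e \<in> borel_measurable haar_circle"
      unfolding s_def e_def by measurable
    have e2: "integrable haar_circle (\<lambda>z. (norm (e z))\<^sup>2)"
      unfolding e_def s_def by (rule int)
    have s2: "integrable haar_circle (\<lambda>z. (norm (s z))\<^sup>2)"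
      unfolding s_def by (rule s_int2)
    have ei: "integrable haar_circle e"
      unfolding e_def s_def by (intro Bochner_Integration.integrable_diff gi s_int)
    have e0: "vfourier e k = 0" if "k \<in> {0..<int N}" for k
      using that pos[of "nat k"] unfolding e_def s_def by (simp add: vfourier_diff gi s_int s_coeff)
    note ints = integrable_cinner_scaleC[of _ haar_circle]
    have "integral_rank_one g x = (\<integral>z. (\<langle>s z, x\<rangle> *\<^sub>C s z + \<langle>s z, x\<rangle> *\<^sub>C e z)
        + (\<langle>e z, x\<rangle> *\<^sub>C s z + \<langle>e z, x\<rangle> *\<^sub>C e z) \<partial>haar_circle)"
      unfolding integral_rank_one_def rank_one_def e_def
      by (intro Bochner_Integration.integral_cong refl)
         (simp add: cinner.diff_left scaleC.diff_left scaleC.diff_right)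
    also have "\<dots> = (\<integral>z. \<langle>s z, x\<rangle> *\<^sub>C s z \<partial>haar_circle) + (\<integral>z. \<langle>s z, x\<rangle> *\<^sub>C e z \<partial>haar_circle)
        + ((\<integral>z. \<langle>e z, x\<rangle> *\<^sub>C s z \<partial>haar_circle) + (\<integral>z. \<langle>e z, x\<rangle> *\<^sub>C e z \<partial>haar_circle))"
      using e2 s2 by (simp add: ints)
    also have "(\<integral>z. \<langle>s z, x\<rangle> *\<^sub>C e z \<partial>haar_circle) = 0"
      unfolding s_def by (subst integral_trig_poly_cross[OF ei]) (simp_all add: e0)
    also have "(\<integral>z. \<langle>e z, x\<rangle> *\<^sub>C s z \<partial>haar_circle) = 0"
      unfolding s_def by (subst integral_cross_trig_poly[OF ei]) (simp_all add: e0 cinner.zero_left)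
    also have "(\<integral>z. \<langle>s z, x\<rangle> *\<^sub>C s z \<partial>haar_circle) = (\<Sum>n<N. \<langle>a n, x\<rangle> *\<^sub>C a n)"
      unfolding s_def
      by (subst integral_trig_poly_cross[OF s_int])
         (simp_all add: s_coeff sum_int_nat[of "\<lambda>k. \<langle>a k, x\<rangle> *\<^sub>C a k" 0, simplified] atLeast0LessThan)
    finally have "integral_rank_one g x - (\<Sum>n<N. \<langle>a n, x\<rangle> *\<^sub>C a n) = (\<integral>z. \<langle>e z, x\<rangle> *\<^sub>C e z \<partial>haar_circle)"
      by simp
    also have "norm \<dots> \<le> (\<integral>z. norm (\<langle>e z, x\<rangle> *\<^sub>C e z) \<partial>haar_circle)"
      by (rule integral_norm_bound)
    also have "\<dots> \<le> (\<integral>z. (norm (e z))\<^sup>2 * norm x \<partial>haar_circle)"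
    proof (rule integral_mono)
      show "integrable haar_circle (\<lambda>z. norm (\<langle>e z, x\<rangle> *\<^sub>C e z))"
        using e2 by (simp add: ints)
      show "norm (\<langle>e z, x\<rangle> *\<^sub>C e z) \<le> (norm (e z))\<^sup>2 * norm x" for z
        using mult_right_mono[OF cmod_cinner_le[of "e z" x], of "norm (e z)"]
        by (simp add: norm_scaleC power2_eq_square mult_ac)
    qed (use e2 in simp)
    also have "\<dots> = (\<integral>z. (norm (e z))\<^sup>2 \<partial>haar_circle) * norm x"
      by simp
    also have "\<dots> \<le> tail N * norm x"
      using le[of N] by (intro mult_right_mono) (simp_all add: e_def s_def)
    finally show ?thesis .
  qed
  show thesis
    using that[of g] g2 neg pos main unfolding H2_ell2_def tail_def by simp
qed

section \<open>Fejer means and multiplication by power series\<close>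

text \<open>A nonnegative difference \<open>n\<close> occurs \<open>N - n\<close> times.\<close>

lemma sum_diff_indices:
  fixes F :: "int \<Rightarrow> 'a :: real_vector"
  assumes "\<And>n. n < 0 \<Longrightarrow> F n = 0"
  shows "(\<Sum>j<N. \<Sum>k<N. F (int j - int k)) = (\<Sum>n<N. real (N - n) *\<^sub>R F (int n))"
proof (induction N)
  case (Suc N)
  have "(\<Sum>j<Suc N. \<Sum>k<Suc N. F (int j - int k))
      = (\<Sum>j<N. \<Sum>k<N. F (int j - int k)) + (\<Sum>j<N. F (int j - int N)) + (\<Sum>k<Suc N. F (int N - int k))"
    by (simp add: sum.distrib)
  also have "(\<Sum>j<N. F (int j - int N)) = 0"
    by (intro sum.neutral) (simp add: assms)
  also have "(\<Sum>k<Suc N. F (int N - int k)) = (\<Sum>n<Suc N. F (int n))"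
    by (rule sum.reindex_bij_witness[of _ "\<lambda>n. N - n" "\<lambda>n. N - n"]) (auto simp: of_nat_diff)
  also have "(\<Sum>j<N. \<Sum>k<N. F (int j - int k)) = (\<Sum>n<Suc N. real (N - n) *\<^sub>R F (int n))"
    using Suc by simp
  also have "\<dots> + 0 + (\<Sum>n<Suc N. F (int n)) = (\<Sum>n<Suc N. real (Suc N - n) *\<^sub>R F (int n))"
    unfolding add_0_right sum.distrib[symmetric]
    by (intro sum.cong refl) (auto simp: Suc_diff_le algebra_simps)
  finally show ?case .
qed simp

definition fejer_mean :: "(complex \<Rightarrow> ell2) \<Rightarrow> nat \<Rightarrow> complex \<Rightarrow> ell2"
  where "fejer_mean f N = fourier_sum (\<lambda>n. of_real (real (N - n) / real N) *\<^sub>C vfourier f (int n)) N"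

text \<open>The Fejer mean averages the translates of \<open>f\<close> against a nonnegative kernel with integral \<open>1\<close>.  The
  kernel is a finite sum of products of characters, so integration over the translations only involves
  finitely many coefficients of \<open>\<parallel>f\<parallel>\<close>.\<close>

lemma fejer_mean_L1_le:
  assumes f: "f \<in> H1_ell2" and N: "0 < N"
  shows "(\<integral>z. norm (fejer_mean f N z) \<partial>haar_circle) \<le> H1_norm f"
proof -
  have fi: "integrable haar_circle f" and neg: "\<And>n. n < 0 \<Longrightarrow> vfourier f n = 0"
    using f by (auto simp: H1_ell2_def)
  have [measurable]: "f \<in> borel_measurable haar_circle"
    using fi by simp
  \<comment> \<open>\<open>N\<close> times the Fejer kernel at \<open>z / w\<close>; nonnegative as the squared modulus of a Dirichlet sum\<close>
  define \<kappa> where "\<kappa> = (\<lambda>z w. \<Sum>j<N. \<Sum>k<N. z powi (int j - int k) * w powi (- (int j - int k)) :: complex)"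
  define c where "c = (\<lambda>m. \<integral>w. w powi (- m) * of_real (norm (f w)) \<partial>haar_circle)"
  have \<kappa>: "\<kappa> z w = of_real (cmod (\<kappa> z w))" if z: "z \<in> sphere 0 1" and w: "w \<in> sphere 0 1" for z w
  proof -
    define D where "D = (\<Sum>j<N. z powi int j * w powi (- int j))"
    have cn: "cnj (z powi k * w powi (- k)) = z powi (- k) * w powi k" for k
      by (simp only: complex_cnj_mult power_int_circle(3)[OF z, symmetric]
          power_int_circle(3)[OF w, symmetric] minus_minus)
    have pz: "z powi (j - k) = z powi j * z powi (- k)" for j k
      using power_int_circle(2)[OF z, of j "- k"] by simp
    have pw: "w powi (- (j - k)) = w powi (- j) * w powi k" for j k
      using power_int_circle(2)[OF w, of "- j" k] by simp
    have "D * cnj D = \<kappa> z w"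
      unfolding D_def \<kappa>_def cnj_sum sum_product cn pz pw by (intro sum.cong refl) (simp only: mult_ac)
    then have "\<kappa> z w = of_real ((cmod D)\<^sup>2)"
      unfolding complex_norm_square by simp
    then show ?thesis
      by (simp add: norm_power)
  qed
  have mean: "real N *\<^sub>R fejer_mean f N z = (\<integral>w. \<kappa> z w *\<^sub>C f w \<partial>haar_circle)" for z
  proof -
    have "(\<integral>w. \<kappa> z w *\<^sub>C f w \<partial>haar_circle)
        = (\<integral>w. (\<Sum>j<N. \<Sum>k<N. z powi (int j - int k) *\<^sub>C w powi (- (int j - int k)) *\<^sub>C f w) \<partial>haar_circle)"
      by (simp add: \<kappa>_def scaleC.sum_left scaleC_scaleC)
    also have "\<dots> = (\<Sum>j<N. \<Sum>k<N. z powi (int j - int k) *\<^sub>C vfourier f (int j - int k))"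
      unfolding vfourier_def
      by (subst Bochner_Integration.integral_sum,
          intro Bochner_Integration.integrable_sum integrable_bounded_linear[OF scaleC.bounded_linear_right]
            integrable_power_int_scaleC fi,
          intro sum.cong refl,
          subst Bochner_Integration.integral_sum,
          intro integrable_bounded_linear[OF scaleC.bounded_linear_right] integrable_power_int_scaleC fi,
          intro sum.cong refl integral_bounded_linear[OF scaleC.bounded_linear_right]
            integrable_power_int_scaleC fi)
    also have "\<dots> = (\<Sum>n<N. real (N - n) *\<^sub>R (z powi int n *\<^sub>C vfourier f (int n)))"
      by (rule sum_diff_indices) (simp add: neg)
    also have "\<dots> = real N *\<^sub>R fejer_mean f N z"
      unfolding fejer_mean_def trig_poly_def scaleR_sum_right
        sum_int_nat[of "\<lambda>n. real N *\<^sub>R (z powi int n *\<^sub>C of_real (real (N - n) / real N) *\<^sub>C vfourier f (int n))" 0 N,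
          simplified, symmetric]
      using N by (subst sum.reindex_bij_witness[of "{0..<int N}" int nat "{..<N}"])
        (auto simp: scaleR_ell2_scaleC scaleC_scaleC power_int_def mult.commute)
    finally show ?thesis ..
  qed
  have int_c: "integrable haar_circle (\<lambda>w. w powi m * of_real (norm (f w)))" for m
    by (rule Bochner_Integration.integrable_bound[OF fi]) (auto simp: norm_mult norm_power_int)
  have le: "norm (fejer_mean f N z) \<le> (1 / real N) * Re (\<Sum>j<N. \<Sum>k<N. z powi (int j - int k) * c (int j - int k))"
    if z: "z \<in> sphere 0 1" for z
  proof -
    have eq: "(\<integral>w. \<kappa> z w * of_real (norm (f w)) \<partial>haar_circle) = (\<Sum>j<N. \<Sum>k<N. z powi (int j - int k) * c (int j - int k))"
    proof -
      have "(\<integral>w. \<kappa> z w * of_real (norm (f w)) \<partial>haar_circle)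
        = (\<integral>w. (\<Sum>j<N. \<Sum>k<N. z powi (int j - int k) * (w powi (- (int j - int k)) * of_real (norm (f w)))) \<partial>haar_circle)"
        by (simp add: \<kappa>_def sum_distrib_right mult.assoc)
      also have "\<dots> = (\<Sum>j<N. \<Sum>k<N. z powi (int j - int k) * c (int j - int k))"
        unfolding c_def
        by (subst Bochner_Integration.integral_sum,
            intro Bochner_Integration.integrable_sum integrable_mult_right int_c,
            intro sum.cong refl,
            subst Bochner_Integration.integral_sum,
            intro integrable_mult_right int_c,
            intro sum.cong refl integral_mult_right_zero)
      finally show ?thesis .
    qed
    have "real N * norm (fejer_mean f N z) = norm (\<integral>w. \<kappa> z w *\<^sub>C f w \<partial>haar_circle)"
      unfolding mean[symmetric] by simp
    also have "\<dots> \<le> (\<integral>w. norm (\<kappa> z w *\<^sub>C f w) \<partial>haar_circle)"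
      by (rule integral_norm_bound)
    also have "complex_of_real \<dots> = (\<integral>w. \<kappa> z w * of_real (norm (f w)) \<partial>haar_circle)"
      unfolding integral_complex_of_real[symmetric] using \<kappa>[OF z]
      by (intro Bochner_Integration.integral_cong refl) (simp add: norm_scaleC)
    then have "(\<integral>w. norm (\<kappa> z w *\<^sub>C f w) \<partial>haar_circle) = Re (\<Sum>j<N. \<Sum>k<N. z powi (int j - int k) * c (int j - int k))"
      unfolding eq by (metis Re_complex_of_real)
    finally show ?thesis
      using N by (simp add: field_simps)
  qed
  have cont: "continuous_on (sphere 0 1) (\<lambda>z. \<Sum>j<N. \<Sum>k<N. z powi (int j - int k) * c (int j - int k))"
    by (intro continuous_intros continuous_on_circle_power_int)
  have "(\<integral>z. norm (fejer_mean f N z) \<partial>haar_circle)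
      \<le> (\<integral>z. (1 / real N) * Re (\<Sum>j<N. \<Sum>k<N. z powi (int j - int k) * c (int j - int k)) \<partial>haar_circle)"
  proof (rule integral_mono)
    show "integrable haar_circle (\<lambda>z. norm (fejer_mean f N z))"
      unfolding fejer_mean_def by (intro integrable_haar_continuous continuous_intros continuous_on_trig_poly)
    show "integrable haar_circle (\<lambda>z. (1 / real N) * Re (\<Sum>j<N. \<Sum>k<N. z powi (int j - int k) * c (int j - int k)))"
      by (intro integrable_haar_continuous continuous_intros continuous_on_circle_power_int)
  qed (use le in simp)
  also have "\<dots> = (1 / real N) * Re (\<integral>z. (\<Sum>j<N. \<Sum>k<N. z powi (int j - int k) * c (int j - int k)) \<partial>haar_circle)"
    by (simp add: integral_Re[OF integrable_haar_continuous[OF cont]] del: Re_sum)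
  also have "(\<integral>z. (\<Sum>j<N. \<Sum>k<N. z powi (int j - int k) * c (int j - int k)) \<partial>haar_circle)
      = (\<Sum>j<N. \<Sum>k<N. (\<integral>z. z powi (int j - int k) \<partial>haar_circle) * c (int j - int k))"
    by (subst Bochner_Integration.integral_sum,
        intro integrable_haar_continuous continuous_intros continuous_on_circle_power_int,
        intro sum.cong refl,
        subst Bochner_Integration.integral_sum,
        intro integrable_haar_continuous continuous_intros continuous_on_circle_power_int,
        intro sum.cong refl integral_mult_left_zero)
  also have "\<dots> = (\<Sum>j<N. \<Sum>k<N. if k = j then c 0 else 0)"
    by (intro sum.cong refl) (auto simp: integral_power_int_circle)
  also have "\<dots> = of_nat N * c 0"
    by simp
  also have "c 0 = of_real (H1_norm f)"
    by (simp add: c_def H1_norm_def integral_complex_of_real)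
  finally show ?thesis
    using N by simp
qed

text \<open>The partial sums of the power series converge uniformly on the circle, so multiplication of \<open>F\<close> by \<open>E\<close>
  convolves the coefficients.\<close>

lemma vfourier_power_series_mult:
  assumes e: "summable (\<lambda>i. cmod (e i))" and E: "\<And>z. z \<in> sphere 0 1 \<Longrightarrow> (\<lambda>i. e i * z ^ i) sums E z"
    and E_meas: "E \<in> borel_measurable haar_circle"
    and F: "integrable haar_circle F" "\<And>m. m < 0 \<Longrightarrow> vfourier F m = 0"
  shows "vfourier (\<lambda>z. E z *\<^sub>C F z) (int n) = (\<Sum>i\<le>n. e i *\<^sub>C vfourier F (int (n - i)))"
    and "m < 0 \<Longrightarrow> vfourier (\<lambda>z. E z *\<^sub>C F z) m = 0"
proof -
  define tail where "tail = (\<lambda>M. \<Sum>i. cmod (e (i + M)))"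
  have tail: "tail \<longlonglongrightarrow> 0"
    unfolding tail_def by (rule suminf_exist_split2[OF e])
  have [measurable]: "F \<in> borel_measurable haar_circle" "E \<in> borel_measurable haar_circle"
    using F(1) E_meas by simp_all
  have E_le: "cmod (E z - (\<Sum>i<M. e i * z ^ i)) \<le> tail M" if z: "z \<in> sphere 0 1" for z M
  proof -
    have nrm: "cmod (e i * z ^ i) = cmod (e i)" for i
      using z by (simp add: norm_mult norm_power)
    have "E z - (\<Sum>i<M. e i * z ^ i) = (\<Sum>i. e (i + M) * z ^ (i + M))"
      using suminf_minus_initial_segment[of "\<lambda>i. e i * z ^ i" M] E[OF z] by (simp add: sums_iff)
    also have "cmod \<dots> \<le> (\<Sum>i. cmod (e (i + M) * z ^ (i + M)))"
      using e unfolding nrm[symmetric] by (intro summable_norm) (simp add: nrm summable_iff_shift[of "\<lambda>i. cmod (e i)"])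
    finally show ?thesis by (simp add: tail_def nrm)
  qed
  have int_bdd: "integrable haar_circle (\<lambda>z. G z *\<^sub>C F z)"
    if "G \<in> borel_measurable haar_circle" "\<And>z. z \<in> sphere 0 1 \<Longrightarrow> cmod (G z) \<le> B" for G B
  proof (rule Bochner_Integration.integrable_bound)
    show "integrable haar_circle (\<lambda>z. B * norm (F z))"
      using F(1) by simp
    show "AE z in haar_circle. norm (G z *\<^sub>C F z) \<le> norm (B * norm (F z))"
    proof (rule AE_I2)
      fix z assume "z \<in> space haar_circle"
      then have "cmod (G z) \<le> \<bar>B\<bar>" using that(2)[of z] by simp
      then show "norm (G z *\<^sub>C F z) \<le> norm (B * norm (F z))"
        by (simp add: norm_scaleC abs_mult mult_right_mono)
    qed
  qed (use that(1) in measurable)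
  have intE: "integrable haar_circle (\<lambda>z. E z *\<^sub>C F z)"
    using int_bdd[OF E_meas, of "tail 0"] E_le[of _ 0] by simp
  have intP: "integrable haar_circle (\<lambda>z. \<Sum>i<M. e i *\<^sub>C z powi int i *\<^sub>C F z)" for M
    by (intro Bochner_Integration.integrable_sum integrable_bounded_linear[OF scaleC.bounded_linear_right]
        integrable_power_int_scaleC F(1))
  have sums: "(\<lambda>i. e i *\<^sub>C vfourier F (m - int i)) sums vfourier (\<lambda>z. E z *\<^sub>C F z) m" for m
    unfolding sums_def
  proof (rule LIM_zero_cancel, rule Lim_null_comparison)
    show "(\<lambda>M. tail M * (\<integral>z. norm (F z) \<partial>haar_circle)) \<longlonglongrightarrow> 0"
      using tendsto_mult_right[OF tail, of "\<integral>z. norm (F z) \<partial>haar_circle"] by simp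
    show "\<forall>\<^sub>F M in sequentially. norm ((\<Sum>i<M. e i *\<^sub>C vfourier F (m - int i)) - vfourier (\<lambda>z. E z *\<^sub>C F z) m)
        \<le> tail M * (\<integral>z. norm (F z) \<partial>haar_circle)"
    proof (intro always_eventually allI)
      fix M
      have "(\<Sum>i<M. e i *\<^sub>C vfourier F (m - int i)) = vfourier (\<lambda>z. \<Sum>i<M. e i *\<^sub>C z powi int i *\<^sub>C F z) m"
        by (subst vfourier_sum, intro integrable_bounded_linear[OF scaleC.bounded_linear_right]
              integrable_power_int_scaleC F(1), simp only: vfourier_scaleC vfourier_shift)
      then have "norm ((\<Sum>i<M. e i *\<^sub>C vfourier F (m - int i)) - vfourier (\<lambda>z. E z *\<^sub>C F z) m)
          = norm (vfourier (\<lambda>z. E z *\<^sub>C F z - (\<Sum>i<M. e i *\<^sub>C z powi int i *\<^sub>C F z)) m)"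
        by (simp only: vfourier_diff[OF intE intP] norm_minus_commute)
      also have "\<dots> \<le> (\<integral>z. norm (E z *\<^sub>C F z - (\<Sum>i<M. e i *\<^sub>C z powi int i *\<^sub>C F z)) \<partial>haar_circle)"
        by (intro norm_vfourier_le Bochner_Integration.integrable_diff intE intP)
      also have "\<dots> \<le> (\<integral>z. tail M * norm (F z) \<partial>haar_circle)"
      proof (rule integral_mono)
        fix z assume "z \<in> space haar_circle"
        then have z: "z \<in> sphere 0 1" by simp
        have "E z *\<^sub>C F z - (\<Sum>i<M. e i *\<^sub>C z powi int i *\<^sub>C F z) = (E z - (\<Sum>i<M. e i * z ^ i)) *\<^sub>C F z"
          by (simp add: scaleC.diff_left scaleC.sum_left scaleC_scaleC)
        then show "norm (E z *\<^sub>C F z - (\<Sum>i<M. e i *\<^sub>C z powi int i *\<^sub>C F z)) \<le> tail M * norm (F z)"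
          using E_le[OF z, of M] by (simp add: norm_scaleC mult_right_mono)
      qed (use F(1) intE intP in \<open>auto intro!: Bochner_Integration.integrable_diff integrable_norm\<close>)
      finally show "norm ((\<Sum>i<M. e i *\<^sub>C vfourier F (m - int i)) - vfourier (\<lambda>z. E z *\<^sub>C F z) m)
          \<le> tail M * (\<integral>z. norm (F z) \<partial>haar_circle)"
        by simp
    qed
  qed
  show "vfourier (\<lambda>z. E z *\<^sub>C F z) (int n) = (\<Sum>i\<le>n. e i *\<^sub>C vfourier F (int (n - i)))"
  proof -
    have "(\<lambda>i. e i *\<^sub>C vfourier F (int n - int i)) sums (\<Sum>i\<le>n. e i *\<^sub>C vfourier F (int n - int i))"
      by (rule sums_finite) (auto simp: F(2))
    from sums_unique2[OF sums this] show ?thesis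
      by (simp add: of_nat_diff)
  qed
  show "vfourier (\<lambda>z. E z *\<^sub>C F z) m = 0" if "m < 0"
    using sums_unique2[OF sums[of m], of 0] that by (simp add: F(2))
qed

section \<open>Approximate outer factorisation\<close>

text \<open>The product of the real parts is half the real part of \<open>u v + u cnj v\<close>.  On the circle the second
  term is a monomial or the conjugate of one.\<close>

lemma Re_mult_monomials_circle:
  assumes "cmod z = 1"
  shows "Re (a * z ^ i) * Re (b * z ^ j) =
    Re (poly (monom (a * b / 2) (i + j)
      + (if j \<le> i then monom (a * cnj b / 2) (i - j) else monom (cnj a * b / 2) (j - i))) z)"
proof -
  have zz: "z ^ m * cnj (z ^ m) = 1" for m
    using complex_norm_square[of "z ^ m"] assms by (simp add: norm_power)
  have prod: "Re u * Re v = Re (u * v / 2) + Re (u * cnj v / 2)" for u v :: complex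
    by (simp add: field_simps)
  have "Re (a * z ^ i * cnj (b * z ^ j) / 2) =
    Re (poly (if j \<le> i then monom (a * cnj b / 2) (i - j) else monom (cnj a * b / 2) (j - i)) z)"
  proof (cases "j \<le> i")
    case True
    then have "z ^ i = z ^ (i - j) * z ^ j"
      by (simp add: power_add[symmetric])
    then have "a * z ^ i * cnj (b * z ^ j) / 2 = (a * cnj b / 2) * z ^ (i - j) * (z ^ j * cnj (z ^ j))"
      by (simp add: mult_ac)
    then show ?thesis using True by (simp only: zz) (simp add: poly_monom)
  next
    case False
    then have "z ^ j = z ^ (j - i) * z ^ i"
      by (simp add: power_add[symmetric])
    then have "a * z ^ i * cnj (b * z ^ j) / 2 = cnj ((cnj a * b / 2) * z ^ (j - i)) * (z ^ i * cnj (z ^ i))"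
      by (simp add: mult_ac)
    then have "a * z ^ i * cnj (b * z ^ j) / 2 = cnj ((cnj a * b / 2) * z ^ (j - i))"
      by (simp only: zz mult_1_right)
    then show ?thesis using False by (simp only: complex_cnj(1) cnj.sel if_False poly_monom)
  qed
  moreover have "a * z ^ i * (b * z ^ j) / 2 = poly (monom (a * b / 2) (i + j)) z"
    by (simp add: poly_monom power_add mult_ac)
  ultimately show ?thesis
    unfolding prod[of "a * z ^ i"] by (simp only: poly_add plus_complex.sel)
qed

text \<open>Real trigonometric polynomials are the real parts of polynomials on the circle.\<close>

lemma Re_poly_dense_circle:
  fixes u :: "complex \<Rightarrow> real"
  assumes u: "continuous_on (sphere 0 1) u" and "0 < e"
  obtains q where "\<And>z. z \<in> sphere 0 1 \<Longrightarrow> \<bar>u z - Re (poly q z)\<bar> < e"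
proof -
  define R where "R = {f :: complex \<Rightarrow> real. \<exists>q. \<forall>z\<in>sphere 0 1. f z = Re (poly q z)}"
  have add: "(\<lambda>z. f z + g z) \<in> R" if "f \<in> R" "g \<in> R" for f g
  proof -
    from that obtain p q where "\<forall>z\<in>sphere 0 1. f z = Re (poly p z)" "\<forall>z\<in>sphere 0 1. g z = Re (poly q z)"
      by (auto simp: R_def)
    then show ?thesis
      unfolding R_def by (intro CollectI exI[of _ "p + q"]) simp
  qed
  have zero: "(\<lambda>_. 0) \<in> R"
    unfolding R_def by (intro CollectI exI[of _ 0]) simp
  have sum: "(\<lambda>z. \<Sum>i\<in>I. f i z) \<in> R" if "\<And>i. i \<in> I \<Longrightarrow> f i \<in> R" for f and I :: "nat set"
    using that by (induction I rule: infinite_finite_induct) (auto intro: add zero)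
  have mult: "(\<lambda>z. f z * g z) \<in> R" if "f \<in> R" "g \<in> R" for f g
  proof -
    from that obtain p q where pq: "\<forall>z\<in>sphere 0 1. f z = Re (poly p z)" "\<forall>z\<in>sphere 0 1. g z = Re (poly q z)"
      by (auto simp: R_def)
    have "(\<lambda>z. \<Sum>i\<le>degree p. \<Sum>j\<le>degree q. Re (coeff p i * z ^ i) * Re (coeff q j * z ^ j)) \<in> R"
    proof (intro sum)
      fix i j
      show "(\<lambda>z. Re (coeff p i * z ^ i) * Re (coeff q j * z ^ j)) \<in> R"
        unfolding R_def using Re_mult_monomials_circle by fastforce
    qed
    then obtain r where "\<forall>z\<in>sphere 0 1. (\<Sum>i\<le>degree p. \<Sum>j\<le>degree q. Re (coeff p i * z ^ i) * Re (coeff q j * z ^ j)) = Re (poly r z)"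
      by (auto simp: R_def)
    then have "\<forall>z\<in>sphere 0 1. f z * g z = Re (poly r z)"
      using pq by (simp add: poly_altdef Re_sum sum_product)
    then show ?thesis
      unfolding R_def by blast
  qed
  interpret function_ring_on R "sphere 0 1"
  proof
    fix f assume "f \<in> R"
    then obtain q where "\<forall>z\<in>sphere 0 1. f z = Re (poly q z)"
      by (auto simp: R_def)
    then show "continuous_on (sphere 0 1) f"
      by (subst continuous_on_cong[OF refl, of _ _ "\<lambda>z. Re (poly q z)"]) (auto intro!: continuous_intros)
  next
    fix c show "(\<lambda>_. c) \<in> R"
      unfolding R_def by (intro CollectI exI[of _ "[:of_real c:]"]) simp
  next
    fix x y :: complex assume "x \<noteq> y"
    moreover have "Re \<in> R"
      unfolding R_def by (intro CollectI exI[of _ "[:0, 1:]"]) simp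
    moreover have "Im \<in> R"
      unfolding R_def by (intro CollectI exI[of _ "[:0, - \<i>:]"]) simp
    ultimately show "\<exists>f\<in>R. f x \<noteq> f y"
      by (metis complex_eqI)
  qed (use add mult in auto)
  from Stone_Weierstrass_basic[OF u \<open>0 < e\<close>] obtain f where "f \<in> R" "\<And>z. z \<in> sphere 0 1 \<Longrightarrow> \<bar>u z - f z\<bar> < e"
    by blast
  moreover from \<open>f \<in> R\<close> obtain q where "\<forall>z\<in>sphere 0 1. f z = Re (poly q z)"
    unfolding R_def by blast
  ultimately show thesis
    by (intro that[of q]) metis
qed

text \<open>An entire function has an absolutely convergent power series on the circle.\<close>

lemma power_series_exp_poly:
  obtains e where "summable (\<lambda>i. cmod (e i))"
    "\<And>z. z \<in> sphere 0 1 \<Longrightarrow> (\<lambda>i. e i * z ^ i) sums exp (poly q z)"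
proof -
  define e where "e = (\<lambda>i. (deriv ^^ i) (\<lambda>z. exp (poly q z)) 0 / fact i)"
  have hol: "(\<lambda>z. exp (poly q z)) holomorphic_on ball 0 3"
    by (intro holomorphic_intros)
  have sums: "(\<lambda>i. e i * z ^ i) sums exp (poly q z)" if "z \<in> ball 0 3" for z
    using holomorphic_power_series[OF hol that] by (simp add: e_def)
  have "summable (\<lambda>i. e i * 2 ^ i)"
    using sums[of 2] by (auto simp: sums_iff)
  then have "summable (\<lambda>i. norm (e i * 1 ^ i))"
    by (rule powser_insidea) simp
  then show thesis
    using sums by (intro that[of e]) auto
qed

text \<open>The factors are \<open>E = exp (q/2)\<close> and \<open>G = p exp (-q/2)\<close>, where \<open>Re q\<close> is within \<open>\<delta>\<close> of
  \<open>ln (\<parallel>p\<parallel> + \<delta>)\<close> on the circle.  So \<open>|E|\<^sup>2\<close> is at most \<open>e\<^sup>\<delta> (\<parallel>p\<parallel> + \<delta>)\<close> and \<open>\<parallel>G\<parallel>\<^sup>2\<close> is at most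
  \<open>e\<^sup>\<delta> \<parallel>p\<parallel>\<close>.  Both factors are analytic, and Bessel's inequality bounds their coefficients.\<close>

lemma approximate_outer_factorisation:
  fixes N :: nat
  assumes I: "p = fourier_sum a N" and "0 < \<delta>"
  obtains h g where "\<And>n. n < N \<Longrightarrow> a n = (\<Sum>i\<le>n. h i *\<^sub>C g (n - i))"
    "(\<Sum>i<N. (cmod (h i))\<^sup>2) \<le> exp \<delta> * ((\<integral>z. norm (p z) \<partial>haar_circle) + \<delta>)"
    "(\<Sum>k<N. (norm (g k))\<^sup>2) \<le> exp \<delta> * (\<integral>z. norm (p z) \<partial>haar_circle)"
proof -
  have p_cont: "continuous_on (sphere 0 1) p"
    unfolding I by (rule continuous_on_trig_poly)
  have p_coeff: "vfourier p k = (if 0 \<le> k \<and> k < int N then a (nat k) else 0)" for k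
    unfolding I by (simp add: vfourier_trig_poly)
  have pos: "0 < norm (p z) + \<delta>" for z
    using \<open>0 < \<delta>\<close> by (simp add: add_nonneg_pos)
  have "continuous_on (sphere 0 1) (\<lambda>z. ln (norm (p z) + \<delta>))"
    by (intro continuous_intros p_cont) (use pos in \<open>simp add: less_imp_neq[symmetric]\<close>)
  then obtain q where q: "\<And>z. z \<in> sphere 0 1 \<Longrightarrow> \<bar>ln (norm (p z) + \<delta>) - Re (poly q z)\<bar> < \<delta>"
    using Re_poly_dense_circle \<open>0 < \<delta>\<close> by blast
  have up: "exp (Re (poly q z)) \<le> exp \<delta> * (norm (p z) + \<delta>)" if "z \<in> sphere 0 1" for z
  proof -
    have "exp (Re (poly q z)) \<le> exp (\<delta> + ln (norm (p z) + \<delta>))"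
      using q[OF that] by simp
    then show ?thesis using pos[of z] by (simp add: exp_add)
  qed
  have lo: "exp (- Re (poly q z)) \<le> exp \<delta> / (norm (p z) + \<delta>)" if "z \<in> sphere 0 1" for z
  proof -
    have "exp (- Re (poly q z)) \<le> exp (\<delta> - ln (norm (p z) + \<delta>))"
      using q[OF that] by simp
    then show ?thesis using pos[of z] by (simp add: exp_diff)
  qed
  define E where "E = (\<lambda>z. exp (poly (smult (1/2) q) z))"
  define E' where "E' = (\<lambda>z. exp (poly (smult (-1/2) q) z))"
  obtain h where h: "summable (\<lambda>i. cmod (h i))" "\<And>z. z \<in> sphere 0 1 \<Longrightarrow> (\<lambda>i. h i * z ^ i) sums E z"
    using power_series_exp_poly[of "smult (1/2) q"] unfolding E_def by blast
  obtain h' where h': "summable (\<lambda>i. cmod (h' i))" "\<And>z. z \<in> sphere 0 1 \<Longrightarrow> (\<lambda>i. h' i * z ^ i) sums E' z"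
    using power_series_exp_poly[of "smult (-1/2) q"] unfolding E'_def by blast
  have E_cont: "continuous_on (sphere 0 1) E" "continuous_on (sphere 0 1) E'"
    unfolding E_def E'_def by (intro continuous_intros)+
  note E_meas = E_cont[THEN borel_measurable_haar_circle]
  have normE: "(cmod (E z))\<^sup>2 = exp (Re (poly q z))" "(cmod (E' z))\<^sup>2 = exp (- Re (poly q z))" for z
    by (simp_all add: E_def E'_def power2_eq_square flip: exp_add)
  define G where "G = (\<lambda>z. E' z *\<^sub>C p z)"
  have G_cont: "continuous_on (sphere 0 1) G"
    unfolding G_def by (intro scaleC.continuous_on E_cont p_cont)
  have EG: "(\<lambda>z. E z *\<^sub>C G z) = p"
    by (simp add: G_def E_def E'_def scaleC_scaleC flip: exp_add)
  have G_neg: "vfourier G m = 0" if "m < 0" for m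
    unfolding G_def
    by (rule vfourier_power_series_mult(2)[OF h' E_meas(2) integrable_haar_continuous[OF p_cont] _ that])
       (simp_all add: p_coeff)
  \<comment> \<open>a constant unit vector, which turns the scalar \<open>E\<close> into a vector-valued function\<close>
  define C where "C = (\<lambda>_ :: complex. coord 0)"
  have C_cont: "continuous_on (sphere 0 1) C"
    unfolding C_def by (rule continuous_on_const)
  have "vfourier (\<lambda>z. E z *\<^sub>C C z) (int n) = h n *\<^sub>C coord 0" for n
  proof -
    have "vfourier (\<lambda>z. E z *\<^sub>C C z) (int n) = (\<Sum>i\<le>n. h i *\<^sub>C vfourier C (int (n - i)))"
      by (rule vfourier_power_series_mult(1)[OF h E_meas(1) integrable_haar_continuous[OF C_cont]])
         (simp_all add: C_def vfourier_const)
    also have "\<dots> = (\<Sum>i\<le>n. if i = n then h n *\<^sub>C coord 0 else 0)"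
      by (intro sum.cong refl) (auto simp: C_def vfourier_const)
    finally show ?thesis by simp
  qed
  then have h_coeff: "norm (vfourier (\<lambda>z. E z *\<^sub>C C z) (int n)) = cmod (h n)" for n
    by (simp add: norm_scaleC)
  have EC_cont: "continuous_on (sphere 0 1) (\<lambda>z. E z *\<^sub>C C z)"
    by (intro scaleC.continuous_on E_cont C_cont)
  have bessel: "(\<Sum>n<N. (norm (vfourier F (int n)))\<^sup>2) \<le> (\<integral>z. (norm (F z))\<^sup>2 \<partial>haar_circle)"
    if "continuous_on (sphere 0 1) F" for F
  proof -
    have "(\<Sum>k\<in>int ` {..<N}. (norm (vfourier F k))\<^sup>2) \<le> (\<integral>z. (norm (F z))\<^sup>2 \<partial>haar_circle)"
      by (intro bessel_vfourier borel_measurable_haar_circle integrable_haar_continuous continuous_intros that) simp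
    then show ?thesis by (simp add: sum.reindex)
  qed
  show thesis
  proof (rule that[of h "\<lambda>k. vfourier G (int k)"])
    fix n assume "n < N"
    then have "a n = vfourier (\<lambda>z. E z *\<^sub>C G z) (int n)"
      unfolding EG by (simp add: p_coeff)
    also have "\<dots> = (\<Sum>i\<le>n. h i *\<^sub>C vfourier G (int (n - i)))"
      by (rule vfourier_power_series_mult(1)[OF h E_meas(1) integrable_haar_continuous[OF G_cont] G_neg])
    finally show "a n = (\<Sum>i\<le>n. h i *\<^sub>C vfourier G (int (n - i)))" .
  next
    have "(\<Sum>i<N. (cmod (h i))\<^sup>2) \<le> (\<integral>z. (norm (E z *\<^sub>C C z))\<^sup>2 \<partial>haar_circle)"
      using bessel[OF EC_cont] by (simp add: h_coeff)
    also have "\<dots> \<le> (\<integral>z. exp \<delta> * (norm (p z) + \<delta>) \<partial>haar_circle)"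
    proof (rule integral_mono)
      fix z assume "z \<in> space haar_circle"
      then show "(norm (E z *\<^sub>C C z))\<^sup>2 \<le> exp \<delta> * (norm (p z) + \<delta>)"
        using up[of z] by (simp add: norm_scaleC C_def normE)
    qed (intro integrable_haar_continuous continuous_intros EC_cont p_cont)+
    also have "\<dots> = exp \<delta> * ((\<integral>z. norm (p z) \<partial>haar_circle) + \<delta>)"
      using integrable_haar_continuous[OF p_cont] haar.prob_space by simp
    finally show "(\<Sum>i<N. (cmod (h i))\<^sup>2) \<le> exp \<delta> * ((\<integral>z. norm (p z) \<partial>haar_circle) + \<delta>)" .
  next
    have "(\<Sum>k<N. (norm (vfourier G (int k)))\<^sup>2) \<le> (\<integral>z. (norm (G z))\<^sup>2 \<partial>haar_circle)"
      by (rule bessel[OF G_cont])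
    also have "\<dots> \<le> (\<integral>z. exp \<delta> * norm (p z) \<partial>haar_circle)"
    proof (rule integral_mono)
      fix z assume "z \<in> space haar_circle"
      then have z: "z \<in> sphere 0 1" by simp
      have "(norm (G z))\<^sup>2 \<le> exp \<delta> / (norm (p z) + \<delta>) * (norm (p z))\<^sup>2"
        using mult_right_mono[OF lo[OF z], of "(norm (p z))\<^sup>2"]
        by (simp add: G_def norm_scaleC power_mult_distrib normE)
      also have "\<dots> = exp \<delta> * norm (p z) * (norm (p z) / (norm (p z) + \<delta>))"
        by (simp add: power2_eq_square)
      also have "\<dots> \<le> exp \<delta> * norm (p z) * 1"
        using pos[of z] \<open>0 < \<delta>\<close> by (intro mult_left_mono) auto
      finally show "(norm (G z))\<^sup>2 \<le> exp \<delta> * norm (p z)" by simp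
    qed (intro integrable_haar_continuous continuous_intros G_cont p_cont)+
    also have "\<dots> = exp \<delta> * (\<integral>z. norm (p z) \<partial>haar_circle)"
      by simp
    finally show "(\<Sum>k<N. (norm (vfourier G (int k)))\<^sup>2) \<le> exp \<delta> * (\<integral>z. norm (p z) \<partial>haar_circle)" .
  qed
qed

section \<open>The weighted Toeplitz matrix of a multiplier\<close>

lemma vfourier_monomial_mult:
  assumes "integrable haar_circle \<psi>"
  shows "vfourier (\<lambda>z. \<psi> z *\<^sub>C (z powi m *\<^sub>C a)) k = fourier \<psi> (k - m) *\<^sub>C a"
proof -
  have int: "integrable haar_circle (\<lambda>z. z powi n * \<psi> z)" for n
    by (rule Bochner_Integration.integrable_bound[OF assms])
       (use assms in \<open>auto simp: norm_mult norm_power_int\<close>)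
  have "vfourier (\<lambda>z. \<psi> z *\<^sub>C (z powi m *\<^sub>C a)) k = (\<integral>z. (z powi (- (k - m)) * \<psi> z) *\<^sub>C a \<partial>haar_circle)"
    unfolding vfourier_def
  proof (intro Bochner_Integration.integral_cong refl)
    fix z assume "z \<in> space haar_circle"
    then have "z powi (- (k - m)) = z powi (- k) * z powi m"
      using power_int_circle(2)[of z "- k" m] by simp
    then show "z powi (- k) *\<^sub>C \<psi> z *\<^sub>C z powi m *\<^sub>C a = (z powi (- (k - m)) * \<psi> z) *\<^sub>C a"
      by (simp only: scaleC_scaleC mult_ac)
  qed
  also have "\<dots> = fourier \<psi> (k - m) *\<^sub>C a"
    unfolding fourier_def by (rule integral_bounded_linear[OF scaleC.bounded_linear_left int])
  finally show ?thesis .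
qed

text \<open>The inner sums are the Fourier coefficients of \<open>\<psi> p\<close>, where \<open>p\<close> is the trigonometric polynomial with
  the coefficients \<open>c\<close>.\<close>

lemma bessel_bounded_mult_trig_poly:
  assumes [measurable]: "\<psi> \<in> borel_measurable haar_circle" and K: "AE z in haar_circle. cmod (\<psi> z) \<le> K"
    and "finite I" "finite J"
  shows "(\<Sum>k\<in>J. (cmod (\<Sum>m\<in>I. fourier \<psi> (k - m) * c m))\<^sup>2) \<le> K\<^sup>2 * (\<Sum>m\<in>I. (cmod (c m))\<^sup>2)"
proof -
  define P where "P = trig_poly I (\<lambda>m. c m *\<^sub>C coord 0)"
  define F where "F = (\<lambda>z. \<psi> z *\<^sub>C P z)"
  have P_cont: "continuous_on (sphere 0 1) P"
    unfolding P_def by (rule continuous_on_trig_poly)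
  have [measurable]: "P \<in> borel_measurable haar_circle"
    by (rule borel_measurable_haar_circle[OF P_cont])
  have [measurable]: "F \<in> borel_measurable haar_circle"
    unfolding F_def by measurable
  have \<psi>_int: "integrable haar_circle \<psi>"
    using K by (intro haar.integrable_const_bound[of _ K]) auto
  have P2: "integrable haar_circle (\<lambda>z. K\<^sup>2 * (norm (P z))\<^sup>2)"
    by (intro integrable_haar_continuous continuous_intros P_cont)
  have FP: "AE z in haar_circle. (norm (F z))\<^sup>2 \<le> K\<^sup>2 * (norm (P z))\<^sup>2"
    using K
  proof eventually_elim
    case (elim z)
    then have "(cmod (\<psi> z))\<^sup>2 \<le> K\<^sup>2"
      by (intro power_mono) auto
    then show ?case
      unfolding F_def norm_scaleC power_mult_distrib by (intro mult_right_mono) auto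
  qed
  have F2: "integrable haar_circle (\<lambda>z. (norm (F z))\<^sup>2)"
    by (rule Bochner_Integration.integrable_bound[OF P2]) (use FP in auto)
  have coeff: "vfourier F k = (\<Sum>m\<in>I. fourier \<psi> (k - m) * c m) *\<^sub>C coord 0" for k
  proof -
    have "F = (\<lambda>z. \<Sum>m\<in>I. \<psi> z *\<^sub>C (z powi m *\<^sub>C c m *\<^sub>C coord 0))"
      by (simp add: F_def P_def trig_poly_def scaleC.sum_right)
    moreover have "integrable haar_circle (\<lambda>z. \<psi> z *\<^sub>C (z powi m *\<^sub>C c m *\<^sub>C coord 0))" for m
      by (rule Bochner_Integration.integrable_bound[OF integrable_mult_right[OF \<psi>_int, of "c m"]])
         (auto simp: norm_scaleC norm_mult norm_power_int)
    ultimately have "vfourier F k = (\<Sum>m\<in>I. fourier \<psi> (k - m) *\<^sub>C c m *\<^sub>C coord 0)"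
      by (simp only: vfourier_sum vfourier_monomial_mult[OF \<psi>_int])
    then show ?thesis
      by (simp only: scaleC_scaleC scaleC.sum_left)
  qed
  have "(\<Sum>k\<in>J. (cmod (\<Sum>m\<in>I. fourier \<psi> (k - m) * c m))\<^sup>2) = (\<Sum>k\<in>J. (norm (vfourier F k))\<^sup>2)"
    by (simp add: coeff norm_scaleC)
  also have "\<dots> \<le> (\<integral>z. (norm (F z))\<^sup>2 \<partial>haar_circle)"
    using F2 \<open>finite J\<close> by (intro bessel_vfourier) auto
  also have "\<dots> \<le> (\<integral>z. K\<^sup>2 * (norm (P z))\<^sup>2 \<partial>haar_circle)"
    by (rule integral_mono_AE[OF F2 P2 FP])
  also have "\<dots> = K\<^sup>2 * (\<Sum>m\<in>I. (cmod (c m))\<^sup>2)"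
    using \<open>finite I\<close> by (simp add: P_def parseval_trig_poly norm_scaleC)
  finally show ?thesis .
qed

text \<open>On the diagonal \<open>l - k = d\<close> the substitution \<open>n = k + i\<close> turns the entries into coefficients of \<open>\<psi>\<close>
  times the trigonometric polynomial with the coefficients \<open>h\<^sub>i cnj h\<^sub>i\<^sub>-\<^sub>d\<close> at \<open>-i\<close>.  The range \<open>n < 2 N\<close>
  contains every sum \<open>k + i\<close> with \<open>k, i < N\<close>: a shorter range would truncate \<open>\<psi>\<close>, which does not
  preserve its bound.\<close>

lemma toeplitz_product_bound:
  fixes h :: "int \<Rightarrow> complex"
  assumes \<psi>: "\<psi> \<in> borel_measurable haar_circle" "AE z in haar_circle. cmod (\<psi> z) \<le> K"
    and h: "\<And>i. i < 0 \<or> int N \<le> i \<Longrightarrow> h i = 0"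
  shows "(\<Sum>k<N. \<Sum>l<N. (cmod (\<Sum>n<2 * N. fourier \<psi> (int n) * (h (int n - int k) * cnj (h (int n - int l)))))\<^sup>2)
    \<le> K\<^sup>2 * ((\<Sum>i<N. (cmod (h (int i)))\<^sup>2))\<^sup>2"
proof -
  define S where "S = (\<Sum>i\<in>{0..<int N}. (cmod (h i))\<^sup>2)"
  define I where "I = {- int N<..0}"
  define D where "D = {- int N..int N}"
  define c where "c = (\<lambda>d m. h (- m) * cnj (h (- m - d)))"
  define G where "G = (\<lambda>d k. (cmod (\<Sum>m\<in>I. fourier \<psi> (k - m) * c d m))\<^sup>2)"
  have entry: "(cmod (\<Sum>n<2 * N. fourier \<psi> (int n) * (h (int n - int k) * cnj (h (int n - int l)))))\<^sup>2
      = G (int l - int k) (int k)" if k: "k < N" for k l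
  proof -
    have "(\<Sum>n<2 * N. fourier \<psi> (int n) * (h (int n - int k) * cnj (h (int n - int l))))
        = (\<Sum>n\<in>{k..<k + N}. fourier \<psi> (int n) * (h (int n - int k) * cnj (h (int n - int l))))"
      using k by (intro sum.mono_neutral_right) (auto simp: h)
    also have "\<dots> = (\<Sum>m\<in>I. fourier \<psi> (int k - m) * c (int l - int k) m)"
      by (rule sum.reindex_bij_witness[of _ "\<lambda>m. nat (int k - m)" "\<lambda>n. int k - int n"])
         (auto simp: I_def c_def)
    finally show ?thesis by (simp add: G_def)
  qed
  have S_le: "(\<Sum>d\<in>D. (cmod (h (i - d)))\<^sup>2) \<le> S" for i
  proof -
    have "(\<Sum>d\<in>D. (cmod (h (i - d)))\<^sup>2) = (\<Sum>j\<in>(\<lambda>d. i - d) ` D. (cmod (h j))\<^sup>2)"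
      by (simp add: sum.reindex inj_on_def)
    also have "\<dots> = (\<Sum>j\<in>(\<lambda>d. i - d) ` D \<inter> {0..<int N}. (cmod (h j))\<^sup>2)"
      using h by (intro sum.mono_neutral_right) (force simp: D_def not_le not_less)+
    also have "\<dots> \<le> S"
      unfolding S_def by (intro sum_mono2) auto
    finally show ?thesis .
  qed
  have "(\<Sum>k<N. \<Sum>l<N. (cmod (\<Sum>n<2 * N. fourier \<psi> (int n) * (h (int n - int k) * cnj (h (int n - int l)))))\<^sup>2)
      = (\<Sum>k<N. \<Sum>l<N. G (int l - int k) (int k))"
    by (simp add: entry)
  also have "\<dots> \<le> (\<Sum>k<N. \<Sum>d\<in>D. G d (int k))"
  proof (rule sum_mono)
    fix k assume "k \<in> {..<N}"
    then have "(\<lambda>l. int l - int k) ` {..<N} \<subseteq> D"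
      by (auto simp: D_def)
    then have "(\<Sum>d\<in>(\<lambda>l. int l - int k) ` {..<N}. G d (int k)) \<le> (\<Sum>d\<in>D. G d (int k))"
      by (intro sum_mono2) (auto simp: D_def G_def)
    then show "(\<Sum>l<N. G (int l - int k) (int k)) \<le> (\<Sum>d\<in>D. G d (int k))"
      by (simp add: sum.reindex inj_on_def)
  qed
  also have "\<dots> = (\<Sum>d\<in>D. \<Sum>k\<in>int ` {..<N}. G d k)"
    by (subst sum.swap) (simp add: sum.reindex)
  also have "\<dots> \<le> (\<Sum>d\<in>D. K\<^sup>2 * (\<Sum>m\<in>I. (cmod (c d m))\<^sup>2))"
    unfolding G_def by (intro sum_mono bessel_bounded_mult_trig_poly \<psi>) (auto simp: I_def)
  also have "\<dots> = K\<^sup>2 * (\<Sum>m\<in>I. \<Sum>d\<in>D. (cmod (c d m))\<^sup>2)"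
    by (simp only: sum_distrib_left[symmetric] sum.swap[of _ D])
  also have "\<dots> = K\<^sup>2 * (\<Sum>m\<in>I. (cmod (h (- m)))\<^sup>2 * (\<Sum>d\<in>D. (cmod (h (- m - d)))\<^sup>2))"
    by (simp add: c_def norm_mult power_mult_distrib sum_distrib_left)
  also have "\<dots> \<le> K\<^sup>2 * (\<Sum>m\<in>I. (cmod (h (- m)))\<^sup>2 * S)"
    by (intro mult_left_mono sum_mono S_le) auto
  also have "(\<Sum>m\<in>I. (cmod (h (- m)))\<^sup>2 * S) = S * S"
    unfolding sum_distrib_right[symmetric] S_def
    by (intro arg_cong2[where f = "(*)"] refl sum.reindex_bij_witness[of _ uminus uminus]) (auto simp: I_def)
  also have "S = (\<Sum>i<N. (cmod (h (int i)))\<^sup>2)"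
    unfolding S_def by (rule sum.reindex_bij_witness[of _ int nat]) auto
  finally show ?thesis by (simp add: power2_eq_square)
qed

text \<open>\<open>X\<^sup>* X\<close> and \<open>X X\<^sup>*\<close> have the same Hilbert-Schmidt norm.\<close>

lemma frobenius_gram:
  fixes X :: "'k \<Rightarrow> 'n \<Rightarrow> complex"
  shows "(\<Sum>n\<in>B. \<Sum>m\<in>B. (cmod (\<Sum>k\<in>A. cnj (X k n) * X k m))\<^sup>2)
    = (\<Sum>k\<in>A. \<Sum>l\<in>A. (cmod (\<Sum>n\<in>B. X k n * cnj (X l n)))\<^sup>2)"
proof -
  define T where "T = (\<lambda>n m k l. cnj (X k n) * X k m * (X l n * cnj (X l m)))"
  have L: "complex_of_real ((cmod (\<Sum>k\<in>A. cnj (X k n) * X k m))\<^sup>2) = (\<Sum>k\<in>A. \<Sum>l\<in>A. T n m k l)" for n m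
    unfolding complex_norm_square cnj_sum sum_product T_def by simp
  have R: "complex_of_real ((cmod (\<Sum>n\<in>B. X k n * cnj (X l n)))\<^sup>2) = (\<Sum>m\<in>B. \<Sum>n\<in>B. T n m k l)" for k l
    unfolding complex_norm_square cnj_sum sum_product T_def
    by (intro sum.cong refl) (simp add: mult_ac)
  have "complex_of_real (\<Sum>n\<in>B. \<Sum>m\<in>B. (cmod (\<Sum>k\<in>A. cnj (X k n) * X k m))\<^sup>2)
      = (\<Sum>n\<in>B. \<Sum>m\<in>B. \<Sum>k\<in>A. \<Sum>l\<in>A. T n m k l)"
    unfolding of_real_sum L ..
  also have "\<dots> = (\<Sum>m\<in>B. \<Sum>k\<in>A. \<Sum>l\<in>A. \<Sum>n\<in>B. T n m k l)"
    by (subst sum.swap, intro sum.cong refl, subst sum.swap, intro sum.cong refl, rule sum.swap)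
  also have "\<dots> = (\<Sum>k\<in>A. \<Sum>l\<in>A. \<Sum>m\<in>B. \<Sum>n\<in>B. T n m k l)"
    by (subst sum.swap, intro sum.cong refl, rule sum.swap)
  also have "\<dots> = complex_of_real (\<Sum>k\<in>A. \<Sum>l\<in>A. (cmod (\<Sum>n\<in>B. X k n * cnj (X l n)))\<^sup>2)"
    unfolding of_real_sum R ..
  finally show ?thesis unfolding of_real_eq_iff .
qed

section \<open>The estimate for polynomials\<close>

lemma Linf_integrable:
  assumes "\<psi> \<in> Linf"
  shows "integrable haar_circle \<psi>"
proof -
  have fin: "Linf_norm \<psi> < \<infinity>" and [measurable]: "\<psi> \<in> borel_measurable haar_circle"
    using assms by (auto simp: Linf_def)
  have "AE z in haar_circle. ennreal (cmod (\<psi> z)) \<le> Linf_norm \<psi>"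
    unfolding Linf_norm_def by (rule esssup_AE)
  then have "AE z in haar_circle. cmod (\<psi> z) \<le> enn2real (Linf_norm \<psi>)"
  proof eventually_elim
    case (elim z)
    with fin show ?case
      by (metis enn2real_ennreal enn2real_mono norm_ge_zero infinity_ennreal_def)
  qed
  then show ?thesis
    by (intro haar.integrable_const_bound) auto
qed

lemma BMOA2_norm_nonneg: "0 \<le> BMOA2_norm \<phi>"
  by (simp add: BMOA2_norm_def)

text \<open>Subtracting an element of \<open>conj_H0_inf\<close> leaves the coefficients with \<open>n \<ge> 0\<close> unchanged, so the
  infimum in the quotient norm runs over bounded functions with these coefficients.\<close>

lemma BMOA2_symbol:
  assumes "\<phi> \<in> BMOA2" and K: "(BMOA2_norm \<phi>)\<^sup>2 < K"
  obtains \<psi> where "\<psi> \<in> borel_measurable haar_circle" "AE z in haar_circle. cmod (\<psi> z) \<le> K"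
    "\<And>n. fourier \<psi> (int n) = of_real ((cmod (\<phi> n))\<^sup>2)"
proof -
  let ?a = "\<lambda>n. complex_of_real ((cmod (\<phi> n))\<^sup>2)"
  have "BMOA_norm ?a < \<infinity>"
    using assms(1) by (simp add: BMOA2_def)
  then have "BMOA_norm ?a = ennreal ((BMOA2_norm \<phi>)\<^sup>2)"
    by (simp add: BMOA2_norm_def less_top)
  then have "BMOA_norm ?a < ennreal K"
    using K by (simp add: ennreal_less_iff)
  then obtain \<psi> h where \<psi>: "\<psi> \<in> Linf" "\<And>n. fourier \<psi> (int n) = ?a n"
    and h: "h \<in> conj_H0_inf" and le: "Linf_norm (\<lambda>z. \<psi> z - h z) < ennreal K"
    unfolding BMOA_norm_def INF_less_iff by blast
  have hL: "h \<in> Linf" and h0: "\<And>n. fourier h (int n) = 0"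
    using h by (auto simp: conj_H0_inf_def)
  have [measurable]: "\<psi> \<in> borel_measurable haar_circle" "h \<in> borel_measurable haar_circle"
    using \<psi>(1) hL by (auto simp: Linf_def)
  have int: "integrable haar_circle (\<lambda>z. z powi (- n) * u z)" if "u \<in> Linf" for u n
    by (rule Bochner_Integration.integrable_bound[OF Linf_integrable[OF that]])
       (use Linf_integrable[OF that] in \<open>auto simp: norm_mult norm_power_int\<close>)
  show thesis
  proof (rule that[of "\<lambda>z. \<psi> z - h z"])
    have "AE z in haar_circle. ennreal (cmod (\<psi> z - h z)) \<le> Linf_norm (\<lambda>z. \<psi> z - h z)"
      unfolding Linf_norm_def by (rule esssup_AE)
    then show "AE z in haar_circle. cmod (\<psi> z - h z) \<le> K"
    proof eventually_elim
      case (elim z)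
      then have "ennreal (cmod (\<psi> z - h z)) < ennreal K"
        using le by (rule le_less_trans)
      then show ?case
        by (simp add: ennreal_less_iff)
    qed
    fix n
    have "fourier (\<lambda>z. \<psi> z - h z) (int n) = fourier \<psi> (int n) - fourier h (int n)"
      unfolding fourier_def using int[OF \<psi>(1)] int[OF hL] by (simp add: right_diff_distrib)
    then show "fourier (\<lambda>z. \<psi> z - h z) (int n) = ?a n"
      by (simp add: \<psi>(2) h0)
  qed measurable
qed

text \<open>For each \<open>\<delta> > 0\<close> a nearly optimal symbol of \<open>|\<phi>|\<^sup>2\<close> and a nearly optimal factorisation of the
  polynomial give the bound up to \<open>\<delta>\<close>.  The vectors \<open>w\<close> do not depend on \<open>\<delta>\<close>, so it may tend to \<open>0\<close>.\<close>

lemma schatten_bound_finite_stage: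
  fixes a :: "nat \<Rightarrow> ell2"
  assumes \<phi>: "\<phi> \<in> BMOA2" and F: "(\<integral>z. norm (fourier_sum a N z) \<partial>haar_circle) \<le> F"
    and w: "\<And>i. i < N \<Longrightarrow> w i \<in> finite_vecs N" "\<And>i. i < N \<Longrightarrow> norm (w i) = 1"
    and orth: "orthogonal_family w {..<N}" "orthogonal_family (\<lambda>i. synth N (\<lambda>n. \<phi> n *\<^sub>C a n) (w i)) {..<N}"
  shows "(\<Sum>i<N. norm (synth N (\<lambda>n. \<phi> n *\<^sub>C a n) (w i)) powr (4/3)) \<le> (BMOA2_norm \<phi> * F) powr (4/3)"
proof -
  define \<Sigma> where "\<Sigma> = (\<Sum>i<N. norm (synth N (\<lambda>n. \<phi> n *\<^sub>C a n) (w i)) powr (4/3))"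
  define \<beta> where "\<beta> = BMOA2_norm \<phi>"
  have F0: "0 \<le> F"
    using F by (rule order_trans[rotated]) simp
  have \<beta>0: "0 \<le> \<beta>"
    unfolding \<beta>_def by (rule BMOA2_norm_nonneg)
  have key: "\<Sigma> \<le> ((\<beta>\<^sup>2 + \<delta>)\<^sup>2 * (exp \<delta> * (F + \<delta>))\<^sup>2) powr (1/3) * (exp \<delta> * F) powr (2/3)" if \<delta>: "0 < \<delta>" for \<delta>
  proof -
    obtain \<psi> where \<psi>: "\<psi> \<in> borel_measurable haar_circle" "AE z in haar_circle. cmod (\<psi> z) \<le> \<beta>\<^sup>2 + \<delta>"
      "\<And>n. fourier \<psi> (int n) = of_real ((cmod (\<phi> n))\<^sup>2)"
      using BMOA2_symbol[OF \<phi>, of "\<beta>\<^sup>2 + \<delta>"] \<delta> by (auto simp: \<beta>_def)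
    obtain h0 g where a: "\<And>n. n < N \<Longrightarrow> a n = (\<Sum>i\<le>n. h0 i *\<^sub>C g (n - i))"
      and h0: "(\<Sum>i<N. (cmod (h0 i))\<^sup>2) \<le> exp \<delta> * ((\<integral>z. norm (fourier_sum a N z) \<partial>haar_circle) + \<delta>)"
      and g: "(\<Sum>k<N. (norm (g k))\<^sup>2) \<le> exp \<delta> * (\<integral>z. norm (fourier_sum a N z) \<partial>haar_circle)"
      using approximate_outer_factorisation[OF refl \<delta>] by blast
    define h where "h = (\<lambda>i. if 0 \<le> i \<and> i < int N then h0 (nat i) else 0)"
    \<comment> \<open>the matrix \<open>H\<close> of the factorisation \<open>W = G H\<close>; the sequence below lists its columns\<close>
    define X where "X = (\<lambda>k n. \<phi> n * h (int n - int k))"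
    define H where "H = (\<lambda>n. \<Sum>k<N. X k n *\<^sub>C coord k)"
    have H: "\<langle>H n, H m\<rangle> = (\<Sum>k<N. cnj (X k n) * X k m)" for n m
      unfolding H_def cinner.sum_left cinner_scaleC_left cinner_coord_left
      by (simp add: ell2_nth_coord_combination)
    have v: "\<phi> n *\<^sub>C a n = synth N g (H n)" if n: "n < N" for n
    proof -
      have "synth N g (H n) = (\<Sum>k<N. X k n *\<^sub>C g k)"
        unfolding synth_def H_def by (simp add: ell2_nth_coord_combination)
      also have "\<dots> = (\<Sum>k\<le>n. X k n *\<^sub>C g k)"
        using n by (intro sum.mono_neutral_right) (auto simp: X_def h_def)
      also have "\<dots> = (\<Sum>i\<le>n. X (n - i) n *\<^sub>C g (n - i))"
        by (rule sum.reindex_bij_witness[of _ "\<lambda>i. n - i" "\<lambda>i. n - i"]) auto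
      also have "\<dots> = (\<Sum>i\<le>n. \<phi> n *\<^sub>C h0 i *\<^sub>C g (n - i))"
        using n by (intro sum.cong refl) (simp add: X_def h_def of_nat_diff scaleC_scaleC)
      also have "\<dots> = \<phi> n *\<^sub>C a n"
        by (simp only: a[OF n] scaleC.sum_right)
      finally show ?thesis ..
    qed
    \<comment> \<open>more columns only enlarge the norm; the bound on the Toeplitz product needs the range \<open>n < 2 N\<close>\<close>
    have "(\<Sum>n<N. \<Sum>m<N. (cmod \<langle>H n, H m\<rangle>)\<^sup>2) \<le> (\<Sum>n<2 * N. \<Sum>m<2 * N. (cmod \<langle>H n, H m\<rangle>)\<^sup>2)"
      by (intro order_trans[OF sum_mono[OF sum_mono2] sum_mono2] sum_nonneg) auto
    also have "\<dots> = (\<Sum>k<N. \<Sum>l<N. (cmod (\<Sum>n<2 * N. X k n * cnj (X l n)))\<^sup>2)"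
      unfolding H by (rule frobenius_gram)
    also have "\<dots> = (\<Sum>k<N. \<Sum>l<N. (cmod (\<Sum>n<2 * N. fourier \<psi> (int n) * (h (int n - int k) * cnj (h (int n - int l)))))\<^sup>2)"
      unfolding X_def \<psi>(3) complex_norm_square by (simp add: mult_ac)
    also have "\<dots> \<le> (\<beta>\<^sup>2 + \<delta>)\<^sup>2 * (\<Sum>i<N. (cmod (h (int i)))\<^sup>2)\<^sup>2"
      by (rule toeplitz_product_bound[OF \<psi>(1,2)]) (auto simp: h_def)
    also have "(\<Sum>i<N. (cmod (h (int i)))\<^sup>2) = (\<Sum>i<N. (cmod (h0 i))\<^sup>2)"
      by (simp add: h_def)
    also have "(\<beta>\<^sup>2 + \<delta>)\<^sup>2 * (\<Sum>i<N. (cmod (h0 i))\<^sup>2)\<^sup>2 \<le> (\<beta>\<^sup>2 + \<delta>)\<^sup>2 * (exp \<delta> * (F + \<delta>))\<^sup>2"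
    proof (intro mult_left_mono power_mono)
      show "(\<Sum>i<N. (cmod (h0 i))\<^sup>2) \<le> exp \<delta> * (F + \<delta>)"
        using h0 F by (smt (verit) exp_gt_zero mult_left_mono)
    qed (auto intro: sum_nonneg)
    finally have gram: "(\<Sum>n<N. \<Sum>m<N. (cmod \<langle>H n, H m\<rangle>)\<^sup>2) \<le> (\<beta>\<^sup>2 + \<delta>)\<^sup>2 * (exp \<delta> * (F + \<delta>))\<^sup>2" .
    have gF: "(\<Sum>k<N. (norm (g k))\<^sup>2) \<le> exp \<delta> * F"
      using g F by (smt (verit) exp_gt_zero mult_left_mono)
    have "\<Sigma> \<le> (\<Sum>n<N. \<Sum>m<N. (cmod \<langle>H n, H m\<rangle>)\<^sup>2) powr (1/3) * (\<Sum>k<N. (norm (g k))\<^sup>2) powr (2/3)"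
      unfolding \<Sigma>_def by (rule schatten_norm_product_le[OF w orth v])
    also have "\<dots> \<le> ((\<beta>\<^sup>2 + \<delta>)\<^sup>2 * (exp \<delta> * (F + \<delta>))\<^sup>2) powr (1/3) * (exp \<delta> * F) powr (2/3)"
      using gram gF by (intro mult_mono powr_mono2) (auto intro!: sum_nonneg)
    finally show ?thesis .
  qed
  have "\<Sigma> \<le> ((\<beta>\<^sup>2 + 0)\<^sup>2 * (exp 0 * (F + 0))\<^sup>2) powr (1/3) * (exp 0 * F) powr (2/3)"
  proof (rule tendsto_lowerbound)
    show "((\<lambda>\<delta>. ((\<beta>\<^sup>2 + \<delta>)\<^sup>2 * (exp \<delta> * (F + \<delta>))\<^sup>2) powr (1/3) * (exp \<delta> * F) powr (2/3))
        \<longlongrightarrow> ((\<beta>\<^sup>2 + 0)\<^sup>2 * (exp 0 * (F + 0))\<^sup>2) powr (1/3) * (exp 0 * F) powr (2/3)) (at_right 0)"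
      by (intro tendsto_mult tendsto_powr2 tendsto_power tendsto_add tendsto_exp tendsto_const tendsto_ident_at always_eventually)
         (use F0 in auto)
    show "\<forall>\<^sub>F \<delta> in at_right 0. \<Sigma> \<le> ((\<beta>\<^sup>2 + \<delta>)\<^sup>2 * (exp \<delta> * (F + \<delta>))\<^sup>2) powr (1/3) * (exp \<delta> * F) powr (2/3)"
      using key eventually_at_right_less[of "0::real"] by (auto elim: eventually_mono)
  qed simp
  also have "\<dots> = (\<beta> * F) powr (4/3)"
  proof (cases "\<beta> = 0 \<or> F = 0")
    case False
    then have pos: "0 < \<beta>" "0 < F" using \<beta>0 F0 by auto
    have "((\<beta>\<^sup>2)\<^sup>2 * F\<^sup>2) powr (1/3) * F powr (2/3) = \<beta> powr (4/3) * (F powr (2/3) * F powr (2/3))"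
      using pos by (simp add: powr_mult powr_powr flip: powr_numeral)
    also have "F powr (2/3) * F powr (2/3) = F powr (4/3)"
      by (simp flip: powr_add)
    finally show ?thesis using pos by (simp add: powr_mult)
  qed auto
  finally show ?thesis by (simp add: \<Sigma>_def \<beta>_def)
qed

section \<open>Passage to the limit\<close>

lemma fejer_factor_tendsto: "(\<lambda>N. real (Suc N - n) / real (Suc N)) \<longlonglongrightarrow> 1"
proof (rule Lim_transform_eventually)
  have "(\<lambda>N. real n / real (Suc N)) \<longlonglongrightarrow> 0"
    using LIMSEQ_Suc[OF lim_const_over_n[of "real n"]] by simp
  from tendsto_diff[OF tendsto_const[of 1] this]
  show "(\<lambda>N. 1 - real n / real (Suc N)) \<longlonglongrightarrow> 1"
    by simp
  show "\<forall>\<^sub>F N in sequentially. 1 - real n / real (Suc N) = real (Suc N - n) / real (Suc N)"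
    using eventually_ge_at_top[of n]
  proof eventually_elim
    case (elim N)
    then have "real (Suc N - n) = real (Suc N) - real n"
      by (intro of_nat_diff) simp
    then show ?case
      by (simp only: diff_divide_distrib) simp
  qed
qed

theorem corollary6p9:
  fixes \<phi> :: "nat \<Rightarrow> complex" and f :: "complex \<Rightarrow> ell2"
  assumes "\<phi> \<in> BMOA2" and "f \<in> H1_ell2"
  shows "\<exists>g. represents_conv g f \<phi> \<and>
           op_sqrt (integral_rank_one g) \<in> schatten_class (4/3) \<and>
           schatten_norm (4/3) (op_sqrt (integral_rank_one g)) \<le> BMOA2_norm \<phi> * H1_norm f"
proof -
  define C where "C = BMOA2_norm \<phi> * H1_norm f"
  define b where "b = (\<lambda>n. \<phi> n *\<^sub>C vfourier f (int n))"
  \<comment> \<open>stage \<open>N\<close> uses the Fejer mean of order \<open>Suc N\<close>, which avoids the degenerate order \<open>0\<close>\<close>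
  define c where "c = (\<lambda>N n. real (Suc N - n) / real (Suc N))"
  define v where "v = (\<lambda>N n. \<phi> n *\<^sub>C (of_real (c N n) *\<^sub>C vfourier f (int n)))"
  have C0: "0 \<le> C"
    by (simp add: C_def BMOA2_norm_nonneg H1_norm_def)
  have v: "v N n = of_real (c N n) *\<^sub>C b n" for N n
    by (simp add: v_def b_def scaleC_scaleC mult.commute)
  have c: "0 \<le> c N n" "c N n \<le> 1" for N n
    by (auto simp: c_def)
  have c_lim: "(\<lambda>N. c N n) \<longlonglongrightarrow> 1" for n
    unfolding c_def by (rule fejer_factor_tendsto)
  have "\<exists>w. (\<forall>i<Suc N. w i \<in> finite_vecs (Suc N)) \<and> (\<forall>i<Suc N. norm (w i) = 1) \<and>
      orthogonal_family w {..<Suc N} \<and> orthogonal_family (\<lambda>i. synth (Suc N) (v N) (w i)) {..<Suc N} \<and>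
      (\<forall>i j. i \<le> j \<longrightarrow> j < Suc N \<longrightarrow> norm (synth (Suc N) (v N) (w j)) \<le> norm (synth (Suc N) (v N) (w i)))" for N
    by (rule exists_orthogonal_mixing[of "Suc N" "v N"]) blast
  then obtain w where w: "\<And>N i. i < Suc N \<Longrightarrow> w N i \<in> finite_vecs (Suc N)" "\<And>N i. i < Suc N \<Longrightarrow> norm (w N i) = 1"
    and orth: "\<And>N. orthogonal_family (w N) {..<Suc N}"
      "\<And>N. orthogonal_family (\<lambda>i. synth (Suc N) (v N) (w N i)) {..<Suc N}"
    and dec: "\<And>N i j. i \<le> j \<Longrightarrow> j < Suc N \<Longrightarrow>
      norm (synth (Suc N) (v N) (w N j)) \<le> norm (synth (Suc N) (v N) (w N i))"
    by metis
  define z where "z = (\<lambda>N i. synth (Suc N) (v N) (w N i))"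
  have stage: "(\<Sum>i<Suc N. norm (z N i) powr (4/3)) \<le> C powr (4/3)" for N
    unfolding z_def v_def C_def
  proof (rule schatten_bound_finite_stage)
    show "(\<integral>u. norm (fourier_sum (\<lambda>n. of_real (c N n) *\<^sub>C vfourier f (int n)) (Suc N) u) \<partial>haar_circle) \<le> H1_norm f"
      using fejer_mean_L1_le[OF assms(2), of "Suc N"] unfolding fejer_mean_def c_def by simp
  qed (use assms(1) w orth in \<open>auto simp: v_def\<close>)
  have z_le: "norm (z N i) \<le> C" if "i < Suc N" for N i
  proof -
    have "norm (z N i) powr (4/3) \<le> (\<Sum>i<Suc N. norm (z N i) powr (4/3))"
      by (rule member_le_sum) (use that in auto)
    then have "norm (z N i) powr (4/3) \<le> C powr (4/3)"
      using stage[of N] by linarith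
    then show ?thesis
      using C0 powr_less_mono2[of "4/3" C "norm (z N i)"] by (meson not_le zero_less_divide_iff zero_less_numeral)
  qed
  \<comment> \<open>the Hilbert-Schmidt norm is at most the Schatten \<open>4/3\<close> norm\<close>
  have sum_v: "(\<Sum>n<Suc N. (norm (v N n))\<^sup>2) \<le> C\<^sup>2" for N
  proof -
    have "(\<Sum>n<Suc N. (norm (v N n))\<^sup>2) = (\<Sum>i<Suc N. (norm (z N i))\<^sup>2)"
      unfolding z_def by (rule sum_norm_mixing[OF w orth(1)])
    also have "\<dots> \<le> (\<Sum>i<Suc N. norm (z N i) powr (4/3) * C powr (2/3))"
    proof (rule sum_mono)
      fix i assume "i \<in> {..<Suc N}"
      then have "norm (z N i) powr (2/3) \<le> C powr (2/3)"
        using z_le by (intro powr_mono2) auto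
      then have "norm (z N i) powr (4/3) * norm (z N i) powr (2/3) \<le> norm (z N i) powr (4/3) * C powr (2/3)"
        by (intro mult_left_mono) auto
      then show "(norm (z N i))\<^sup>2 \<le> norm (z N i) powr (4/3) * C powr (2/3)"
        by (cases "z N i = 0") (simp_all flip: powr_add)
    qed
    also have "\<dots> \<le> C powr (4/3) * C powr (2/3)"
      unfolding sum_distrib_right[symmetric] by (intro mult_right_mono stage) auto
    also have "\<dots> = C\<^sup>2"
      using C0 by (cases "C = 0") (simp_all flip: powr_add)
    finally show ?thesis .
  qed
  have b_sum: "summable (\<lambda>n. (norm (b n))\<^sup>2)"
  proof (rule summableI_nonneg_bounded)
    fix m
    show "(\<Sum>n<m. (norm (b n))\<^sup>2) \<le> C\<^sup>2"
    proof (rule LIMSEQ_le_const2)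
      have "(\<lambda>N. \<Sum>n<m. (c N n)\<^sup>2 * (norm (b n))\<^sup>2) \<longlonglongrightarrow> (\<Sum>n<m. 1\<^sup>2 * (norm (b n))\<^sup>2)"
        by (intro tendsto_intros c_lim)
      then show "(\<lambda>N. \<Sum>n<m. (c N n)\<^sup>2 * (norm (b n))\<^sup>2) \<longlonglongrightarrow> (\<Sum>n<m. (norm (b n))\<^sup>2)"
        by simp
      have "(\<Sum>n<m. (c N n)\<^sup>2 * (norm (b n))\<^sup>2) \<le> C\<^sup>2" if "m \<le> N" for N
      proof -
        have "(\<Sum>n<m. (c N n)\<^sup>2 * (norm (b n))\<^sup>2) = (\<Sum>n<m. (norm (v N n))\<^sup>2)"
          using c by (simp add: v norm_scaleC power_mult_distrib)
        also have "\<dots> \<le> (\<Sum>n<Suc N. (norm (v N n))\<^sup>2)"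
          using that by (intro sum_mono2) auto
        finally show ?thesis
          using sum_v[of N] by linarith
      qed
      then show "\<exists>N. \<forall>n\<ge>N. (\<Sum>k<m. (c n k)\<^sup>2 * (norm (b k))\<^sup>2) \<le> C\<^sup>2"
        by blast
    qed
  qed simp
  obtain g where g: "g \<in> H2_ell2" "\<And>n. vfourier g (int n) = b n"
    and A: "\<And>N x. norm (integral_rank_one g x - (\<Sum>n<N. \<langle>b n, x\<rangle> *\<^sub>C b n)) \<le> (\<Sum>n. (norm (b (n + N)))\<^sup>2) * norm x"
    using exists_H2_function[OF b_sum] by blast
  define S where "S = (\<lambda>N. diag_op {..<Suc N} (z N))"
  define r where "r = (\<lambda>N. \<Sum>n<Suc N. (1 - (c N n)\<^sup>2) * (norm (b n))\<^sup>2)"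
  \<comment> \<open>distance of the finite stage to the limit operator: the tail of the series and the effect \<open>r\<close> of the Fejer weights\<close>
  define e where "e = (\<lambda>N. (\<Sum>n. (norm (b (n + Suc N)))\<^sup>2) + r N)"
  have c2: "(c N n)\<^sup>2 \<le> 1" for N n
    using c by (simp add: power_le_one)
  have SS: "S N (S N x) = (\<Sum>n<Suc N. of_real ((c N n)\<^sup>2) *\<^sub>C \<langle>b n, x\<rangle> *\<^sub>C b n)" for N x
  proof -
    have "S N (S N x) = (\<Sum>i<Suc N. \<langle>z N i, x\<rangle> *\<^sub>C z N i)"
      unfolding S_def by (rule diag_op_square) (use orth(2) in \<open>auto simp: z_def\<close>)
    also have "\<dots> = (\<Sum>n<Suc N. \<langle>v N n, x\<rangle> *\<^sub>C v N n)"
      unfolding z_def by (rule sum_rank_one_mixing[OF w orth(1), symmetric])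
    finally show ?thesis
      by (simp add: v cinner_scaleC_left scaleC_scaleC power2_eq_square mult_ac)
  qed
  have near: "norm (S N (S N x) - integral_rank_one g x) \<le> e N * norm x" for N x
  proof -
    let ?B = "\<Sum>n<Suc N. \<langle>b n, x\<rangle> *\<^sub>C b n"
    have "S N (S N x) - ?B = (\<Sum>n<Suc N. of_real ((c N n)\<^sup>2 - 1) *\<^sub>C \<langle>b n, x\<rangle> *\<^sub>C b n)"
      unfolding SS sum_subtractf[symmetric]
      by (intro sum.cong refl) (simp only: of_real_diff of_real_1 scaleC.diff_left scaleC_one)
    also have "norm \<dots> \<le> (\<Sum>n<Suc N. (1 - (c N n)\<^sup>2) * (norm (b n))\<^sup>2 * norm x)"
    proof (rule sum_norm_le)
      fix n
      have "norm (of_real ((c N n)\<^sup>2 - 1) *\<^sub>C \<langle>b n, x\<rangle> *\<^sub>C b n) = (1 - (c N n)\<^sup>2) * (cmod \<langle>b n, x\<rangle> * norm (b n))"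
        using c2[of N n] by (simp only: norm_scaleC norm_of_real) simp
      also have "\<dots> \<le> (1 - (c N n)\<^sup>2) * (norm (b n) * norm x * norm (b n))"
        using c2[of N n] by (intro mult_left_mono mult_right_mono cmod_cinner_le) auto
      finally show "norm (of_real ((c N n)\<^sup>2 - 1) *\<^sub>C \<langle>b n, x\<rangle> *\<^sub>C b n) \<le> (1 - (c N n)\<^sup>2) * (norm (b n))\<^sup>2 * norm x"
        by (simp only: power2_eq_square mult_ac)
    qed
    also have "\<dots> = r N * norm x"
      by (simp only: r_def sum_distrib_right)
    finally have "norm (S N (S N x) - ?B) \<le> r N * norm x" .
    moreover have "norm (S N (S N x) - integral_rank_one g x)
        \<le> norm (S N (S N x) - ?B) + norm (integral_rank_one g x - ?B)"
      using norm_triangle_ineq4[of "S N (S N x) - ?B" "integral_rank_one g x - ?B"] by simp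
    ultimately show ?thesis
      using A[of x "Suc N"] by (simp add: e_def distrib_right)
  qed
  have "r \<longlonglongrightarrow> (\<Sum>n. 0 :: real)"
  proof -
    define t where "t = (\<lambda>n N. if n < Suc N then (1 - (c N n)\<^sup>2) * (norm (b n))\<^sup>2 else 0)"
    have lim: "t n \<longlonglongrightarrow> 0" for n
    proof (rule Lim_transform_eventually)
      have "(\<lambda>N. (1 - (c N n)\<^sup>2) * (norm (b n))\<^sup>2) \<longlonglongrightarrow> (1 - 1\<^sup>2) * (norm (b n))\<^sup>2"
        by (intro tendsto_intros c_lim)
      then show "(\<lambda>N. (1 - (c N n)\<^sup>2) * (norm (b n))\<^sup>2) \<longlonglongrightarrow> 0"
        by simp
      show "\<forall>\<^sub>F N in sequentially. (1 - (c N n)\<^sup>2) * (norm (b n))\<^sup>2 = t n N"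
        using eventually_ge_at_top[of n] by eventually_elim (simp add: t_def)
    qed
    have t_le: "norm (t n N) \<le> (norm (b n))\<^sup>2" for n N
      using c2[of N n] by (auto simp: t_def abs_mult intro!: mult_left_le_one_le)
    have "(\<lambda>N. \<Sum>n. t n N) \<longlonglongrightarrow> (\<Sum>n. 0)"
      by (rule tannerys_theorem[THEN conjunct2, THEN conjunct2, OF lim _ b_sum])
         (use t_le in \<open>auto intro!: always_eventually\<close>)
    moreover have "(\<Sum>n. t n N) = r N" for N
      using suminf_finite[of "{..<Suc N}" "\<lambda>n. t n N"] by (simp add: t_def r_def)
    ultimately show ?thesis
      by simp
  qed
  then have "e \<longlonglongrightarrow> 0 + 0"
    unfolding e_def
    using LIMSEQ_Suc[OF suminf_exist_split2[OF b_sum]] by (intro tendsto_add) simp_all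
  then have e: "e \<longlonglongrightarrow> 0"
    by simp
  define T where "T = op_sqrt (integral_rank_one g)"
  have S_pos: "pos_op (S N)" for N
    unfolding S_def by (rule pos_op_diag_op)
  have T_pos: "pos_op T" and T_near: "\<And>N x. norm (S N x - T x) \<le> sqrt (e N) * norm x"
    unfolding T_def by (rule op_sqrt_limit[OF S_pos e near])+
  have T_lin: "bounded_clinear T"
    using T_pos by (simp add: pos_op_def)
  then have T_bl: "bounded_linear T"
    by (simp add: bounded_clinear_def)
  have e0: "0 \<le> sqrt (e N)" for N
    unfolding e_def r_def using c2 b_sum
    by (intro real_sqrt_ge_zero add_nonneg_nonneg sum_nonneg suminf_nonneg mult_nonneg_nonneg)
       (auto simp: summable_iff_shift[of "\<lambda>n. (norm (b n))\<^sup>2" "Suc _", simplified])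
  have sv_le: "singular_value T n \<le> sqrt (e N) + norm (z N n)" if "n < Suc N" for n N
    using singular_value_near_diag_op[OF T_bl, of "Suc N" "z N" "sqrt (e N)" n] T_near[of N] e0 orth(2) dec that
    by (simp add: norm_minus_commute S_def z_def)
  have partial: "(\<Sum>n<m. singular_value T n powr (4/3)) \<le> C powr (4/3)" for m
  proof (rule LIMSEQ_le_const2)
    \<comment> \<open>the error must be subtracted inside the power, where truncation at \<open>0\<close> keeps the base nonnegative\<close>
    have "(\<lambda>N. \<Sum>n<m. max 0 (singular_value T n - sqrt (e N)) powr (4/3))
        \<longlonglongrightarrow> (\<Sum>n<m. max 0 (singular_value T n - sqrt 0) powr (4/3))"
      by (intro tendsto_sum tendsto_powr2 tendsto_max tendsto_diff tendsto_const tendsto_real_sqrt e) auto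
    then show "(\<lambda>N. \<Sum>n<m. max 0 (singular_value T n - sqrt (e N)) powr (4/3))
        \<longlonglongrightarrow> (\<Sum>n<m. singular_value T n powr (4/3))"
      by (simp add: max_absorb2 singular_value_nonneg[OF T_bl])
    have "(\<Sum>n<m. max 0 (singular_value T n - sqrt (e N)) powr (4/3)) \<le> C powr (4/3)" if "m \<le> N" for N
    proof -
      have "(\<Sum>n<m. max 0 (singular_value T n - sqrt (e N)) powr (4/3)) \<le> (\<Sum>n<m. norm (z N n) powr (4/3))"
        using that sv_le[of _ N] by (intro sum_mono powr_mono2) (force simp: algebra_simps)+
      also have "\<dots> \<le> (\<Sum>n<Suc N. norm (z N n) powr (4/3))"
        using that by (intro sum_mono2) auto
      finally show ?thesis
        using stage[of N] by linarith
    qed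
    then show "\<exists>N. \<forall>k\<ge>N. (\<Sum>n<m. max 0 (singular_value T n - sqrt (e k)) powr (4/3)) \<le> C powr (4/3)"
      by blast
  qed
  have T_sum: "summable (\<lambda>n. singular_value T n powr (4/3))"
    by (rule summableI_nonneg_bounded[OF _ partial]) simp
  have "(\<Sum>n. singular_value T n powr (4/3)) \<le> C powr (4/3)"
    by (rule suminf_le_const[OF T_sum partial])
  then have "schatten_norm (4/3) T \<le> (C powr (4/3)) powr (1 / (4/3))"
    unfolding schatten_norm_def by (intro powr_mono2 suminf_nonneg T_sum) auto
  also have "\<dots> = C"
    using C0 by (simp add: powr_powr)
  finally have "schatten_norm (4/3) T \<le> C" .
  moreover have "T \<in> schatten_class (4/3)"
    using T_lin T_sum by (simp add: schatten_class_def)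
  moreover have "represents_conv g f \<phi>"
    using g by (simp add: represents_conv_def b_def)
  ultimately show ?thesis
    unfolding T_def C_def by blast
qed

end
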